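(* Let $U, D_1, D_2 \subset \mathbb{C}$ be simply connected bounded open sets with $\overline{U} \subset D_1 \cap D_2$. Let $\nu_1=\nu_1^{\#\delta}$ and $\nu_2=\nu_2^{\#\delta}$ denote the laws of the restrictions to $U$ of the wired uniform spanning trees of $D_1^{\#\delta}$ and $D_2^{\#\delta}$ respectively. For every $\epsilon>0$ there exists $C = C(U,D_1,D_2,\epsilon)>0$ such that for all $\delta$ small enough $$\nu_1\Big(\frac1C \le \frac{d\nu_1}{d\nu_2}\le C\Big)\ge 1-\epsilon, \qquad \nu_2\Big(\frac1C \le \frac{d\nu_1}{d\nu_2}\le C\Big)\ge 1-\epsilon .$$
   Context: **Graphs.** $(G^{\#\delta})_{\delta>0}$ is a family of oriented, weighted planar graphs (self loops and multiple edges allowed). Weights are transition rates of a continuous time random walk $RW$ on $G^{\#\delta}$, whose law from $v$ is $\mathbb{P}_v$; $q(v\to v')$ denotes the weights normalised so that $\sum_{v'}q(v\to v')=1$. Assume: (i) Good embedding: edges are embedded in the plane as piecewise smooth curves that do not cross each other. (ii) Uniformly bounded density: there is $M>0$ such that for all $\delta>0$, $z\in\mathbb{C}$, the square $z+[0,\delta]^2$ contains at most $M$ vertices. (iii) Connected: for each $\delta$ and all vertices $u,v$ of $G^{\#\delta}$, $\mathbb{P}_u(RW_1=v)>0$. (iv) Uniform crossing: let $\mathcal{R}=[0,3]\times[0,1]$, $B_1=B((1/2,1/2),1/4)$, $B_2=B((5/2,1/2),1/4)$. There are $p_0>0$, $\delta_0>0$ such that for all $z\in\mathbb{C}$, $\eta>0$,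 $\delta\le\eta\delta_0$ and $v\in\eta B_1$ with $z+v$ a vertex of $G^{\#\delta}$, $\mathbb{P}_{z+v}(RW\text{ hits }\eta B_2+z\text{ before exiting }\eta\mathcal{R}+z)>p_0$; the same holds with $B_1,B_2$ exchanged, and for the vertical rectangle $[0,1]\times[0,3]$ with the corresponding balls. **Domains and trees.** For an open set $D$, $D^{\#\delta}$ is the subgraph of $G^{\#\delta}$ formed by the vertices and edges embedded inside $D$ (an edge with both ends in $D$ but meeting $\partial D$ is not included). Wired boundary condition: a cemetery vertex, denoted $\partial D$, with no outgoing transition is added, and every edge of $G^{\#\delta}$ starting in $D^{\#\delta}$ and touching $\partial D$ is replaced by an edge with the same starting point and weight leading to the cemetery. A wired spanning tree of $D^{\#\delta}$ is a set of oriented edges with no cycle in which every vertex other than the cemetery has exactly one outgoing edge (the cemetery has none). The wired uniform spanning tree (UST) is the law with $\mathbb{P}(\mathcal{T})\propto\prod_{(vv')\in\mathcal{T}}q(v\to v')$. Its restriction to $U$ is the set of its edges contained in $U$. The laws are on finite sets, so $d\nu_1/d\nu_2$ at a configuration is the ratio of its masses (with value $+\infty$ if only $\nu_2$ vanishes). *)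

theory Defs
  imports "HOL-Probability.Probability" "Graph_Theory.Arc_Walk"
begin

section \<open>Oriented weighted graphs embedded in the plane\<close>

record 'e plane_graph =
  skel :: "(complex, 'e) pre_digraph"
  weight :: "'e \<Rightarrow> real"
  curve :: "'e \<Rightarrow> real \<Rightarrow> complex"

text \<open>Edges are elements of an arbitrary type, so that loops and multiple edges are allowed.
  The weights are normalised by summing over the outgoing edges of a vertex, which are therefore
  required to be finite in number and to exist.\<close>

definition weighted_graph :: "'e plane_graph \<Rightarrow> bool" where
  "weighted_graph G \<longleftrightarrow>
     wf_digraph (skel G) \<and>
     (\<forall>e\<in>arcs (skel G). 0 < weight G e) \<and>
     (\<forall>v\<in>verts (skel G). finite (out_arcs (skel G) v) \<and> out_arcs (skel G) v \<noteq> {})"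

abbreviation trace :: "'e plane_graph \<Rightarrow> 'e \<Rightarrow> complex set" where
  "trace G e \<equiv> path_image (curve G e)"

definition open_trace :: "'e plane_graph \<Rightarrow> 'e \<Rightarrow> complex set" where
  "open_trace G e = curve G e ` {0<..<1}"

text \<open>Two edges may be drawn along the same curve (for instance the two orientations of an
  unoriented edge); otherwise they meet at most at common endpoints.\<close>

definition good_embedding :: "'e plane_graph \<Rightarrow> bool" where
  "good_embedding G \<longleftrightarrow>
     (\<forall>e\<in>arcs (skel G).
        valid_path (curve G e) \<and> simple_path (curve G e) \<and>
        pathstart (curve G e) = tail (skel G) e \<and> pathfinish (curve G e) = head (skel G) e \<and>
        open_trace G e \<inter> verts (skel G) = {}) \<and>
     (\<forall>e\<in>arcs (skel G). \<forall>e'\<in>arcs (skel G).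
        open_trace G e = open_trace G e' \<or> open_trace G e \<inter> open_trace G e' = {})"

definition bounded_density :: "(real \<Rightarrow> 'e plane_graph) \<Rightarrow> bool" where
  "bounded_density G \<longleftrightarrow>
     (\<exists>M::nat. 0 < M \<and> (\<forall>\<delta>>0. \<forall>z::complex.
        finite (verts (skel (G \<delta>)) \<inter> cbox z (z + Complex \<delta> \<delta>)) \<and>
        card (verts (skel (G \<delta>)) \<inter> cbox z (z + Complex \<delta> \<delta>)) \<le> M))"


section \<open>The continuous time random walk\<close>

definition total_rate :: "'e plane_graph \<Rightarrow> complex \<Rightarrow> real" where
  "total_rate G v = (\<Sum>e\<in>out_arcs (skel G) v. weight G e)"

definition norm_weight :: "'e plane_graph \<Rightarrow> 'e \<Rightarrow> real" where
  "norm_weight G e = weight G e / total_rate G (tail (skel G) e)"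

definition jump_pmf :: "'e plane_graph \<Rightarrow> complex \<Rightarrow> 'e pmf" where
  "jump_pmf G v = embed_pmf (\<lambda>e. if e \<in> out_arcs (skel G) v then norm_weight G e else 0)"

lemma pmf_jump_pmf:
  assumes "weighted_graph G" "v \<in> verts (skel G)"
  shows "pmf (jump_pmf G v) e = (if e \<in> out_arcs (skel G) v then norm_weight G e else 0)"
proof -
  let ?O = "out_arcs (skel G) v"
  let ?f = "\<lambda>e. if e \<in> ?O then norm_weight G e else 0"
  have fin: "finite ?O" and ne: "?O \<noteq> {}" and pos: "\<And>e. e \<in> ?O \<Longrightarrow> 0 < weight G e"
    using assms by (auto simp: weighted_graph_def out_arcs_def)
  have rate: "0 < total_rate G v"
    unfolding total_rate_def using fin ne pos by (rule sum_pos)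
  have tl: "tail (skel G) e = v" if "e \<in> ?O" for e
    using that by (simp add: out_arcs_def)
  have nn: "0 \<le> ?f e" for e
    using pos rate tl by (auto simp: norm_weight_def less_imp_le)
  have "(\<integral>\<^sup>+e. ennreal (?f e) \<partial>count_space UNIV) = (\<Sum>e\<in>?O. ennreal (?f e))"
    by (rule nn_integral_count_space'[OF fin]) auto
  also have "\<dots> = ennreal (\<Sum>e\<in>?O. ?f e)"
    by (rule sum_ennreal) (rule nn)
  also have "(\<Sum>e\<in>?O. ?f e) = (\<Sum>e\<in>?O. weight G e / total_rate G v)"
    by (intro sum.cong refl) (simp add: norm_weight_def tl)
  also have "\<dots> = 1"
    using rate by (simp add: sum_divide_distrib[symmetric] total_rate_def)
  finally have "(\<integral>\<^sup>+x. ennreal (?f x) \<partial>count_space UNIV) = 1"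
    by simp
  then show ?thesis
    unfolding jump_pmf_def by (rule pmf_embed_pmf[of ?f, OF nn])
qed

text \<open>The walk started at \<^term>\<open>u\<close> is described by the sequence \<^term>\<open>\<omega>\<close> of the edges it
  traverses; \<^term>\<open>walk_vertex G u \<omega> n\<close> is its position after \<^term>\<open>n\<close> jumps.\<close>

definition walk_vertex :: "'e plane_graph \<Rightarrow> complex \<Rightarrow> (nat \<Rightarrow> 'e) \<Rightarrow> nat \<Rightarrow> complex" where
  "walk_vertex G u \<omega> n = (case n of 0 \<Rightarrow> u | Suc m \<Rightarrow> head (skel G) (\<omega> m))"

abbreviation jump_kernel :: "'e plane_graph \<Rightarrow> complex \<Rightarrow> nat \<Rightarrow> (nat \<Rightarrow> 'e) \<Rightarrow> 'e measure" where
  "jump_kernel G u n \<omega> \<equiv> measure_pmf (jump_pmf G (walk_vertex G u \<omega> n))"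

lemma Ionescu_Tulcea_jump_kernel:
  "Ionescu_Tulcea (jump_kernel G u) (\<lambda>_. count_space UNIV)"
proof
  fix n :: nat
  show "jump_kernel G u n \<in> measurable (PiM {0..<n} (\<lambda>_. count_space UNIV))
          (subprob_algebra (count_space UNIV))"
  proof (cases n)
    case 0
    show ?thesis
      by (simp add: 0 walk_vertex_def measure_pmf_in_subprob_algebra)
  next
    case (Suc m)
    have "(\<lambda>\<omega>. \<omega> m) \<in> measurable (PiM {0..<n} (\<lambda>_. count_space UNIV)) (count_space UNIV)"
      by (rule measurable_component_singleton) (simp add: Suc)
    moreover have "(\<lambda>e. measure_pmf (jump_pmf G (head (skel G) e)))
        \<in> measurable (count_space UNIV) (subprob_algebra (count_space UNIV))"
      by (simp add: measure_pmf_in_subprob_algebra)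
    ultimately show ?thesis
      unfolding walk_vertex_def Suc nat.case by (rule measurable_compose)
  qed
qed

text \<open>The law of the edge sequence is the infinite product of kernels given by the Ionescu-Tulcea
  theorem.\<close>

definition jump_chain :: "'e plane_graph \<Rightarrow> complex \<Rightarrow> (nat \<Rightarrow> 'e) measure" where
  "jump_chain G u = projective_family.lim UNIV
     (Ionescu_Tulcea.CI (jump_kernel G u) (\<lambda>_. count_space UNIV)) (\<lambda>_. count_space UNIV)"

text \<open>Holding times are \<^term>\<open>\<tau> i / total_rate G v\<close> with \<^term>\<open>\<tau>\<close> a sequence of independent
  standard exponential variables, independent of the edges. A sample of the walk is a pair
  \<^term>\<open>(\<omega>, \<tau>)\<close>.\<close>

definition walk_law :: "'e plane_graph \<Rightarrow> complex \<Rightarrow> ((nat \<Rightarrow> 'e) \<times> (nat \<Rightarrow> real)) measure" where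
  "walk_law G u = jump_chain G u \<Otimes>\<^sub>M (PiM UNIV (\<lambda>_. density lborel (exponential_density 1)))"

lemma prob_space_walk_law: "prob_space (walk_law G u)"
proof -
  interpret IT: Ionescu_Tulcea "jump_kernel G u" "\<lambda>_. count_space UNIV"
    by (rule Ionescu_Tulcea_jump_kernel)
  interpret E: prob_space "density lborel (exponential_density 1)"
    by (rule prob_space_exponential_density) simp
  interpret T: product_prob_space "\<lambda>_. density lborel (exponential_density 1)" "UNIV :: nat set"
    by standard
  interpret L: prob_space "jump_chain G u"
  proof
    have "emeasure IT.PF.lim (prod_emb UNIV (\<lambda>_. count_space UNIV) {}
            (space (PiM {} (\<lambda>_::nat. count_space (UNIV :: 'a set)))))
        = emeasure (IT.CI {}) (space (PiM {} (\<lambda>_::nat. count_space UNIV)))"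
      by (rule IT.lim) auto
    moreover have "emeasure (IT.CI {}) (space (IT.CI {})) = 1"
      by (intro prob_space.emeasure_space_1 IT.PF.prob_space_P) auto
    ultimately show "emeasure (jump_chain G u) (space (jump_chain G u)) = 1"
      by (simp add: jump_chain_def prod_emb_def space_PiM IT.CI_def vimage_def restrict_def)
  qed
  interpret pair_prob_space "jump_chain G u"
    "PiM (UNIV :: nat set) (\<lambda>_. density lborel (exponential_density 1))" ..
  show ?thesis
    unfolding walk_law_def by (rule prob_space_axioms)
qed

definition jump_time ::
    "'e plane_graph \<Rightarrow> complex \<Rightarrow> (nat \<Rightarrow> 'e) \<times> (nat \<Rightarrow> real) \<Rightarrow> nat \<Rightarrow> real" where
  "jump_time G u \<xi> n = (\<Sum>i<n. snd \<xi> i / total_rate G (walk_vertex G u (fst \<xi>) i))"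

text \<open>The walk is at \<^term>\<open>v\<close> at time \<^term>\<open>t\<close>.  Should infinitely many jumps accumulate before
  time \<^term>\<open>t\<close>, the walk is nowhere at time \<^term>\<open>t\<close> (minimal process).\<close>

definition walk_at ::
    "'e plane_graph \<Rightarrow> complex \<Rightarrow> (nat \<Rightarrow> 'e) \<times> (nat \<Rightarrow> real) \<Rightarrow> real \<Rightarrow> complex \<Rightarrow> bool" where
  "walk_at G u \<xi> t v \<longleftrightarrow>
     (\<exists>n. jump_time G u \<xi> n \<le> t \<and> t < jump_time G u \<xi> (Suc n) \<and> walk_vertex G u (fst \<xi>) n = v)"

definition connected_graph :: "'e plane_graph \<Rightarrow> bool" where
  "connected_graph G \<longleftrightarrow> (\<forall>u\<in>verts (skel G). \<forall>v\<in>verts (skel G).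
     0 < measure (walk_law G u) {\<xi> \<in> space (walk_law G u). walk_at G u \<xi> 1 v})"

text \<open>Hitting \<^term>\<open>B\<close> before exiting \<^term>\<open>R\<close>: the walk reaches a vertex in \<^term>\<open>B\<close>, and all edges
  used until then are drawn inside \<^term>\<open>R\<close>. As for the subgraph of a domain below, a jump along an
  edge which is not drawn inside the set leaves the set, even if both its ends are inside.\<close>

definition hits_before_exit ::
    "'e plane_graph \<Rightarrow> complex \<Rightarrow> (nat \<Rightarrow> 'e) \<times> (nat \<Rightarrow> real) \<Rightarrow> complex set \<Rightarrow> complex set \<Rightarrow> bool"
where
  "hits_before_exit G u \<xi> B R \<longleftrightarrow>
     u \<in> R \<and> (\<exists>n. walk_vertex G u (fst \<xi>) n \<in> B \<and> (\<forall>k<n. trace G (fst \<xi> k) \<subseteq> R))"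

definition affine_image :: "complex \<Rightarrow> real \<Rightarrow> complex set \<Rightarrow> complex set" where
  "affine_image z \<eta> S = (\<lambda>x. z + of_real \<eta> * x) ` S"

definition crossing :: "(real \<Rightarrow> 'e plane_graph) \<Rightarrow> real \<Rightarrow> real \<Rightarrow>
    complex set \<Rightarrow> complex set \<Rightarrow> complex set \<Rightarrow> bool" where
  "crossing G p0 \<delta>0 R B B' \<longleftrightarrow>
     (\<forall>z. \<forall>\<eta>>0. \<forall>\<delta>>0. \<delta> \<le> \<eta> * \<delta>0 \<longrightarrow>
        (\<forall>u \<in> verts (skel (G \<delta>)) \<inter> affine_image z \<eta> B.
           p0 < measure (walk_law (G \<delta>) u) {\<xi> \<in> space (walk_law (G \<delta>) u).
                  hits_before_exit (G \<delta>) u \<xi> (affine_image z \<eta> B') (affine_image z \<eta> R)}))"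

definition uniform_crossing :: "(real \<Rightarrow> 'e plane_graph) \<Rightarrow> bool" where
  "uniform_crossing G \<longleftrightarrow>
     (\<exists>p0>0. \<exists>\<delta>0>0.
        let H = cbox 0 (Complex 3 1); V = cbox 0 (Complex 1 3);
            B1 = ball (Complex (1/2) (1/2)) (1/4);
            B2 = ball (Complex (5/2) (1/2)) (1/4);
            B3 = ball (Complex (1/2) (5/2)) (1/4)
        in crossing G p0 \<delta>0 H B1 B2 \<and> crossing G p0 \<delta>0 H B2 B1 \<and>
           crossing G p0 \<delta>0 V B1 B3 \<and> crossing G p0 \<delta>0 V B3 B1)"


section \<open>Wired uniform spanning trees\<close>

text \<open>The cemetery is \<^term>\<open>None\<close>. An edge starting in the open set \<^term>\<open>D\<close> either is drawn inside
  \<^term>\<open>D\<close> or touches the boundary of \<^term>\<open>D\<close>; edges of the second kind are redirected to the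
  cemetery and keep their name.\<close>

definition wired_graph :: "'e plane_graph \<Rightarrow> complex set \<Rightarrow> (complex option, 'e) pre_digraph" where
  "wired_graph G D =
     \<lparr> verts = insert None (Some ` (verts (skel G) \<inter> D)),
       arcs = {e \<in> arcs (skel G). tail (skel G) e \<in> D},
       tail = (\<lambda>e. Some (tail (skel G) e)),
       head = (\<lambda>e. if trace G e \<subseteq> D then Some (head (skel G) e) else None) \<rparr>"

definition wired_trees :: "'e plane_graph \<Rightarrow> complex set \<Rightarrow> 'e set set" where
  "wired_trees G D =
     {T. T \<subseteq> arcs (wired_graph G D) \<and>
         (\<forall>v \<in> verts (wired_graph G D) - {None}. \<exists>!e. e \<in> T \<and> tail (wired_graph G D) e = v) \<and>
         (\<nexists>p. pre_digraph.cycle (wired_graph G D \<lparr> arcs := T \<rparr>) p)}"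

definition tree_weight :: "'e plane_graph \<Rightarrow> 'e set \<Rightarrow> real" where
  "tree_weight G T = (\<Prod>e\<in>T. norm_weight G e)"

definition wired_ust :: "'e plane_graph \<Rightarrow> complex set \<Rightarrow> 'e set pmf" where
  "wired_ust G D = embed_pmf (\<lambda>T.
     if T \<in> wired_trees G D then tree_weight G T / (\<Sum>T'\<in>wired_trees G D. tree_weight G T') else 0)"

lemma pmf_wired_ust:
  assumes G: "weighted_graph G" and fin: "finite (wired_trees G D)" and ne: "wired_trees G D \<noteq> {}"
  shows "pmf (wired_ust G D) T =
    (if T \<in> wired_trees G D then tree_weight G T / (\<Sum>T'\<in>wired_trees G D. tree_weight G T') else 0)"
proof -
  let ?Z = "\<Sum>T'\<in>wired_trees G D. tree_weight G T'"
  let ?f = "\<lambda>T. if T \<in> wired_trees G D then tree_weight G T / ?Z else 0"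
  have qpos: "0 < norm_weight G e" if e: "e \<in> arcs (skel G)" for e
  proof -
    have v: "tail (skel G) e \<in> verts (skel G)"
      using G e by (auto simp: weighted_graph_def wf_digraph_def)
    have "0 < total_rate G (tail (skel G) e)"
      unfolding total_rate_def
      using G v by (intro sum_pos) (auto simp: weighted_graph_def out_arcs_def)
    then show ?thesis
      using G e by (auto simp: norm_weight_def weighted_graph_def)
  qed
  have pos: "0 < tree_weight G T" if "T \<in> wired_trees G D" for T
    unfolding tree_weight_def using that qpos
    by (intro prod_pos) (auto simp: wired_trees_def wired_graph_def)
  have Z: "0 < ?Z"
    using fin ne pos by (rule sum_pos)
  have nn: "0 \<le> ?f T" for T
    using Z pos by (auto simp: less_imp_le)
  have "(\<integral>\<^sup>+T. ennreal (?f T) \<partial>count_space UNIV) = (\<Sum>T\<in>wired_trees G D. ennreal (?f T))"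
    by (rule nn_integral_count_space'[OF fin]) auto
  also have "\<dots> = ennreal (\<Sum>T\<in>wired_trees G D. ?f T)"
    by (rule sum_ennreal) (rule nn)
  also have "(\<Sum>T\<in>wired_trees G D. ?f T) = (\<Sum>T\<in>wired_trees G D. tree_weight G T / ?Z)"
    by (intro sum.cong) auto
  also have "\<dots> = 1"
    using Z by (simp add: sum_divide_distrib[symmetric])
  finally have "(\<integral>\<^sup>+x. ennreal (?f x) \<partial>count_space UNIV) = 1"
    by simp
  then show ?thesis
    unfolding wired_ust_def by (rule pmf_embed_pmf[of ?f, OF nn])
qed

definition restricted_ust :: "'e plane_graph \<Rightarrow> complex set \<Rightarrow> complex set \<Rightarrow> 'e set pmf" where
  "restricted_ust G U D = map_pmf (\<lambda>T. {e \<in> T. trace G e \<subseteq> U}) (wired_ust G D)"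

text \<open>In \<^typ>\<open>ennreal\<close> one has \<open>x / 0 = \<infinity>\<close> for \<open>x \<noteq> 0\<close>, which is the value wanted
  where only the denominator vanishes.\<close>

definition density_ratio :: "'a pmf \<Rightarrow> 'a pmf \<Rightarrow> 'a \<Rightarrow> ennreal" where
  "density_ratio \<nu>1 \<nu>2 x = ennreal (pmf \<nu>1 x) / ennreal (pmf \<nu>2 x)"

end

theory Submission
  imports "HOL-Complex_Analysis.Complex_Analysis" "HOL-Combinatorics.Cycles" "Jordan_Normal_Form.Determinant" Defs
begin

text \<open>By the matrix-tree theorem, the total weight of the wired trees of \<open>D\<close> whose restriction to \<open>U\<close>
  is \<open>F\<close> is a factor depending on \<open>F\<close> only times \<open>det (1 - P)\<close>, where \<open>P\<close> is the kernel of the walk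
  killed on the boundary of \<open>D\<close> and conditioned, inside \<open>U\<close>, to use edges compatible with \<open>F\<close>.
  A ring around \<open>U\<close> inside \<open>D1 \<inter> D2\<close> separates this determinant into a factor which does not depend
  on \<open>F\<close>, a factor which does not depend on \<open>D\<close>, and \<open>det (1 - N)\<close>, where \<open>N\<close> describes the
  excursions between the ring and the part of \<open>D\<close> far outside. All rows of \<open>N\<close> are comparable
  by a Harnack inequality, and the walk escapes with a probability bounded below, so that
  \<open>det (1 - N)\<close> lies between two positive constants. Hence \<open>\<nu>i F = \<kappa>i * w F * di F\<close> with \<open>di F\<close> bounded
  above and below; as both laws have total mass one, \<open>\<kappa>1 / \<kappa>2\<close> is bounded as well, and so is the
  density, at every configuration.

  The Harnack inequality follows from the crossing hypothesis and planarity: if a positive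
  supersolution is small at a vertex, then it is small along a chain of crossings, and such chains
  form loops, which a path of large values to the boundary must meet. Common large scale rings are
  provided by the Riemann map of the component of \<open>D1 \<inter> D2\<close> containing \<open>U\<close>.\<close>

section \<open>Determinants of kernels on a finite set\<close>

text \<open>The number of vertices in the ring is unbounded as the mesh tends to zero, so no
  estimate may depend on the dimension of \<open>N\<close>. Harnack supplies what is needed:
  \<open>N s t \<le> C * N s0 t\<close> for one reference state \<open>s0\<close>, and since the row
  of \<open>s0\<close> has mass at most one, these column bounds sum to at most \<open>C\<close>.
  Row sums at most \<open>r < 1\<close>, the probability of coming back from far outside, then keep
  the determinant away from zero. The independence statements have simple sources. Off
  \<open>U\<close> conditioning on \<open>F\<close> changes nothing, so a determinant over vertices
  off \<open>U\<close> ignores \<open>F\<close>. Edges starting near \<open>U\<close> are drawn in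
  both domains, so a determinant over vertices near \<open>U\<close> ignores the domain. The latter
  needs short edges, and these are deduced from planarity and the crossing estimate. The estimates
  are statements on super- and subsolutions on a graph; the path measure enters them through one
  inequality, which bounds a hitting probability by a supersolution.\<close>

definition vmul :: "'v set \<Rightarrow> ('v \<Rightarrow> 'v \<Rightarrow> real) \<Rightarrow> ('v \<Rightarrow> 'v \<Rightarrow> real) \<Rightarrow> 'v \<Rightarrow> 'v \<Rightarrow> real" where
  "vmul V p q v w = (\<Sum>u\<in>V. p v u * q u w)"

definition vone :: "'v \<Rightarrow> 'v \<Rightarrow> real" where
  "vone v w = (if v = w then 1 else 0)"

text \<open>Leibniz formula over the states themselves. All determinants are taken over one common
  set \<open>V\<close>, and facts on matrices are imported through an arbitrary enumeration of
  \<open>V\<close>.\<close>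

definition vdet :: "'v set \<Rightarrow> ('v \<Rightarrow> 'v \<Rightarrow> real) \<Rightarrow> real" where
  "vdet V p = (\<Sum>\<pi> | \<pi> permutes V. of_int (sign \<pi>) * (\<Prod>v\<in>V. p v (\<pi> v)))"

lemma vdet_cong:
  assumes "\<And>v w. v \<in> V \<Longrightarrow> w \<in> V \<Longrightarrow> p v w = q v w"
  shows "vdet V p = vdet V q"
  unfolding vdet_def
  by (intro sum.cong refl arg_cong2[where f="(*)"] prod.cong assms) (auto simp: permutes_in_image)

definition vmat :: "nat \<Rightarrow> (nat \<Rightarrow> 'v) \<Rightarrow> ('v \<Rightarrow> 'v \<Rightarrow> real) \<Rightarrow> real mat" where
  "vmat n e p = mat n n (\<lambda>(i, j). p (e i) (e j))"

lemma vmat_carrier [simp]: "vmat n e p \<in> carrier_mat n n"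
  by (simp add: vmat_def)

text \<open>Transport along the enumeration is a sign preserving bijection between the permutations
  of the indices and those of \<open>V\<close>.\<close>

lemma vdet_eq_det:
  assumes e: "bij_betw e {0..<n} V"
  shows "vdet V p = det (vmat n e p)"
proof -
  let ?T = "map_permutation {0..<n} e"
  have inj: "inj_on e {0..<n}" and im: "e ` {0..<n} = V"
    using e by (auto simp: bij_betw_def)
  have bij: "bij_betw ?T {\<pi>. \<pi> permutes {0..<n}} {\<pi>. \<pi> permutes V}"
  proof -
    have "bij_betw (\<lambda>\<pi> x. if x \<in> V then e (\<pi> (inv_into {0..<n} e x)) else x)
        {\<pi>. \<pi> permutes {0..<n}} {\<pi>. \<pi> permutes V}"
      by (rule bij_betw_permutations[OF e])
    moreover have "(\<lambda>\<pi> x. if x \<in> V then e (\<pi> (inv_into {0..<n} e x)) else x) = ?T"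
      by (auto simp: fun_eq_iff map_permutation_def restrict_id_def im)
    ultimately show ?thesis by simp
  qed
  have T: "?T \<pi> (e i) = e (\<pi> i)" if "i < n" for \<pi> i
    using that inj by (auto simp: map_permutation_def restrict_id_def)
  have "vdet V p = (\<Sum>\<pi> | \<pi> permutes {0..<n}. of_int (sign (?T \<pi>)) * (\<Prod>v\<in>V. p v (?T \<pi> v)))"
    unfolding vdet_def by (rule sum.reindex_bij_betw[OF bij, symmetric])
  also have "\<dots> = (\<Sum>\<pi> | \<pi> permutes {0..<n}. of_int (sign \<pi>) * (\<Prod>i=0..<n. p (e i) (e (\<pi> i))))"
  proof (rule sum.cong[OF refl])
    fix \<pi> assume "\<pi> \<in> {\<pi>. \<pi> permutes {0..<n}}"
    then have \<pi>: "\<pi> permutes {0..<n}" by simp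
    have "(\<Prod>v\<in>V. p v (?T \<pi> v)) = (\<Prod>i=0..<n. p (e i) (?T \<pi> (e i)))"
      by (rule prod.reindex_bij_betw[OF e, symmetric])
    also have "\<dots> = (\<Prod>i=0..<n. p (e i) (e (\<pi> i)))"
      by (intro prod.cong) (auto simp: T)
    finally show "of_int (sign (?T \<pi>)) * (\<Prod>v\<in>V. p v (?T \<pi> v))
        = of_int (sign \<pi>) * (\<Prod>i=0..<n. p (e i) (e (\<pi> i)))"
      using sign_map_permutation[OF inj \<pi>] by simp
  qed
  also have "\<dots> = det (vmat n e p)"
    by (subst det_def'[OF vmat_carrier]) (auto simp: vmat_def permutes_in_image intro!: sum.cong prod.cong)
  finally show ?thesis .
qed

lemma vmat_vmul:
  assumes e: "bij_betw e {0..<n} V"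
  shows "vmat n e (vmul V p q) = vmat n e p * vmat n e q"
proof (rule eq_matI)
  fix i j assume "i < dim_row (vmat n e p * vmat n e q)" "j < dim_col (vmat n e p * vmat n e q)"
  then have ij: "i < n" "j < n" by (auto simp: vmat_def)
  have "vmul V p q (e i) (e j) = (\<Sum>k=0..<n. p (e i) (e k) * q (e k) (e j))"
    unfolding vmul_def by (rule sum.reindex_bij_betw[OF e, symmetric])
  then show "vmat n e (vmul V p q) $$ (i, j) = (vmat n e p * vmat n e q) $$ (i, j)"
    using ij by (simp add: vmat_def scalar_prod_def)
qed (auto simp: vmat_def)

lemma finite_enumeration:
  assumes "finite V"
  obtains e and n :: nat where "bij_betw e {0..<n} V"
  using ex_bij_betw_nat_finite[OF assms] by blast

lemma vdet_mul:
  assumes "finite V"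
  shows "vdet V (vmul V p q) = vdet V p * vdet V q"
proof -
  obtain e n where e: "bij_betw e {0..<n::nat} V"
    using finite_enumeration[OF assms] .
  show ?thesis
    by (simp add: vdet_eq_det[OF e] vmat_vmul[OF e] det_mult[of _ n])
qed

lemma vdet_diagonal:
  assumes "finite V" "\<And>v w. v \<in> V \<Longrightarrow> w \<in> V \<Longrightarrow> v \<noteq> w \<Longrightarrow> p v w = 0"
  shows "vdet V p = (\<Prod>v\<in>V. p v v)"
proof -
  have zero: "(\<Prod>v\<in>V. p v (\<pi> v)) = 0" if \<pi>: "\<pi> permutes V" "\<pi> \<noteq> id" for \<pi>
  proof -
    obtain v where v: "\<pi> v \<noteq> v" using \<pi>(2) by (auto simp: fun_eq_iff)
    then have "v \<in> V" using permutes_not_in[OF \<pi>(1)] by auto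
    then show ?thesis
      using assms v permutes_in_image[OF \<pi>(1), of v] by (auto intro!: prod_zero bexI[of _ v])
  qed
  have "vdet V p = (\<Sum>\<pi>\<in>{id}. of_int (sign \<pi>) * (\<Prod>v\<in>V. p v (\<pi> v)))"
    unfolding vdet_def
    by (rule sum.mono_neutral_right) (auto simp: finite_permutations assms permutes_id zero)
  then show ?thesis by simp
qed

lemma vdet_inverse:
  assumes "finite V" "vdet V p \<noteq> 0"
  obtains q where "\<And>v w. v \<in> V \<Longrightarrow> w \<in> V \<Longrightarrow> vmul V p q v w = vone v w"
    "\<And>v w. v \<in> V \<Longrightarrow> w \<in> V \<Longrightarrow> vmul V q p v w = vone v w"
proof -
  obtain e n where e: "bij_betw e {0..<n::nat} V"
    using finite_enumeration[OF assms(1)] .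
  have "det (vmat n e p) \<noteq> 0" using assms(2) by (simp add: vdet_eq_det[OF e])
  \<comment> \<open>\<open>b\<close> only fills the extension slot of the ring record; a unit of the
    matrix ring has a two-sided inverse.\<close>
  from det_non_zero_imp_unit[OF vmat_carrier this, where b="()"]
  obtain Q where Q: "Q \<in> carrier_mat n n" "Q * vmat n e p = 1\<^sub>m n" "vmat n e p * Q = 1\<^sub>m n"
    unfolding Units_def ring_mat_def by auto
  define i where "i = inv_into {0..<n} e"
  define q where "q v w = Q $$ (i v, i w)" for v w
  have ie: "i (e k) = k" if "k < n" for k
    using that e by (auto simp: i_def bij_betw_def)
  have vq: "vmat n e q = Q"
    using Q(1) by (auto simp: vmat_def q_def ie intro!: eq_matI)
  have one: "r v w = vone v w" if r: "vmat n e r = 1\<^sub>m n" and vw: "v \<in> V" "w \<in> V" for r v w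
  proof -
    have "v \<in> e ` {0..<n}" "w \<in> e ` {0..<n}" using vw e by (auto simp: bij_betw_def)
    then obtain a b where ab: "a < n" "b < n" "v = e a" "w = e b" by auto
    have "r v w = vmat n e r $$ (a, b)" using ab by (simp add: vmat_def)
    also have "\<dots> = vone v w" unfolding r using ab e
      by (auto simp: vone_def bij_betw_def inj_on_def)
    finally show ?thesis .
  qed
  show thesis
    by (rule that[of q]) (auto intro!: one simp: vmat_vmul[OF e] vq Q)
qed

lemma vdet_nonzeroI:
  assumes V: "finite V"
    and ker: "\<And>u. (\<And>v. v \<in> V \<Longrightarrow> (\<Sum>w\<in>V. p v w * u w) = 0) \<Longrightarrow> \<forall>v\<in>V. u v = 0"
  shows "vdet V p \<noteq> 0"
proof
  assume "vdet V p = 0"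
  obtain e n where e: "bij_betw e {0..<n::nat} V"
    using finite_enumeration[OF V] .
  obtain x where x: "x \<in> carrier_vec n" "x \<noteq> 0\<^sub>v n" "vmat n e p *\<^sub>v x = 0\<^sub>v n"
    using \<open>vdet V p = 0\<close> det_0_iff_vec_prod_zero_field[OF vmat_carrier[of n e p]]
    by (auto simp: vdet_eq_det[OF e])
  define i where "i = inv_into {0..<n} e"
  have ie: "i (e k) = k" if "k < n" for k
    using that e by (auto simp: i_def bij_betw_def)
  have "(\<Sum>w\<in>V. p v w * x $ i w) = 0" if "v \<in> V" for v
  proof -
    have "v \<in> e ` {0..<n}" using that e by (auto simp: bij_betw_def)
    then obtain a where a: "a < n" "v = e a" by auto
    have "(\<Sum>w\<in>V. p v w * x $ i w) = (\<Sum>k=0..<n. p v (e k) * x $ i (e k))"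
      by (rule sum.reindex_bij_betw[OF e, symmetric])
    also have "\<dots> = (vmat n e p *\<^sub>v x) $ a"
      using x(1) a by (simp add: vmat_def scalar_prod_def ie)
    finally show ?thesis using x(3) a by simp
  qed
  then have "\<forall>v\<in>V. x $ i v = 0" by (rule ker)
  then have "x $ k = 0" if "k < n" for k
    using that e ie[OF that] by (force simp: bij_betw_def)
  then have "x = 0\<^sub>v n" using x(1) by (intro eq_vecI) auto
  then show False using x(2) by simp
qed

lemma vdet_one: "finite V \<Longrightarrow> vdet V vone = 1"
  by (subst vdet_diagonal) (auto simp: vone_def)

text \<open>With \<open>M = (1, A; B, 1)\<close> and \<open>E = (1, -A; 0, 1)\<close> both products
  \<open>M * E\<close> and \<open>E * M\<close> are block triangular, with determinants
  \<open>det (1 - B * A)\<close> and \<open>det (1 - A * B)\<close>.\<close>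

lemma vdet_sylvester:
  assumes "finite V"
  shows "vdet V (\<lambda>v w. vone v w - vmul V p q v w) = vdet V (\<lambda>v w. vone v w - vmul V q p v w)"
proof -
  obtain e n where e: "bij_betw e {0..<n::nat} V"
    using finite_enumeration[OF assms] .
  define A where "A = vmat n e p"
  define B where "B = vmat n e q"
  have [simp]: "A \<in> carrier_mat n n" "B \<in> carrier_mat n n" by (auto simp: A_def B_def)
  have eq: "vmat n e (\<lambda>v w. vone v w - vmul V r s v w) = 1\<^sub>m n - vmat n e r * vmat n e s" for r s
  proof (rule eq_matI)
    fix i j assume "i < dim_row (1\<^sub>m n - vmat n e r * vmat n e s)"
      "j < dim_col (1\<^sub>m n - vmat n e r * vmat n e s)"
    then have ij: "i < n" "j < n" by (auto simp: vmat_def)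
    have "e i = e j \<longleftrightarrow> i = j" using e ij by (auto simp: bij_betw_def inj_on_def)
    then show "vmat n e (\<lambda>v w. vone v w - vmul V r s v w) $$ (i, j)
        = (1\<^sub>m n - vmat n e r * vmat n e s) $$ (i, j)"
      using ij unfolding vmat_vmul[OF e, symmetric] by (auto simp: vmat_def vone_def)
  qed (auto simp: vmat_def)
  let ?M = "four_block_mat (1\<^sub>m n) A B (1\<^sub>m n)"
  let ?E = "four_block_mat (1\<^sub>m n) (- A) (0\<^sub>m n n) (1\<^sub>m n)"
  have carr: "?M \<in> carrier_mat (n + n) (n + n)" "?E \<in> carrier_mat (n + n) (n + n)"
    by (auto intro!: four_block_carrier_mat)
  have c: "A \<in> carrier_mat n n" "B \<in> carrier_mat n n" "- A \<in> carrier_mat n n"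
    "1\<^sub>m n \<in> carrier_mat n n" "0\<^sub>m n n \<in> carrier_mat n n"
    by auto
  have BA: "B * A \<in> carrier_mat n n" and AB: "A * B \<in> carrier_mat n n"
    by (rule mult_carrier_mat[OF c(2) c(1)], rule mult_carrier_mat[OF c(1) c(2)])
  have BA': "1\<^sub>m n - B * A \<in> carrier_mat n n" and AB': "1\<^sub>m n - A * B \<in> carrier_mat n n"
    by (rule minus_carrier_mat[OF BA], rule minus_carrier_mat[OF AB])
  have d: "dim_col B = dim_row A" "dim_col A = dim_row B"
    using carrier_matD[OF c(1)] carrier_matD[OF c(2)] by auto
  have neg1: "B * - A + 1\<^sub>m n = 1\<^sub>m n - B * A"
    unfolding uminus_mult_right_mat[OF d(1)] minus_add_uminus_mat[OF c(4) BA]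
    by (rule comm_add_mat[of _ n n]) (use BA in auto)
  have neg2: "1\<^sub>m n + - A * B = 1\<^sub>m n - A * B"
    unfolding uminus_mult_left_mat[OF d(2)] by (rule add_uminus_minus_mat[OF c(4) AB])
  have neg3: "A + - A = 0\<^sub>m n n"
    unfolding add_uminus_minus_mat[OF c(1) c(1)] using c(1) by auto
  note bl = left_mult_one_mat[OF c(1)] left_mult_one_mat[OF c(2)] left_mult_one_mat[OF c(3)]
    right_mult_one_mat[OF c(1)] right_mult_one_mat[OF c(2)] right_mult_one_mat[OF c(3)]
    left_mult_zero_mat[OF c(1)] left_mult_zero_mat[OF c(2)] right_mult_zero_mat[OF c(1)]
    right_mult_zero_mat[OF c(2)] left_add_zero_mat[OF c(1)] left_add_zero_mat[OF c(2)]
    right_add_zero_mat[OF c(1)] right_add_zero_mat[OF c(2)] uminus_l_inv_mat[OF c(1)] neg1 neg2 neg3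
    left_mult_one_mat[OF c(4)] right_add_zero_mat[OF c(4)] left_add_zero_mat[OF c(4)]
    left_mult_zero_mat[OF c(4)] right_mult_zero_mat[OF c(4)]
  have ME: "?M * ?E = four_block_mat (1\<^sub>m n) (0\<^sub>m n n) B (1\<^sub>m n - B * A)"
    unfolding mult_four_block_mat[OF c(4) c(1) c(2) c(4) c(4) c(3) c(5) c(4)] bl ..
  have EM: "?E * ?M = four_block_mat (1\<^sub>m n - A * B) (0\<^sub>m n n) B (1\<^sub>m n)"
    unfolding mult_four_block_mat[OF c(4) c(3) c(5) c(4) c(4) c(1) c(2) c(4)] bl ..
  have "det (1\<^sub>m n - B * A) = det (?M * ?E)"
    unfolding ME by (subst det_four_block_mat_upper_right_zero[of _ n _ n]) (use c AB' BA' in auto)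
  also have "\<dots> = det (?E * ?M)"
    using carr by (simp add: det_mult[of _ "n+n"])
  also have "\<dots> = det (1\<^sub>m n - A * B)"
    unfolding EM by (subst det_four_block_mat_upper_right_zero[of _ n _ n]) (use c AB' BA' in auto)
  finally show ?thesis
    unfolding vdet_eq_det[OF e] eq A_def B_def by simp
qed

text \<open>The outer product is factored through a single state \<open>t\<close>: one factor has
  only column \<open>t\<close>, the other only row \<open>t\<close>. In the opposite order their
  product lives at the entry \<open>(t, t)\<close>, so Sylvester's identity leaves a diagonal
  determinant.\<close>

lemma vdet_rank_one:
  assumes V: "finite V"
  shows "vdet V (\<lambda>v w. vone v w - g v * r w) = 1 - (\<Sum>u\<in>V. r u * g u)"
proof (cases "V = {}")
  case True then show ?thesis by (simp add: vdet_def)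
next
  case False
  then obtain t where t: "t \<in> V" by auto
  let ?A = "\<lambda>v w. g v * vone w t" and ?B = "\<lambda>v w. vone v t * r w"
  have "vdet V (\<lambda>v w. vone v w - g v * r w) = vdet V (\<lambda>v w. vone v w - vmul V ?A ?B v w)"
    by (rule vdet_cong) (use V t in \<open>auto simp: vmul_def vone_def if_distrib if_distribR cong: if_cong\<close>)
  also have "\<dots> = vdet V (\<lambda>v w. vone v w - vmul V ?B ?A v w)"
    by (rule vdet_sylvester[OF V])
  also have "\<dots> = (\<Prod>v\<in>V. vone v v - vmul V ?B ?A v v)"
    by (rule vdet_diagonal[OF V]) (auto simp: vmul_def vone_def)
  also have "\<dots> = (\<Prod>v\<in>V. if v = t then 1 - (\<Sum>u\<in>V. r u * g u) else 1)"
    by (rule prod.cong) (auto simp: vmul_def vone_def)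
  also have "\<dots> = 1 - (\<Sum>u\<in>V. r u * g u)"
    using V t by simp
  finally show ?thesis .
qed

section \<open>Substochastic kernels\<close>

text \<open>A path of positive weight that stays in \<open>A\<close> until it loses mass or leaves
  \<open>A\<close>. This finite certificate takes the place of statements about the walk leaving
  \<open>A\<close> almost surely.\<close>

inductive escapes :: "'v set \<Rightarrow> ('v \<Rightarrow> 'v \<Rightarrow> real) \<Rightarrow> 'v set \<Rightarrow> 'v \<Rightarrow> bool"
  for V P A where
  die: "v \<in> A \<Longrightarrow> (\<Sum>w\<in>V. P v w) < 1 \<Longrightarrow> escapes V P A v"
| leave: "v \<in> A \<Longrightarrow> w \<in> V \<Longrightarrow> 0 < P v w \<Longrightarrow> w \<notin> A \<Longrightarrow> escapes V P A v"
| step: "v \<in> A \<Longrightarrow> w \<in> V \<Longrightarrow> 0 < P v w \<Longrightarrow> escapes V P A w \<Longrightarrow> escapes V P A v"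

lemma escapes_subset:
  assumes "escapes V P A v" "v \<in> A'" "A' \<subseteq> A"
  shows "escapes V P A' v"
  using assms(1,2)
proof induction
  case (die v) then show ?case by (intro escapes.die)
next
  case (leave v w) then show ?case using assms(3) by (blast intro: escapes.leave)
next
  case (step v w) then show ?case using assms(3) by (blast intro: escapes.leave escapes.step)
qed

text \<open>Rows outside \<open>A\<close> are those of the identity, so the determinant over
  \<open>V\<close> is the principal minor of \<open>1 - P\<close> on \<open>A\<close>. Minors for
  different \<open>A\<close> thereby live on one index set and can be multiplied as
  matrices.\<close>

definition lap :: "'v set \<Rightarrow> ('v \<Rightarrow> 'v \<Rightarrow> real) \<Rightarrow> 'v \<Rightarrow> 'v \<Rightarrow> real" where
  "lap A P v w = vone v w - (if v \<in> A then P v w else 0)"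

lemma sum_vone [simp]: "finite V \<Longrightarrow> (\<Sum>w\<in>V. vone v w * u w) = (if v \<in> V then u v else 0)"
proof -
  have "vone v w * u w = (if v = w then u w else 0)" for w by (simp add: vone_def)
  then show "finite V \<Longrightarrow> ?thesis" by simp
qed

lemma sum_vone' [simp]: "finite V \<Longrightarrow> (\<Sum>w\<in>V. u w * vone w v) = (if v \<in> V then u v else 0)"
proof -
  have "u w * vone w v = (if w = v then u w else 0)" for w by (simp add: vone_def)
  then show "finite V \<Longrightarrow> ?thesis" by simp
qed

lemma sum_lap:
  assumes "finite V" "v \<in> V"
  shows "(\<Sum>w\<in>V. lap A P v w * u w) = u v - (if v \<in> A then \<Sum>w\<in>V. P v w * u w else 0)"
  using assms by (simp add: lap_def left_diff_distrib sum_subtractf)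

locale substochastic =
  fixes V :: "'v set" and P :: "'v \<Rightarrow> 'v \<Rightarrow> real"
  assumes finite_V: "finite V"
    and nonneg: "\<And>v w. v \<in> V \<Longrightarrow> w \<in> V \<Longrightarrow> 0 \<le> P v w"
    and row_le_1: "\<And>v. v \<in> V \<Longrightarrow> (\<Sum>w\<in>V. P v w) \<le> 1"
begin

text \<open>At a maximum above \<open>c\<close> the mean forces every successor of positive weight
  to be maximal and the row to have full mass. Hence, by induction along \<open>escapes\<close>, no
  point with an escape path is such a maximum. Lost mass counts as value zero, which is why
  \<open>c\<close> is nonnegative.\<close>

lemma maximum_principle:
  assumes A: "A \<subseteq> V" and esc: "\<And>v. v \<in> A \<Longrightarrow> escapes V P A v"
    and sub: "\<And>v. v \<in> A \<Longrightarrow> u v \<le> (\<Sum>w\<in>V. P v w * u w)"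
    and bd: "\<And>v. v \<in> V - A \<Longrightarrow> u v \<le> c" and c: "0 \<le> c" and v: "v \<in> V"
  shows "u v \<le> c"
proof (rule ccontr)
  assume neg: "\<not> u v \<le> c"
  define M where "M = Max (u ` V)"
  have le: "u w \<le> M" if "w \<in> V" for w
    unfolding M_def using that finite_V by auto
  have M: "c < M" using neg le[OF v] by simp
  have esc': "u w \<noteq> M" if "escapes V P A w" for w
    using that
  proof induction
    case (die x)
    have "u x \<le> (\<Sum>w\<in>V. P x w * u w)" using sub die by blast
    also have "\<dots> \<le> (\<Sum>w\<in>V. P x w * M)"
      using die A nonneg le by (intro sum_mono mult_left_mono) auto
    also have "\<dots> = (\<Sum>w\<in>V. P x w) * M" by (simp add: sum_distrib_right)
    also have "\<dots> < 1 * M" using die M c by (intro mult_strict_right_mono) auto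
    finally show ?case by simp
  next
    have lt: "u x < M" if x: "x \<in> A" "w \<in> V" "0 < P x w" "u w < M" for x w
    proof -
      have "u x \<le> (\<Sum>w\<in>V. P x w * u w)" using sub x by blast
      also have "\<dots> < (\<Sum>w\<in>V. P x w * M)"
        using x A nonneg le finite_V
        by (intro sum_strict_mono_ex1 bexI[of _ w]) (auto intro!: mult_left_mono)
      also have "\<dots> = (\<Sum>w\<in>V. P x w) * M" by (simp add: sum_distrib_right)
      also have "\<dots> \<le> 1 * M" using x A row_le_1 M c by (intro mult_right_mono) auto
      finally show ?thesis by simp
    qed
    { case (leave x w)
      then have "u w < M" using bd[of w] M by auto
      then show ?case using lt[of x w] leave by auto
    next
      case (step x w)
      then have "u w < M" using le[of w] by auto
      then show ?case using lt[of x w] step by auto }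
  qed
  obtain w where w: "w \<in> V" "u w = M"
  proof -
    have "M \<in> u ` V" unfolding M_def using finite_V v by (intro Max_in) auto
    then show thesis using that by auto
  qed
  have "w \<notin> A" using esc' esc w by blast
  then show False using bd[of w] w M by auto
qed

text \<open>A vector in the kernel is harmonic on \<open>A\<close> and zero off \<open>A\<close>;
  the maximum principle applies to it and to its negative.\<close>

lemma lap_nonsingular:
  assumes A: "A \<subseteq> V" and esc: "\<And>v. v \<in> A \<Longrightarrow> escapes V P A v"
  shows "vdet V (lap A P) \<noteq> 0"
proof (rule vdet_nonzeroI[OF finite_V])
  fix u assume u: "\<And>v. v \<in> V \<Longrightarrow> (\<Sum>w\<in>V. lap A P v w * u w) = 0"
  have eq: "u v = (if v \<in> A then \<Sum>w\<in>V. P v w * u w else 0)" if "v \<in> V" for v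
    using u[OF that] by (simp add: sum_lap finite_V that split: if_splits)
  have "u v \<le> 0" if "v \<in> V" for v
    by (rule maximum_principle[OF A esc _ _ _ that]) (use eq A in auto)
  moreover have "- u v \<le> 0" if "v \<in> V" for v
    by (rule maximum_principle[OF A esc, where u="\<lambda>v. - u v", OF _ _ _ _ that])
      (use eq A in \<open>auto simp: sum_negf\<close>)
  ultimately show "\<forall>v\<in>V. u v = 0" by force
qed

text \<open>The exit law: \<open>h v w\<close> is the probability that the walk from
  \<open>v\<close> leaves \<open>A\<close> at \<open>w\<close>. Columns in \<open>A\<close> are
  zero, so that products with other kernels can be summed over all of \<open>V\<close>; the rows
  fall short of one by the probability of dying in \<open>A\<close>.\<close>

definition hitting_kernel :: "'v set \<Rightarrow> ('v \<Rightarrow> 'v \<Rightarrow> real) \<Rightarrow> bool" where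
  "hitting_kernel A h \<longleftrightarrow>
     (\<forall>v\<in>A. \<forall>w\<in>V. h v w = (\<Sum>u\<in>V. P v u * h u w)) \<and>
     (\<forall>v\<in>V - A. \<forall>w. h v w = vone v w) \<and> (\<forall>v. \<forall>w\<in>A. h v w = 0) \<and>
     (\<forall>v\<in>V. \<forall>w\<in>V. 0 \<le> h v w) \<and> (\<forall>v\<in>V. (\<Sum>w\<in>V. h v w) \<le> 1)"

lemma hitting_kernelD:
  assumes "hitting_kernel A h"
  shows "v \<in> A \<Longrightarrow> w \<in> V \<Longrightarrow> h v w = (\<Sum>u\<in>V. P v u * h u w)"
    "v \<in> V - A \<Longrightarrow> h v w = vone v w" "w \<in> A \<Longrightarrow> h v w = 0"
    "v \<in> V \<Longrightarrow> w \<in> V \<Longrightarrow> 0 \<le> h v w" "v \<in> V \<Longrightarrow> (\<Sum>w\<in>V. h v w) \<le> 1"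
  using assms unfolding hitting_kernel_def by blast+

lemma ex_hitting_kernel:
  assumes A: "A \<subseteq> V" and esc: "\<And>v. v \<in> A \<Longrightarrow> escapes V P A v"
  shows "\<exists>h. hitting_kernel A h"
proof -
  obtain q where q: "\<And>v w. v \<in> V \<Longrightarrow> w \<in> V \<Longrightarrow> vmul V (lap A P) q v w = vone v w"
    using vdet_inverse[OF finite_V lap_nonsingular[OF A esc]] by metis
  \<comment> \<open>A column \<open>w\<close> off \<open>A\<close> of the inverse of
    \<open>lap A P\<close> solves the Dirichlet problem with boundary value one at \<open>w\<close>.
    The columns in \<open>A\<close> are Green's functions and are discarded.\<close>
  define h where "h v w = (if w \<in> A then 0 else if v \<in> A then q v w else vone v w)" for v w
  have q1: "q v w = vone v w + (if v \<in> A then \<Sum>u\<in>V. P v u * q u w else 0)" if "v \<in> V" "w \<in> V" for v w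
    using q[OF that] by (simp add: vmul_def sum_lap finite_V that)
  have q2: "q v w = vone v w" if "v \<in> V - A" "w \<in> V" for v w
    using q1[of v w] that by auto
  have 1: "h v w = (\<Sum>u\<in>V. P v u * h u w)" if "v \<in> A" "w \<in> V" for v w
  proof (cases "w \<in> A")
    case True then show ?thesis by (simp add: h_def)
  next
    case False
    then have "h v w = (\<Sum>u\<in>V. P v u * q u w)"
      using q1[of v w] that A by (auto simp: h_def vone_def)
    also have "\<dots> = (\<Sum>u\<in>V. P v u * h u w)"
      using False that q2 by (intro sum.cong) (auto simp: h_def)
    finally show ?thesis .
  qed
  have 2: "h v w = vone v w" if "v \<in> V - A" for v w
    using that by (auto simp: h_def vone_def)
  have 4: "0 \<le> h v w" if "v \<in> V" "w \<in> V" for v w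
  proof -
    have "- h v w \<le> 0"
      by (rule maximum_principle[OF A esc, where u="\<lambda>v. - h v w", OF _ _ _ _ that(1)])
        (use 1 2 that(2) in \<open>auto simp: sum_negf vone_def\<close>)
    then show ?thesis by simp
  qed
  have 5: "(\<Sum>w\<in>V. h v w) \<le> 1" if "v \<in> V" for v
  proof (rule maximum_principle[OF A esc, where u="\<lambda>v. \<Sum>w\<in>V. h v w", OF _ _ _ _ that])
    fix v assume v: "v \<in> A"
    have "(\<Sum>w\<in>V. h v w) = (\<Sum>w\<in>V. \<Sum>u\<in>V. P v u * h u w)"
      using 1[OF v] by simp
    also have "\<dots> = (\<Sum>u\<in>V. P v u * (\<Sum>w\<in>V. h u w))"
      by (subst sum.swap) (simp add: sum_distrib_left)
    finally show "(\<Sum>w\<in>V. h v w) \<le> (\<Sum>u\<in>V. P v u * (\<Sum>w\<in>V. h u w))" by simp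
  next
    fix v assume "v \<in> V - A"
    then have "(\<Sum>w\<in>V. h v w) = (\<Sum>w\<in>V. vone v w * 1)" using 2 by simp
    also have "\<dots> \<le> 1" by (subst sum_vone) (use finite_V in auto)
    finally show "(\<Sum>w\<in>V. h v w) \<le> 1" .
  qed auto
  have "hitting_kernel A h"
    unfolding hitting_kernel_def using 1 2 4 5 by (simp add: h_def)
  then show ?thesis by blast
qed

end

text \<open>\<open>g\<close> is column \<open>t\<close> of the inverse of \<open>lap A N\<close>,
  the probability of reaching \<open>t\<close> through \<open>A\<close>. Since
  \<open>lap (insert t A) N\<close> is \<open>lap A N\<close> times a rank one perturbation of the
  identity, admitting \<open>t\<close> multiplies the determinant by one minus the probability of
  returning to \<open>t\<close> through \<open>A\<close>.\<close>

lemma vdet_insert: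
  assumes V: "finite V" and t: "t \<in> V" "t \<notin> A"
    and g: "\<And>v. v \<in> V \<Longrightarrow> g v - (if v \<in> A then \<Sum>u\<in>V. N v u * g u else 0) = vone v t"
  shows "vdet V (lap (insert t A) N) = (1 - (\<Sum>u\<in>V. N t u * g u)) * vdet V (lap A N)"
proof -
  have "vdet V (lap (insert t A) N) = vdet V (vmul V (lap A N) (\<lambda>v w. vone v w - g v * N t w))"
  proof (rule vdet_cong)
    fix v w assume vw: "v \<in> V" "w \<in> V"
    have "vmul V (lap A N) (\<lambda>v w. vone v w - g v * N t w) v w
        = (\<Sum>u\<in>V. lap A N v u * vone u w) - (\<Sum>u\<in>V. lap A N v u * g u) * N t w"
      by (simp add: vmul_def right_diff_distrib sum_subtractf sum_distrib_right mult.assoc)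
    also have "\<dots> = lap A N v w - vone v t * N t w"
      using g[OF vw(1)] vw V by (simp add: sum_lap)
    also have "\<dots> = lap (insert t A) N v w"
      using t by (auto simp: lap_def vone_def)
    finally show "lap (insert t A) N v w = vmul V (lap A N) (\<lambda>v w. vone v w - g v * N t w) v w" ..
  qed
  then show ?thesis by (simp add: vdet_mul[OF V] vdet_rank_one[OF V])
qed

text \<open>From \<open>ln (1 - x) \<ge> - x / (1 - x)\<close>. A product of factors
  \<open>1 - x\<close> is thus controlled by the sum of the \<open>x\<close>, however many there
  are.\<close>

lemma one_minus_ge_exp:
  fixes x r :: real
  assumes "0 \<le> x" "x \<le> r" "r < 1"
  shows "exp (- (x / (1 - r))) \<le> 1 - x"
proof -
  have "1 + x / (1 - x) \<le> exp (x / (1 - x))" by (rule exp_ge_add_one_self)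
  then have "1 / (1 - x) \<le> exp (x / (1 - x))" using assms by (simp add: field_simps)
  then have "inverse (exp (x / (1 - x))) \<le> inverse (1 / (1 - x))"
    using assms by (intro le_imp_inverse_le) auto
  then have *: "exp (- (x / (1 - x))) \<le> 1 - x" by (simp add: exp_minus)
  have "x / (1 - x) \<le> x / (1 - r)"
    using assms by (intro divide_left_mono) auto
  then have "exp (- (x / (1 - r))) \<le> exp (- (x / (1 - x)))" by simp
  then show ?thesis using * by (rule order_trans)
qed

text \<open>Eliminating the states of \<open>S\<close> one by one multiplies the determinant by one minus a return
  probability, which is controlled by \<open>\<mu>\<close>.\<close>

lemma vdet_ge_exp:
  assumes V: "finite V" and S: "S \<subseteq> V"
    and N0: "\<And>v w. v \<in> V \<Longrightarrow> w \<in> V \<Longrightarrow> 0 \<le> N v w"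
    and row: "\<And>v. v \<in> S \<Longrightarrow> (\<Sum>w\<in>V. N v w) \<le> r" and r: "0 \<le> r" "r < 1"
    and \<mu>: "\<And>s t. s \<in> S \<Longrightarrow> t \<in> S \<Longrightarrow> N s t \<le> \<mu> t" and \<mu>0: "\<And>t. t \<in> S \<Longrightarrow> 0 \<le> \<mu> t"
  shows "exp (- ((\<Sum>t\<in>S. \<mu> t) / (1 - r)^2)) \<le> vdet V (lap S N) \<and> vdet V (lap S N) \<le> 1"
proof -
  have "finite S" using S V finite_subset by blast
  have sub: "substochastic V (\<lambda>v w. if v \<in> S then N v w else 0)"
  proof
    show "(\<Sum>w\<in>V. if v \<in> S then N v w else 0) \<le> 1" for v
      using row[of v] r by (cases "v \<in> S") auto
  qed (use V N0 in auto)
  interpret substochastic V "\<lambda>v w. if v \<in> S then N v w else 0" by (rule sub)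
  have esc: "escapes V (\<lambda>v w. if v \<in> S then N v w else 0) A v" if "v \<in> A" "A \<subseteq> S" for v A
    using that row[of v] r by (intro escapes.die) auto
  have lapeq: "lap A (\<lambda>v w. if v \<in> S then N v w else 0) = lap A N" if "A \<subseteq> S" for A
    using that by (auto simp: lap_def fun_eq_iff)
  have "exp (- ((\<Sum>t\<in>A. \<mu> t) / (1 - r)^2)) \<le> vdet V (lap A N) \<and> vdet V (lap A N) \<le> 1" if "A \<subseteq> S" for A
    using finite_subset[OF that \<open>finite S\<close>] that
  proof (induction A rule: finite_induct)
    case empty
    have "vdet V (lap {} N) = 1"
      unfolding vdet_one[OF V, symmetric] by (rule vdet_cong) (simp add: lap_def)
    then show ?case by simp
  next
    case (insert t A)
    have AS: "A \<subseteq> S" "t \<in> S" and AV: "A \<subseteq> V" and tV: "t \<in> V" using insert S by auto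
    obtain q where q: "\<And>v w. v \<in> V \<Longrightarrow> w \<in> V \<Longrightarrow> vmul V (lap A N) q v w = vone v w"
      using vdet_inverse[OF V lap_nonsingular[OF AV esc[OF _ AS(1)], unfolded lapeq[OF AS(1)]]] by metis
    define g where "g v = q v t" for v
    have g: "g v = (if v \<in> A then \<Sum>u\<in>V. N v u * g u else 0) + vone v t" if "v \<in> V" for v
      using q[OF that tV] unfolding vmul_def sum_lap[OF V that] g_def by argo
    have g_out: "g v = vone v t" if "v \<in> V - A" for v using g[of v] that by auto
    have g_in: "g v = (\<Sum>u\<in>V. N v u * g u)" if "v \<in> A" for v
      using g[of v] that insert.hyps(2) AV by (auto simp: vone_def)
    have "- g v \<le> 0" if "v \<in> V" for v
      by (rule maximum_principle[OF AV esc[OF _ AS(1)], where u="\<lambda>v. - g v", OF _ _ _ _ that])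
        (use g_in g_out AS in \<open>auto simp: sum_negf vone_def subset_iff\<close>)
    then have g0: "0 \<le> g v" if "v \<in> V" for v using that by force
    have g1: "g v \<le> 1" if "v \<in> V" for v
      by (rule maximum_principle[OF AV esc[OF _ AS(1)] _ _ _ that])
        (use g_in g_out AS in \<open>auto simp: vone_def subset_iff\<close>)
    have split: "(\<Sum>u\<in>V. N v u * g u) \<le> \<mu> t + r * m"
      if m: "0 \<le> m" "\<And>u. u \<in> A \<Longrightarrow> g u \<le> m" and v: "v \<in> S" for v m
    proof -
      have "(\<Sum>u\<in>V. N v u * g u) = N v t * g t + (\<Sum>u\<in>V-{t}. N v u * g u)"
        using V tV by (simp add: sum.remove)
      also have "\<dots> \<le> \<mu> t + (\<Sum>u\<in>V-{t}. N v u * m)"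
      proof (intro add_mono sum_mono mult_left_mono)
        show "N v t * g t \<le> \<mu> t" using \<mu>[OF v AS(2)] g_out[of t] tV insert.hyps(2) by (simp add: vone_def)
        show "g u \<le> m" if "u \<in> V - {t}" for u
          using that m g_out[of u] by (cases "u \<in> A") (auto simp: vone_def)
        show "0 \<le> N v u" if "u \<in> V - {t}" for u using that N0 v S by auto
      qed
      also have "(\<Sum>u\<in>V-{t}. N v u * m) \<le> (\<Sum>u\<in>V. N v u * m)"
        using V v S N0 m by (intro sum_mono2) auto
      also have "\<dots> = (\<Sum>u\<in>V. N v u) * m" by (simp add: sum_distrib_right)
      also have "\<dots> \<le> r * m" using row[OF v] m by (intro mult_right_mono)
      finally show ?thesis by simp
    qed
    \<comment> \<open>A self-improving bound: a step from \<open>A\<close> enters \<open>t\<close>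
      with probability at most \<open>\<mu> t\<close>, and the rest of the row has mass at most
      \<open>r\<close> and meets values of \<open>g\<close> at most \<open>m\<close>, so
      \<open>m \<le> \<mu> t + r * m\<close>. Zero is inserted in case \<open>A\<close> is
      empty.\<close>
    define m where "m = Max (insert 0 (g ` A))"
    have m0: "0 \<le> m" and m: "\<And>u. u \<in> A \<Longrightarrow> g u \<le> m"
      unfolding m_def using insert.hyps(1) by auto
    have "m \<in> insert 0 (g ` A)" unfolding m_def by (rule Max_in) (use insert.hyps(1) in auto)
    then have "m \<le> \<mu> t + r * m"
    proof
      assume "m = 0" then show ?thesis using \<mu>0[OF AS(2)] by simp
    next
      assume "m \<in> g ` A"
      then obtain s where s: "s \<in> A" "m = g s" by auto
      then show ?thesis using split[OF m0 m, of s] g_in[OF s(1)] AS by auto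
    qed
    then have mle: "m \<le> \<mu> t / (1 - r)" using r by (simp add: field_simps)
    \<comment> \<open>The return probability of \<open>t\<close>: at most
      \<open>\<mu> t / (1 - r)\<close> by the bound on \<open>g\<close>, and at most
      \<open>r\<close> by its first step. The second factor \<open>1 / (1 - r)\<close> in the claim
      is the cost of \<open>one_minus_ge_exp\<close>.\<close>
    define \<rho> where "\<rho> = (\<Sum>u\<in>V. N t u * g u)"
    have "\<rho> \<le> \<mu> t + r * m" unfolding \<rho>_def by (rule split[OF m0 m AS(2)])
    also have "\<dots> \<le> \<mu> t + r * (\<mu> t / (1 - r))" using mle r by (intro add_left_mono mult_left_mono)
    also have "\<dots> = \<mu> t / (1 - r)" using r by (simp add: field_simps)
    finally have \<rho>1: "\<rho> \<le> \<mu> t / (1 - r)" .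
    have \<rho>0: "0 \<le> \<rho>" unfolding \<rho>_def using N0 tV g0 by (intro sum_nonneg) auto
    have "\<rho> \<le> (\<Sum>u\<in>V. N t u * 1)" unfolding \<rho>_def
      using N0 tV g1 by (intro sum_mono mult_left_mono) auto
    also have "\<dots> \<le> r" using row[OF AS(2)] by simp
    finally have \<rho>r: "\<rho> \<le> r" .
    have "exp (- (\<mu> t / (1 - r)^2)) \<le> exp (- (\<rho> / (1 - r)))"
      using divide_right_mono[OF \<rho>1, of "1 - r"] r by (simp add: power2_eq_square)
    also have "\<dots> \<le> 1 - \<rho>" by (rule one_minus_ge_exp[OF \<rho>0 \<rho>r r(2)])
    finally have fac: "exp (- (\<mu> t / (1 - r)^2)) \<le> 1 - \<rho>" .
    have det: "vdet V (lap (insert t A) N) = (1 - \<rho>) * vdet V (lap A N)"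
      unfolding \<rho>_def
    proof (rule vdet_insert[OF V tV insert.hyps(2)])
      show "g v - (if v \<in> A then \<Sum>u\<in>V. N v u * g u else 0) = vone v t" if "v \<in> V" for v
        using g[OF that] by argo
    qed
    have IH: "exp (- ((\<Sum>t\<in>A. \<mu> t) / (1 - r)^2)) \<le> vdet V (lap A N)" "vdet V (lap A N) \<le> 1"
      using insert.IH AS by auto
    have "exp (- ((\<Sum>t\<in>insert t A. \<mu> t) / (1 - r)^2))
        = exp (- (\<mu> t / (1 - r)^2)) * exp (- ((\<Sum>t\<in>A. \<mu> t) / (1 - r)^2))"
      using insert.hyps(1,2) by (simp add: add_divide_distrib exp_add[symmetric])
    also have "\<dots> \<le> (1 - \<rho>) * vdet V (lap A N)"
      by (rule mult_mono[OF fac IH(1)]) (use \<rho>r r in auto)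
    finally have low: "exp (- ((\<Sum>t\<in>insert t A. \<mu> t) / (1 - r)^2)) \<le> vdet V (lap (insert t A) N)"
      by (simp add: det)
    have "(1 - \<rho>) * vdet V (lap A N) \<le> 1 * 1"
      by (rule mult_mono[OF _ IH(2) _ order_trans[OF exp_ge_zero IH(1)]]) (use \<rho>0 in auto)
    then have "vdet V (lap (insert t A) N) \<le> 1" unfolding det by simp
    with low show ?case by blast
  qed
  from this[OF subset_refl] show ?thesis .
qed

text \<open>Used with \<open>\<pi>\<close>, \<open>\<alpha>\<close>, \<open>\<beta>\<close>,
  \<open>\<gamma>\<close> equal to \<open>lap A P\<close> for \<open>A\<close> equal to
  \<open>V\<close>, \<open>V - S\<close>, \<open>V - B\<close>, \<open>V - S - B\<close>. The
  hypotheses give \<open>\<alpha> (1 - Y) = \<pi>\<close> and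
  \<open>\<beta> (1 - X Y) = \<gamma> (1 - Y)\<close>; determinants are taken and
  \<open>1 - Y\<close> is eliminated. In terms of loop measures, the determinant of
  \<open>1 - X Y\<close> is the exponential of minus the mass of the loops that visit both
  \<open>S\<close> and \<open>B\<close>.\<close>

lemma vdet_two_sided_split:
  assumes V: "finite V"
    and X: "\<And>v w. v \<in> V \<Longrightarrow> w \<in> V \<Longrightarrow> vmul V \<beta> X v w = \<beta> v w - \<pi> v w"
    and Y: "\<And>v w. v \<in> V \<Longrightarrow> w \<in> V \<Longrightarrow> vmul V \<alpha> Y v w = \<alpha> v w - \<pi> v w"
    and \<gamma>: "\<And>v w. v \<in> V \<Longrightarrow> w \<in> V \<Longrightarrow> \<gamma> v w = \<alpha> v w + \<beta> v w - \<pi> v w"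
    and \<alpha>: "vdet V \<alpha> \<noteq> 0"
  shows "vdet V \<alpha> * vdet V \<beta> * vdet V (\<lambda>v w. vone v w - vmul V X Y v w) = vdet V \<gamma> * vdet V \<pi>"
proof -
  let ?Y = "\<lambda>v w. vone v w - Y v w" and ?XY = "\<lambda>v w. vone v w - vmul V X Y v w"
  have one: "vmul V p (\<lambda>v w. vone v w - q v w) v w = p v w - vmul V p q v w" if "w \<in> V" for p q v w
    using that V by (simp add: vmul_def right_diff_distrib sum_subtractf)
  have assoc: "vmul V p (vmul V q s) v w = vmul V (vmul V p q) s v w" for p q s :: "'a \<Rightarrow> 'a \<Rightarrow> real" and v w
    by (simp add: vmul_def sum_distrib_left sum_distrib_right mult.assoc) (rule sum.swap)
  have 1: "vdet V (vmul V \<alpha> ?Y) = vdet V \<pi>"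
    by (rule vdet_cong) (simp add: one Y)
  have 2: "vdet V (vmul V \<beta> ?XY) = vdet V (vmul V \<gamma> ?Y)"
  proof (rule vdet_cong)
    fix v w assume vw: "v \<in> V" "w \<in> V"
    have "vmul V \<beta> ?XY v w = \<beta> v w - vmul V (vmul V \<beta> X) Y v w"
      using vw by (simp add: one assoc)
    also have "vmul V (vmul V \<beta> X) Y v w = (\<Sum>u\<in>V. (\<beta> v u - \<pi> v u) * Y u w)"
      using vw X by (simp add: vmul_def)
    also have "\<dots> = vmul V \<beta> Y v w - vmul V \<pi> Y v w"
      by (simp add: vmul_def left_diff_distrib sum_subtractf)
    finally have l: "vmul V \<beta> ?XY v w = \<beta> v w - vmul V \<beta> Y v w + vmul V \<pi> Y v w" by simp
    have "vmul V \<gamma> ?Y v w = (\<Sum>u\<in>V. (\<alpha> v u + \<beta> v u - \<pi> v u) * ?Y u w)"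
      using vw \<gamma> by (simp add: vmul_def)
    also have "\<dots> = vmul V \<alpha> ?Y v w + vmul V \<beta> ?Y v w - vmul V \<pi> ?Y v w"
      by (simp add: vmul_def left_diff_distrib distrib_right sum_subtractf sum.distrib)
    also have "\<dots> = \<beta> v w - vmul V \<beta> Y v w + vmul V \<pi> Y v w"
      using vw by (simp add: one Y)
    finally show "vmul V \<beta> ?XY v w = vmul V \<gamma> ?Y v w" using l by simp
  qed
  have "vdet V \<alpha> * (vdet V \<beta> * vdet V ?XY) = vdet V \<alpha> * (vdet V \<gamma> * vdet V ?Y)"
    using 2 by (simp add: vdet_mul[OF V])
  also have "\<dots> = vdet V \<gamma> * vdet V \<pi>"
    using 1 by (simp add: vdet_mul[OF V])
  finally show ?thesis by simp
qed

text \<open>\<open>d\<close> is the determinant of \<open>1 - N\<close>, where \<open>N\<close> is the kernel of the successive positions on \<open>S\<close>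
  after each visit to \<open>B\<close>. The other factors only see one side of \<open>S\<close>, or the complement of \<open>B\<close>.\<close>

theorem (in substochastic) vdet_decoupling:
  assumes parts: "V = I \<union> S \<union> Out" "I \<inter> S = {}" "I \<inter> Out = {}" "S \<inter> Out = {}" "B \<subseteq> Out"
    and cut: "\<And>v w. v \<in> I \<Longrightarrow> w \<in> Out \<Longrightarrow> P v w = 0" "\<And>v w. v \<in> Out \<Longrightarrow> w \<in> I \<Longrightarrow> P v w = 0"
    and escI: "\<And>v. v \<in> I \<Longrightarrow> escapes V P I v"
    and escOut: "\<And>v. v \<in> Out \<Longrightarrow> escapes V P Out v"
    and escB: "\<And>v. v \<in> V - B \<Longrightarrow> escapes V P (V - B) v"
    and harnack: "\<And>h s s'. (\<And>v. v \<in> V \<Longrightarrow> 0 \<le> h v) \<Longrightarrow>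
        (\<And>v. v \<in> V - B \<Longrightarrow> h v = (\<Sum>w\<in>V. P v w * h w)) \<Longrightarrow> s \<in> S \<Longrightarrow> s' \<in> S \<Longrightarrow> h s \<le> C * h s'"
    and hit: "\<And>u y. (\<And>v. v \<in> V \<Longrightarrow> 0 \<le> u v \<and> u v \<le> 1) \<Longrightarrow>
        (\<And>v. v \<in> V - S \<Longrightarrow> u v = (\<Sum>w\<in>V. P v w * u w)) \<Longrightarrow>
        (\<And>v. v \<in> S \<Longrightarrow> u v = 1) \<Longrightarrow> y \<in> B \<Longrightarrow> u y \<le> r"
    and C: "0 \<le> C" and r: "0 \<le> r" "r < 1"
  shows "\<exists>d. exp (- (C / (1 - r)^2)) \<le> d \<and> d \<le> 1 \<and>
    vdet V (lap V P) * vdet V (lap (Out - B) P) = vdet V (lap Out P) * vdet V (lap (V - B) P) * d"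
proof -
  have sub: "I \<subseteq> V" "S \<subseteq> V" "Out \<subseteq> V" "B \<subseteq> V" "I \<union> Out = V - S" using parts by auto
  \<comment> \<open>By \<open>cut\<close>, an escape path from \<open>I\<close> or from
    \<open>Out\<close> that leaves its part enters \<open>S\<close>, so escaping from either side is
    escaping from \<open>V - S\<close>.\<close>
  have escS: "escapes V P (V - S) v" if v: "v \<in> V - S" for v
  proof -
    have 1: "escapes V P (V - S) v" if "escapes V P I v" for v
      using that
    proof induction
      case (die v) then show ?case using parts by (intro escapes.die) auto
    next
      case (leave v w)
      then have "w \<in> S" using cut(1)[of v w] parts by auto
      then show ?case using leave parts by (intro escapes.leave[of v _ w]) auto
    next
      case (step v w) then show ?case using parts by (intro escapes.step[of v _ w]) auto
    qed
    have 2: "escapes V P (V - S) v" if "escapes V P Out v" for v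
      using that
    proof induction
      case (die v) then show ?case using parts by (intro escapes.die) auto
    next
      case (leave v w)
      then have "w \<in> S" using cut(2)[of v w] parts by auto
      then show ?case using leave parts by (intro escapes.leave[of v _ w]) auto
    next
      case (step v w) then show ?case using parts by (intro escapes.step[of v _ w]) auto
    qed
    show ?thesis using 1[OF escI] 2[OF escOut] v unfolding sub(5)[symmetric] by blast
  qed
  obtain hS hB where h: "hitting_kernel (V - S) hS" "hitting_kernel (V - B) hB"
    using ex_hitting_kernel[OF Diff_subset escS] ex_hitting_kernel[OF Diff_subset escB] by blast
  note hS = hitting_kernelD[OF h(1)] and hB = hitting_kernelD[OF h(2)]
  \<comment> \<open>From a state of \<open>S\<close> run to \<open>B\<close>, then from there back
    to \<open>S\<close>; \<open>w\<close> is the place of return.\<close>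
  define N where "N v w = (if v \<in> S then \<Sum>y\<in>V. hB v y * hS y w else 0)" for v w
  let ?X = "vmul V hB P" and ?Y = "vmul V hS P"
  \<comment> \<open>\<open>lap (V - Q) P\<close> applied to an exit kernel leaves just the identity
    rows on \<open>Q\<close>. Multiplied with \<open>P\<close> these become the rows of
    \<open>P\<close> on \<open>Q\<close>, which is the difference of the two operators.\<close>
  have XYgen: "vmul V (lap (V - Q) P) (vmul V h P) v w = lap (V - Q) P v w - lap V P v w"
    if Q: "Q \<subseteq> V" and h: "\<And>v w. v \<in> V - Q \<Longrightarrow> w \<in> V \<Longrightarrow> h v w = (\<Sum>u\<in>V. P v u * h u w)"
      "\<And>v w. v \<in> V - (V - Q) \<Longrightarrow> h v w = vone v w" "\<And>v w. w \<in> V - Q \<Longrightarrow> h v w = 0"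
      and vw: "v \<in> V" "w \<in> V" for Q h v w
  proof -
    have inner: "vmul V (lap (V - Q) P) h v x = (if v \<in> Q then vone v x else 0)" if "x \<in> V" for x
      using h(1)[of v x] h(2)[of v x] that vw Q finite_V by (auto simp: vmul_def sum_lap)
    have "vmul V (lap (V - Q) P) (vmul V h P) v w = (\<Sum>x\<in>V. vmul V (lap (V - Q) P) h v x * P x w)"
      by (simp add: vmul_def sum_distrib_left sum_distrib_right mult.assoc) (rule sum.swap)
    also have "\<dots> = (if v \<in> Q then P v w else 0)"
      using finite_V vw by (simp add: inner)
    also have "\<dots> = lap (V - Q) P v w - lap V P v w"
      using vw by (simp add: lap_def)
    finally show ?thesis .
  qed
  let ?G = "lap (V - S - B) P"
  have detS: "vdet V (lap (V - S) P) \<noteq> 0" by (rule lap_nonsingular[OF Diff_subset escS])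
  have main: "vdet V (lap (V - S) P) * vdet V (lap (V - B) P) * vdet V (\<lambda>v w. vone v w - vmul V ?X ?Y v w)
      = vdet V ?G * vdet V (lap V P)"
  proof (rule vdet_two_sided_split[OF finite_V _ _ _ detS])
    show "vmul V (lap (V - B) P) ?X v w = lap (V - B) P v w - lap V P v w" if "v \<in> V" "w \<in> V" for v w
      by (rule XYgen[OF sub(4) hB(1-3) that])
    show "vmul V (lap (V - S) P) ?Y v w = lap (V - S) P v w - lap V P v w" if "v \<in> V" "w \<in> V" for v w
      by (rule XYgen[OF sub(2) hS(1-3) that])
    show "?G v w = lap (V - S) P v w + lap (V - B) P v w - lap V P v w" if "v \<in> V" "w \<in> V" for v w
      using that parts by (auto simp: lap_def)
  qed
  \<comment> \<open>No transition leads from \<open>I\<close> to \<open>R\<close>, so the operator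
    for the union is a product. The factor of \<open>I\<close> then occurs on both sides of
    \<open>main\<close> and cancels.\<close>
  have split: "vdet V (lap (I \<union> R) P) = vdet V (lap I P) * vdet V (lap R P)" if R: "R \<subseteq> Out" for R
  proof -
    have "vdet V (lap (I \<union> R) P) = vdet V (vmul V (lap I P) (lap R P))"
    proof (rule vdet_cong)
      fix v w assume vw: "v \<in> V" "w \<in> V"
      have "vmul V (lap I P) (lap R P) v w
          = lap R P v w - (if v \<in> I then \<Sum>u\<in>V. P v u * lap R P u w else 0)"
        unfolding vmul_def by (rule sum_lap[OF finite_V vw(1)])
      also have "(if v \<in> I then \<Sum>u\<in>V. P v u * lap R P u w else 0) = (if v \<in> I then P v w else 0)"
      proof (cases "v \<in> I")
        case True
        have "(\<Sum>u\<in>V. P v u * lap R P u w) = (\<Sum>u\<in>V. P v u * vone u w)"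
          using True R cut(1) by (intro sum.cong) (auto simp: lap_def)
        then show ?thesis using True vw finite_V by simp
      qed simp
      finally have eq: "vmul V (lap I P) (lap R P) v w = lap R P v w - (if v \<in> I then P v w else 0)" .
      show "lap (I \<union> R) P v w = vmul V (lap I P) (lap R P) v w"
        unfolding eq lap_def using R parts(3) by auto
    qed
    then show ?thesis by (simp add: vdet_mul finite_V)
  qed
  have detI: "vdet V (lap I P) \<noteq> 0" by (rule lap_nonsingular[OF sub(1) escI])
  have eqS: "V - S = I \<union> Out" "V - S - B = I \<union> (Out - B)" using parts by auto
  have "vdet V (lap I P) * (vdet V (lap Out P) * vdet V (lap (V - B) P) * vdet V (\<lambda>v w. vone v w - vmul V ?X ?Y v w))
      = vdet V (lap I P) * (vdet V (lap (Out - B) P) * vdet V (lap V P))"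
    using main unfolding eqS(2) unfolding eqS(1) split[OF subset_refl] split[OF Diff_subset] by (simp add: mult.assoc)
  then have main': "vdet V (lap V P) * vdet V (lap (Out - B) P) =
      vdet V (lap Out P) * vdet V (lap (V - B) P) * vdet V (\<lambda>v w. vone v w - vmul V ?X ?Y v w)"
    using detI by simp
  \<comment> \<open>The columns of \<open>hS\<close> live on \<open>S\<close>, so only the rows of
    \<open>P\<close> in \<open>S\<close> matter. Sylvester's identity moves this factor to the
    front, which turns an operator on \<open>V\<close> into one with rows in
    \<open>S\<close>.\<close>
  have Y': "?Y v w = vmul V hS (\<lambda>v w. if v \<in> S then P v w else 0) v w" for v w
    unfolding vmul_def by (rule sum.cong) (auto simp: hS(3))
  have assoc: "vmul V p (vmul V q s) = vmul V (vmul V p q) s" for p q s :: "'v \<Rightarrow> 'v \<Rightarrow> real"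
    by (intro ext, simp add: vmul_def sum_distrib_left sum_distrib_right mult.assoc) (rule sum.swap)
  have "vdet V (\<lambda>v w. vone v w - vmul V ?X ?Y v w)
      = vdet V (\<lambda>v w. vone v w - vmul V (vmul V ?X hS) (\<lambda>v w. if v \<in> S then P v w else 0) v w)"
    by (simp add: Y'[abs_def] assoc)
  also have "\<dots> = vdet V (\<lambda>v w. vone v w - vmul V (\<lambda>v w. if v \<in> S then P v w else 0) (vmul V ?X hS) v w)"
    by (rule vdet_sylvester[OF finite_V])
  also have "\<dots> = vdet V (lap S N)"
  proof (rule vdet_cong)
    fix v w assume vw: "v \<in> V" "w \<in> V"
    \<comment> \<open>Both one-step factors are absorbed: \<open>P hB = hB\<close> on
      \<open>S\<close>, which is disjoint from \<open>B\<close>, and \<open>P hS = hS\<close> on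
      \<open>B\<close>, which carries all columns of \<open>hB\<close>.\<close>
    have "vmul V (\<lambda>v w. if v \<in> S then P v w else 0) (vmul V ?X hS) v w = (if v \<in> S then N v w else 0)"
    proof (cases "v \<in> S")
      case True
      have 1: "vmul V P hB v y = hB v y" if "y \<in> V" for y
      proof -
        have "v \<in> V - B" using True parts(4,5) sub(2) by auto
        then show ?thesis using hB(1)[OF _ that] by (simp add: vmul_def)
      qed
      have "vmul V (\<lambda>v w. if v \<in> S then P v w else 0) (vmul V ?X hS) v w = vmul V P (vmul V ?X hS) v w"
        using True by (simp add: vmul_def)
      also have "\<dots> = vmul V (vmul V P hB) (vmul V P hS) v w" by (simp add: assoc)
      also have "\<dots> = (\<Sum>y\<in>V. hB v y * vmul V P hS y w)"
        unfolding vmul_def[of V "vmul V P hB"] by (rule sum.cong) (simp_all add: 1)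
      also have "\<dots> = (\<Sum>y\<in>V. hB v y * hS y w)"
      proof (rule sum.cong[OF refl])
        fix y assume y: "y \<in> V"
        show "hB v y * vmul V P hS y w = hB v y * hS y w"
        proof (cases "y \<in> B")
          case True
          then have "y \<in> V - S" using parts(4,5) y by blast
          then show ?thesis using hS(1)[OF _ vw(2)] by (simp add: vmul_def)
        next
          case False
          then show ?thesis using hB(3)[of y v] y by simp
        qed
      qed
      finally show ?thesis using True by (simp add: N_def)
    qed (simp add: vmul_def)
    then show "vone v w - vmul V (\<lambda>v w. if v \<in> S then P v w else 0) (vmul V ?X hS) v w = lap S N v w"
      by (simp add: lap_def)
  qed
  finally have detN: "vdet V (\<lambda>v w. vone v w - vmul V ?X ?Y v w) = vdet V (lap S N)" .
  have N0: "0 \<le> N v w" if "v \<in> V" "w \<in> V" for v w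
    unfolding N_def using that hB(4) hS(4) by (auto intro!: sum_nonneg mult_nonneg_nonneg)
  \<comment> \<open>The probability of returning to \<open>S\<close> is harmonic off
    \<open>S\<close> and equal to one on \<open>S\<close>, so \<open>hit\<close> bounds it on
    \<open>B\<close>.\<close>
  have rowS: "(\<Sum>w\<in>V. hS y w) \<le> r" if y: "y \<in> B" for y
  proof (rule hit[of "\<lambda>y. \<Sum>w\<in>V. hS y w", OF _ _ _ y])
    show "0 \<le> (\<Sum>w\<in>V. hS v w) \<and> (\<Sum>w\<in>V. hS v w) \<le> 1" if "v \<in> V" for v
      using hS(4,5) that by (auto intro: sum_nonneg)
    show "(\<Sum>w\<in>V. hS v w) = (\<Sum>u\<in>V. P v u * (\<Sum>w\<in>V. hS u w))" if "v \<in> V - S" for v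
    proof -
      have "(\<Sum>w\<in>V. hS v w) = (\<Sum>w\<in>V. \<Sum>u\<in>V. P v u * hS u w)"
        by (intro sum.cong refl hS(1)[OF that])
      then show ?thesis by (subst (asm) sum.swap) (simp add: sum_distrib_left)
    qed
    show "(\<Sum>w\<in>V. hS v w) = 1" if "v \<in> S" for v
    proof -
      have vV: "v \<in> V" "v \<in> V - (V - S)" using that sub(2) by auto
      have "(\<Sum>w\<in>V. hS v w) = (\<Sum>w\<in>V. vone v w * 1)"
        by (simp add: hS(2)[OF vV(2)])
      also have "\<dots> = 1" unfolding sum_vone[OF finite_V] using vV(1) by simp
      finally show ?thesis .
    qed
  qed
  have rowN: "(\<Sum>w\<in>V. N v w) \<le> r" if v: "v \<in> S" for v
  proof -
    have "(\<Sum>w\<in>V. N v w) = (\<Sum>y\<in>V. hB v y * (\<Sum>w\<in>V. hS y w))"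
      using v by (simp add: N_def sum_distrib_left) (rule sum.swap)
    also have "\<dots> \<le> (\<Sum>y\<in>V. hB v y * r)"
    proof (rule sum_mono)
      fix y assume y: "y \<in> V"
      show "hB v y * (\<Sum>w\<in>V. hS y w) \<le> hB v y * r"
        using hB(3)[of y v] hB(4)[of v y] rowS[of y] v sub y by (cases "y \<in> B") (auto intro!: mult_left_mono)
    qed
    also have "\<dots> = (\<Sum>y\<in>V. hB v y) * r" by (simp add: sum_distrib_right)
    also have "\<dots> \<le> 1 * r" using hB(5)[of v] v sub r by (intro mult_right_mono) auto
    finally show ?thesis by simp
  qed
  \<comment> \<open>For a fixed place of return, the expression is harmonic off \<open>B\<close> as
    a function of the starting point; so all rows on \<open>S\<close> are comparable.\<close>
  have harN: "N s t \<le> C * N s' t" if st: "s \<in> S" "s' \<in> S" "t \<in> V" for s s' t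
  proof -
    have "(\<Sum>y\<in>V. hB s y * hS y t) \<le> C * (\<Sum>y\<in>V. hB s' y * hS y t)"
    proof (rule harnack[of "\<lambda>v. \<Sum>y\<in>V. hB v y * hS y t", OF _ _ st(1,2)])
      show "0 \<le> (\<Sum>y\<in>V. hB v y * hS y t)" if "v \<in> V" for v
        using that hB(4) hS(4) st(3) by (auto intro!: sum_nonneg mult_nonneg_nonneg)
      show "(\<Sum>y\<in>V. hB v y * hS y t) = (\<Sum>w\<in>V. P v w * (\<Sum>y\<in>V. hB w y * hS y t))" if v: "v \<in> V - B" for v
      proof -
        have "(\<Sum>y\<in>V. hB v y * hS y t) = (\<Sum>y\<in>V. (\<Sum>u\<in>V. P v u * hB u y) * hS y t)"
          by (intro sum.cong refl arg_cong2[where f="(*)"] hB(1)[OF v])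
        also have "\<dots> = (\<Sum>w\<in>V. P v w * (\<Sum>y\<in>V. hB w y * hS y t))"
          by (simp add: sum_distrib_left sum_distrib_right mult.assoc) (rule sum.swap)
        finally show ?thesis .
      qed
    qed
    then show ?thesis using st by (simp add: N_def)
  qed
  have "exp (- (C / (1 - r)^2)) \<le> vdet V (lap S N) \<and> vdet V (lap S N) \<le> 1"
  proof (cases "S = {}")
    case True
    have "vdet V (lap S N) = 1"
      unfolding vdet_one[OF finite_V, symmetric] by (rule vdet_cong) (simp add: lap_def True)
    then show ?thesis using C by simp
  next
    case False
    then obtain s0 where s0: "s0 \<in> S" by auto
    \<comment> \<open>The column bounds come from one reference row,
      \<open>\<mu> t = C * N s0 t\<close>. Their sum is at most \<open>C\<close>, whatever the
      number of states in \<open>S\<close>.\<close>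
    have b: "exp (- ((\<Sum>t\<in>S. C * N s0 t) / (1 - r)^2)) \<le> vdet V (lap S N) \<and> vdet V (lap S N) \<le> 1"
    proof (rule vdet_ge_exp[OF finite_V sub(2) N0 rowN r])
      show "N s t \<le> C * N s0 t" if "s \<in> S" "t \<in> S" for s t
        by (rule harN) (use that s0 sub in auto)
      show "0 \<le> C * N s0 t" if "t \<in> S" for t using C N0[OF subsetD[OF sub(2) s0] subsetD[OF sub(2) that]] by simp
    qed auto
    have "(\<Sum>t\<in>S. N s0 t) \<le> (\<Sum>t\<in>V. N s0 t)"
      by (rule sum_mono2[OF finite_V sub(2)]) (rule N0, use s0 sub(2) in auto)
    then have "(\<Sum>t\<in>S. N s0 t) \<le> 1" using rowN[OF s0] r by linarith
    then have "(\<Sum>t\<in>S. C * N s0 t) \<le> C"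
      unfolding sum_distrib_left[symmetric] using C by (rule mult_left_le)
    then have "(\<Sum>t\<in>S. C * N s0 t) / (1 - r)^2 \<le> C / (1 - r)^2"
      by (intro divide_right_mono) auto
    then have "exp (- (C / (1 - r)^2)) \<le> exp (- ((\<Sum>t\<in>S. C * N s0 t) / (1 - r)^2))" by simp
    from order_trans[OF this conjunct1[OF b]] conjunct2[OF b] show ?thesis by (rule conjI)
  qed
  with main'[unfolded detN] show ?thesis by (intro exI[of _ "vdet V (lap S N)"] conjI) simp_all
qed

section \<open>The matrix-tree theorem\<close>

text \<open>As the weights at \<open>v\<close> sum to one, row \<open>v\<close> is the weighted mean
  over the edges in \<open>X v\<close> of the row of a single edge. Multilinearity gives a sum over
  choice functions; each choice is a functional graph, and its determinant is 1 if there is no cycle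
  and 0 otherwise. Edges with target \<open>None\<close> go to the cemetery and close no
  cycle.\<close>

theorem matrix_tree:
  assumes V: "finite V" and A: "A \<subseteq> V" and X: "\<And>v. v \<in> A \<Longrightarrow> finite (X v)"
    and q: "\<And>v. v \<in> A \<Longrightarrow> (\<Sum>e\<in>X v. q e) = 1"
    and P: "\<And>v w. v \<in> A \<Longrightarrow> w \<in> V \<Longrightarrow> P v w = (\<Sum>e\<in>X v. if tgt e = Some w then q e else 0)"
  shows "vdet V (lap A P) =
    (\<Sum>f\<in>{f \<in> PiE A X. acyclic {(v, w). v \<in> A \<and> w \<in> V \<and> tgt (f v) = Some w}}. \<Prod>v\<in>A. q (f v))"
proof -
  define R where "R f = {(v, w). v \<in> A \<and> w \<in> V \<and> tgt (f v) = Some w}" for f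
  define M where "M f v w = vone v w - (if (v, w) \<in> R f then 1 else 0)" for f and v w :: 'a
  have finA: "finite A" using A V finite_subset by blast
  have finF: "finite (PiE A X)" by (rule finite_PiE[OF finA X])
  have row: "lap A P v w = (\<Sum>e\<in>X v. q e * (vone v w - (if tgt e = Some w then 1 else 0)))"
    if "v \<in> A" "w \<in> V" for v w
  proof -
    have "q e * (vone v w - (if tgt e = Some w then 1 else 0))
        = q e * vone v w - (if tgt e = Some w then q e else 0)" for e
      by (simp add: right_diff_distrib)
    then have "(\<Sum>e\<in>X v. q e * (vone v w - (if tgt e = Some w then 1 else 0)))
        = (\<Sum>e\<in>X v. q e) * vone v w - (\<Sum>e\<in>X v. if tgt e = Some w then q e else 0)"
      by (simp add: sum_subtractf sum_distrib_right)
    then show ?thesis using q P that by (simp add: lap_def)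
  qed
  have expand: "(\<Prod>v\<in>V. lap A P v (\<pi> v)) = (\<Sum>f\<in>PiE A X. (\<Prod>v\<in>A. q (f v)) * (\<Prod>v\<in>V. M f v (\<pi> v)))"
    if \<pi>: "\<pi> permutes V" for \<pi>
  proof -
    have inV: "\<pi> v \<in> V" if "v \<in> V" for v using permutes_in_image[OF \<pi>] that by blast
    have VA: "(\<Prod>v\<in>V. g v) = (\<Prod>v\<in>A. g v) * (\<Prod>v\<in>V-A. g v)" for g :: "'a \<Rightarrow> real"
      using prod.subset_diff[OF A V, of g] by (simp add: mult.commute)
    have "(\<Prod>v\<in>A. lap A P v (\<pi> v))
        = (\<Prod>v\<in>A. \<Sum>e\<in>X v. q e * (vone v (\<pi> v) - (if tgt e = Some (\<pi> v) then 1 else 0)))"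
      using A inV by (intro prod.cong refl row) auto
    also have "\<dots> = (\<Sum>f\<in>PiE A X. \<Prod>v\<in>A. q (f v) * (vone v (\<pi> v) - (if tgt (f v) = Some (\<pi> v) then 1 else 0)))"
      by (rule prod_sum_PiE[OF finA X])
    also have "\<dots> = (\<Sum>f\<in>PiE A X. (\<Prod>v\<in>A. q (f v)) * (\<Prod>v\<in>A. M f v (\<pi> v)))"
      using A inV by (intro sum.cong refl) (auto simp: prod.distrib M_def R_def intro!: prod.cong)
    finally have 1: "(\<Prod>v\<in>A. lap A P v (\<pi> v)) = (\<Sum>f\<in>PiE A X. (\<Prod>v\<in>A. q (f v)) * (\<Prod>v\<in>A. M f v (\<pi> v)))" .
    have 2: "(\<Prod>v\<in>V-A. lap A P v (\<pi> v)) = (\<Prod>v\<in>V-A. M f v (\<pi> v))" for f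
      by (intro prod.cong) (auto simp: lap_def M_def R_def)
    show ?thesis
      unfolding VA[of "\<lambda>v. lap A P v (\<pi> v)"] VA[of "\<lambda>v. M _ v (\<pi> v)"] 1 2 sum_distrib_right
      by (simp add: mult.assoc 2[symmetric])
  qed
  have "vdet V (lap A P) = (\<Sum>f\<in>PiE A X. (\<Prod>v\<in>A. q (f v)) * vdet V (M f))"
    unfolding vdet_def
    by (subst sum.cong[OF refl, of _ _ "\<lambda>\<pi>. \<Sum>f\<in>PiE A X. (\<Prod>v\<in>A. q (f v)) * (of_int (sign \<pi>) * (\<Prod>v\<in>V. M f v (\<pi> v)))"])
       (auto simp: expand sum_distrib_left mult_ac intro!: sum.swap)
  also have "\<dots> = (\<Sum>f\<in>PiE A X. if acyclic (R f) then (\<Prod>v\<in>A. q (f v)) else 0)"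
  proof (rule sum.cong[OF refl])
    fix f
    have "vdet V (M f) = (if acyclic (R f) then 1 else 0)"
    proof (cases "acyclic (R f)")
      case True
      \<comment> \<open>A permutation other than the identity moves some vertex, and if its product
        is non-zero, the orbit of this vertex follows arrows of \<open>R f\<close> until it closes
        up.\<close>
      have zero: "(\<Prod>v\<in>V. M f v (\<pi> v)) = 0" if \<pi>: "\<pi> permutes V" "\<pi> \<noteq> id" for \<pi>
      proof (rule ccontr)
        assume nz: "(\<Prod>v\<in>V. M f v (\<pi> v)) \<noteq> 0"
        obtain v where v: "\<pi> v \<noteq> v" using \<pi>(2) by (auto simp: fun_eq_iff)
        have move: "(w, \<pi> w) \<in> R f" if "\<pi> w \<noteq> w" for w
        proof -
          have "w \<in> V" using permutes_not_in[OF \<pi>(1)] that by blast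
          then have "M f w (\<pi> w) \<noteq> 0" using nz V by (metis prod_zero)
          then show ?thesis using that by (auto simp: M_def vone_def split: if_splits)
        qed
        have inj: "inj \<pi>" using \<pi>(1) by (rule permutes_inj)
        have mv: "\<pi> ((\<pi> ^^ n) v) \<noteq> (\<pi> ^^ n) v" for n
        proof (induction n)
          case (Suc n) then show ?case using injD[OF inj] by auto
        qed (use v in simp)
        have path: "(v, (\<pi> ^^ Suc n) v) \<in> (R f)\<^sup>+" for n
        proof (induction n)
          case 0 show ?case using move[OF v] by auto
        next
          case (Suc n) then show ?case using move[OF mv[of "Suc n"]] by (auto intro: trancl_into_trancl)
        qed
        have "permutation \<pi>" using \<pi>(1) V permutation_permutes by blast
        then obtain n where "n > 0" "(\<pi> ^^ n) = id"
          using permutation_is_nilpotent by blast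
        then have "(v, v) \<in> (R f)\<^sup>+" using path[of "n - 1"] by simp
        then show False using True by (auto simp: acyclic_def)
      qed
      have "vdet V (M f) = (\<Sum>\<pi>\<in>{id}. of_int (sign \<pi>) * (\<Prod>v\<in>V. M f v (\<pi> v)))"
        unfolding vdet_def
        by (rule sum.mono_neutral_right) (auto simp: finite_permutations V permutes_id zero)
      moreover have "(x, x) \<notin> R f" for x using True unfolding acyclic_def by blast
      ultimately have "vdet V (M f) = 1" by (simp add: M_def vone_def)
      then show ?thesis using True by simp
    next
      case False
      then obtain v0 where v0: "(v0, v0) \<in> (R f)\<^sup>+" by (auto simp: acyclic_def)
      have v0A: "v0 \<in> A" using tranclD[OF v0] by (auto simp: R_def)
      \<comment> \<open>The indicator of the vertices from which the cycle can be reached. A vertex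
        with an arrow has the same value as its unique successor, a vertex without arrow has value
        zero; so this vector is in the kernel.\<close>
      define y where "y v = (if (v, v0) \<in> (R f)\<^sup>* then 1 else 0 :: real)" for v
      have ker: "(\<Sum>w\<in>V. M f v w * y w) = 0" if v: "v \<in> V" for v
      proof -
        have "M f v w * y w = vone v w * y w - (if (v, w) \<in> R f then y w else 0)" for w
          by (simp add: M_def left_diff_distrib)
        then have fin: "(\<Sum>w\<in>V. M f v w * y w) = y v - (\<Sum>w\<in>V. if (v, w) \<in> R f then y w else 0)"
          using V v by (simp add: sum_subtractf)
        show ?thesis
        proof (cases "\<exists>t. (v, t) \<in> R f")
          case True
          then obtain t where t: "(v, t) \<in> R f" by auto
          then have uniq: "(v, w) \<in> R f \<longleftrightarrow> w = t" for w by (auto simp: R_def)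
          have tV: "t \<in> V" using t by (auto simp: R_def)
          have "y v = y t"
          proof -
            have "(v, v0) \<in> (R f)\<^sup>* \<longleftrightarrow> (t, v0) \<in> (R f)\<^sup>*"
            proof
              assume "(v, v0) \<in> (R f)\<^sup>*"
              then have "(v, v0) \<in> (R f)\<^sup>+" using v0 by (metis rtranclD)
              then show "(t, v0) \<in> (R f)\<^sup>*" using uniq by (metis tranclD)
            qed (use t in \<open>auto intro: converse_rtrancl_into_rtrancl\<close>)
            then show ?thesis by (simp add: y_def)
          qed
          then show ?thesis unfolding fin uniq using V tV by simp
        next
          case False
          then have "(v, v0) \<notin> (R f)\<^sup>*" using v0 by (metis rtranclD tranclD)
          then show ?thesis unfolding fin using False by (simp add: y_def)
        qed
      qed
      have "vdet V (M f) = 0"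
      proof (rule ccontr)
        assume "vdet V (M f) \<noteq> 0"
        then obtain p where p: "\<And>v w. v \<in> V \<Longrightarrow> w \<in> V \<Longrightarrow> vmul V p (M f) v w = vone v w"
          using vdet_inverse[OF V] by metis
        have v0V: "v0 \<in> V" using v0A A by auto
        have "y v0 = (\<Sum>w\<in>V. vmul V p (M f) v0 w * y w)"
          using p v0V V by simp
        also have "\<dots> = (\<Sum>u\<in>V. p v0 u * (\<Sum>w\<in>V. M f u w * y w))"
          by (simp add: vmul_def sum_distrib_left sum_distrib_right mult.assoc) (rule sum.swap)
        also have "\<dots> = 0" using ker by simp
        finally show False by (simp add: y_def)
      qed
      then show ?thesis using False by simp
    qed
    then show "(\<Prod>v\<in>A. q (f v)) * vdet V (M f) = (if acyclic (R f) then (\<Prod>v\<in>A. q (f v)) else 0)"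
      by simp
  qed
  also have "\<dots> = (\<Sum>f\<in>{f \<in> PiE A X. acyclic (R f)}. \<Prod>v\<in>A. q (f v))"
    using finF by (simp add: sum.inter_filter)
  finally show ?thesis by (simp add: R_def)
qed

section \<open>Hitting probabilities and supersolutions\<close>

lemma norm_weight_pos:
  assumes "weighted_graph G" "e \<in> arcs (skel G)"
  shows "0 < norm_weight G e"
proof -
  have "tail (skel G) e \<in> verts (skel G)"
    using assms by (auto simp: weighted_graph_def wf_digraph_def)
  then have "0 < total_rate G (tail (skel G) e)"
    unfolding total_rate_def using assms
    by (intro sum_pos) (auto simp: weighted_graph_def out_arcs_def)
  then show ?thesis using assms by (auto simp: norm_weight_def weighted_graph_def)
qed

lemma sum_norm_weight:
  assumes G: "weighted_graph G" and v: "v \<in> verts (skel G)"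
  shows "(\<Sum>e\<in>out_arcs (skel G) v. norm_weight G e) = 1"
proof -
  have fin: "finite (out_arcs (skel G) v)" "out_arcs (skel G) v \<noteq> {}"
    using G v by (auto simp: weighted_graph_def)
  have "0 < total_rate G v"
    unfolding total_rate_def using G v
    by (intro sum_pos fin) (auto simp: weighted_graph_def out_arcs_def)
  moreover have "(\<Sum>e\<in>out_arcs (skel G) v. norm_weight G e) = (\<Sum>e\<in>out_arcs (skel G) v. weight G e / total_rate G v)"
    by (intro sum.cong) (auto simp: norm_weight_def)
  ultimately show ?thesis
    by (simp add: sum_divide_distrib[symmetric] total_rate_def)
qed

lemma nn_integral_jump_pmf:
  assumes G: "weighted_graph G" and v: "v \<in> verts (skel G)" and f: "\<And>e. 0 \<le> f e"
  shows "(\<integral>\<^sup>+e. ennreal (f e) \<partial>measure_pmf (jump_pmf G v)) =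
    ennreal (\<Sum>e\<in>out_arcs (skel G) v. norm_weight G e * f e)"
proof -
  let ?O = "out_arcs (skel G) v"
  have fin: "finite ?O" using G v by (auto simp: weighted_graph_def)
  have nn: "0 \<le> norm_weight G e" if "e \<in> ?O" for e
    using norm_weight_pos[OF G, of e] that by auto
  have "set_pmf (jump_pmf G v) \<subseteq> ?O"
    by (auto simp: set_pmf_eq pmf_jump_pmf[OF G v] split: if_splits)
  then have "(\<integral>\<^sup>+e. ennreal (f e) \<partial>measure_pmf (jump_pmf G v))
      = (\<Sum>e\<in>?O. ennreal (f e) * ennreal (pmf (jump_pmf G v) e))"
    using fin by (intro nn_integral_measure_pmf_support) (auto simp: set_pmf_eq)
  also have "\<dots> = (\<Sum>e\<in>?O. ennreal (norm_weight G e * f e))"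
    by (intro sum.cong refl) (simp add: pmf_jump_pmf[OF G v] ennreal_mult f nn mult.commute)
  also have "\<dots> = ennreal (\<Sum>e\<in>?O. norm_weight G e * f e)"
    by (intro sum_ennreal) (simp add: f nn)
  finally show ?thesis .
qed

lemma measurable_coordinate:
  assumes "i \<in> J" "\<And>x. f x \<in> space N"
  shows "(\<lambda>\<omega>. f (\<omega> i)) \<in> measurable (PiM J (\<lambda>_. count_space UNIV)) N"
  by (rule measurable_compose[OF measurable_component_singleton[OF assms(1)]]) (simp add: assms(2))

lemma measurable_walk_vertex:
  assumes "{0..<j} \<subseteq> J" "\<And>x. f x \<in> space N"
  shows "(\<lambda>\<omega>. f (walk_vertex G u \<omega> j)) \<in> measurable (PiM J (\<lambda>_. count_space UNIV)) N"
proof (cases j)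
  case 0 then show ?thesis using assms(2) by (simp add: walk_vertex_def)
next
  case (Suc m)
  then have "m \<in> J" using assms(1) by auto
  then show ?thesis
    using measurable_coordinate[of m J "\<lambda>e. f (head (skel G) e)" N] assms(2) Suc
    by (simp add: walk_vertex_def)
qed

text \<open>Optional stopping: the process \<open>\<Phi>\<close>, frozen at 1 after the hit and at 0
  after leaving \<open>R\<close>, and equal to \<open>k\<close> at the current vertex otherwise, is
  a supermartingale. It dominates the indicator of a hit within \<open>n\<close> steps, and these
  events increase with \<open>n\<close> to the hit. Positions off the vertex set, where the jump law
  carries no information, have value 1.\<close>

lemma hitting_probability_le:
  fixes G :: "'e plane_graph"
  assumes G: "weighted_graph G"
    and k: "\<And>w. 0 \<le> k w" "\<And>w. k w \<le> 1" "\<And>w. w \<in> B \<Longrightarrow> k w = 1"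
      "\<And>w. w \<notin> verts (skel G) \<Longrightarrow> k w = 1"
    and super: "\<And>w. w \<in> verts (skel G) \<Longrightarrow> w \<notin> B \<Longrightarrow>
      (\<Sum>e\<in>{e \<in> out_arcs (skel G) w. trace G e \<subseteq> R}. norm_weight G e * k (head (skel G) e)) \<le> k w"
  shows "measure (walk_law G u) {\<xi> \<in> space (walk_law G u). hits_before_exit G u \<xi> B R} \<le> k u"
proof -
  interpret IT: Ionescu_Tulcea "jump_kernel G u" "\<lambda>_. count_space UNIV"
    by (rule Ionescu_Tulcea_jump_kernel)
  let ?M = "\<lambda>n. PiM {0..<n::nat} (\<lambda>_. count_space (UNIV :: 'e set))"
  let ?u = "\<lambda>_::nat. undefined :: 'e"
  define H where "H n = {\<omega>. \<exists>j\<le>n. walk_vertex G u \<omega> j \<in> B \<and> (\<forall>i<j. trace G (\<omega> i) \<subseteq> R)}" for n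
  define \<Phi> where "\<Phi> n \<omega> = (if \<omega> \<in> H n then 1 else if \<forall>i<n. trace G (\<omega> i) \<subseteq> R
    then k (walk_vertex G u \<omega> n) else 0)" for n \<omega>
  have Hmeas: "{\<omega> \<in> space (PiM J (\<lambda>_. count_space UNIV)). \<omega> \<in> H n} \<in> sets (PiM J (\<lambda>_. count_space UNIV))"
    if "{0..<n} \<subseteq> J" for n J
  proof -
    have *: "Measurable.pred (PiM J (\<lambda>_. count_space UNIV)) (\<lambda>\<omega>. walk_vertex G u \<omega> j \<in> B)" if "j \<le> n" for j
      by (rule measurable_walk_vertex[where f="\<lambda>x. x \<in> B"]) (use that \<open>{0..<n} \<subseteq> J\<close> in auto)
    have **: "Measurable.pred (PiM J (\<lambda>_. count_space UNIV)) (\<lambda>\<omega>. trace G (\<omega> i) \<subseteq> R)" if "i < n" for i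
      by (rule measurable_coordinate[where f="\<lambda>x. trace G x \<subseteq> R"]) (use that \<open>{0..<n} \<subseteq> J\<close> in auto)
    have "{\<omega> \<in> space (PiM J (\<lambda>_. count_space UNIV)).
        \<exists>j\<in>{..n}. walk_vertex G u \<omega> j \<in> B \<and> (\<forall>i\<in>{..<j}. trace G (\<omega> i) \<subseteq> R)}
        \<in> sets (PiM J (\<lambda>_. count_space UNIV))"
    proof (intro sets.sets_Collect_finite_Ex sets.sets_Collect_conj sets.sets_Collect_finite_All)
      fix j assume "j \<in> {..n}"
      then show "{\<omega> \<in> space (PiM J (\<lambda>_. count_space UNIV)). walk_vertex G u \<omega> j \<in> B}
          \<in> sets (PiM J (\<lambda>_. count_space UNIV))"
        using * by (simp add: pred_def)
    next
      fix j i assume "j \<in> {..n}" "i \<in> {..<j}"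
      then show "{\<omega> \<in> space (PiM J (\<lambda>_. count_space UNIV)). trace G (\<omega> i) \<subseteq> R}
          \<in> sets (PiM J (\<lambda>_. count_space UNIV))"
        using **[of i] by (simp add: pred_def)
    qed auto
    moreover have "{\<omega> \<in> space (PiM J (\<lambda>_. count_space UNIV)). \<omega> \<in> H n} =
      {\<omega> \<in> space (PiM J (\<lambda>_. count_space UNIV)).
        \<exists>j\<in>{..n}. walk_vertex G u \<omega> j \<in> B \<and> (\<forall>i\<in>{..<j}. trace G (\<omega> i) \<subseteq> R)}"
      by (auto simp: H_def)
    ultimately show ?thesis by simp
  qed
  have \<Phi>meas: "(\<lambda>\<omega>. ennreal (\<Phi> n \<omega>)) \<in> borel_measurable (?M n)" for n
  proof -
    have **: "Measurable.pred (?M n) (\<lambda>\<omega>. trace G (\<omega> i) \<subseteq> R)" if "i < n" for i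
      by (rule measurable_coordinate[where f="\<lambda>x. trace G x \<subseteq> R"]) (use that in auto)
    have 1: "Measurable.pred (?M n) (\<lambda>\<omega>. \<omega> \<in> H n)"
      using Hmeas[of n "{0..<n}"] by (simp add: pred_def)
    have "Measurable.pred (?M n) (\<lambda>\<omega>. \<forall>i\<in>{..<n}. trace G (\<omega> i) \<subseteq> R)"
      unfolding pred_def by (rule sets.sets_Collect_finite_All) (rule **[unfolded pred_def], simp_all)
    then have 2: "Measurable.pred (?M n) (\<lambda>\<omega>. \<forall>i<n. trace G (\<omega> i) \<subseteq> R)"
      unfolding Ball_def lessThan_iff .
    have 3: "(\<lambda>\<omega>. k (walk_vertex G u \<omega> n)) \<in> borel_measurable (?M n)"
      by (rule measurable_walk_vertex) auto
    show ?thesis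
      unfolding \<Phi>_def
      by (intro measurable_compose[OF _ measurable_ennreal] measurable_If measurable_const
          1[unfolded pred_def] 2[unfolded pred_def] 3) auto
  qed
  have \<Phi>01: "0 \<le> \<Phi> n \<omega>" "\<Phi> n \<omega> \<le> 1" for n \<omega> using k by (auto simp: \<Phi>_def)
  have sp: "?u \<in> space (?M 0)" by (simp add: space_PiM)
  have step: "(\<integral>\<^sup>+e. ennreal (\<Phi> (Suc n) (fun_upd \<omega> n e)) \<partial>jump_kernel G u n \<omega>) \<le> ennreal (\<Phi> n \<omega>)" for n \<omega>
  proof -
    have wv_upd: "walk_vertex G u (fun_upd \<omega> n e) j = walk_vertex G u \<omega> j" if "j \<le> n" for e j
      using that by (cases j) (auto simp: walk_vertex_def)
    have wv_new: "walk_vertex G u (fun_upd \<omega> n e) (Suc n) = head (skel G) e" for e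
      by (simp add: walk_vertex_def)
    have tr: "(\<forall>i<j. trace G (fun_upd \<omega> n e i) \<subseteq> R) \<longleftrightarrow> (\<forall>i<j. trace G (\<omega> i) \<subseteq> R)" if "j \<le> n" for e j
      using that by auto
    have goodS: "(\<forall>i<Suc n. trace G (fun_upd \<omega> n e i) \<subseteq> R)
        \<longleftrightarrow> (\<forall>i<n. trace G (\<omega> i) \<subseteq> R) \<and> trace G e \<subseteq> R" for e
      by (auto simp: less_Suc_eq)
    have HS: "fun_upd \<omega> n e \<in> H (Suc n) \<longleftrightarrow> \<omega> \<in> H n \<or>
        (head (skel G) e \<in> B \<and> (\<forall>i<n. trace G (\<omega> i) \<subseteq> R) \<and> trace G e \<subseteq> R)" for e
    proof -
      have ex: "(\<exists>j\<le>Suc n. Q j) \<longleftrightarrow> (\<exists>j\<le>n. Q j) \<or> Q (Suc n)" for Q by (auto simp: le_Suc_eq)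
      have old: "(\<exists>j\<le>n. walk_vertex G u (fun_upd \<omega> n e) j \<in> B \<and> (\<forall>i<j. trace G (fun_upd \<omega> n e i) \<subseteq> R))
          \<longleftrightarrow> (\<exists>j\<le>n. walk_vertex G u \<omega> j \<in> B \<and> (\<forall>i<j. trace G (\<omega> i) \<subseteq> R))"
        by (metis wv_upd tr)
      show ?thesis unfolding H_def mem_Collect_eq ex old goodS wv_new ..
    qed
    consider "\<omega> \<in> H n" | "\<omega> \<notin> H n" "\<not> (\<forall>i<n. trace G (\<omega> i) \<subseteq> R)"
      | "\<omega> \<notin> H n" "\<forall>i<n. trace G (\<omega> i) \<subseteq> R" by argo
    then show ?thesis
    proof cases
      case 1
      have "(\<integral>\<^sup>+e. ennreal (\<Phi> (Suc n) (fun_upd \<omega> n e)) \<partial>jump_kernel G u n \<omega>) \<le> (\<integral>\<^sup>+e. 1 \<partial>jump_kernel G u n \<omega>)"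
        by (intro nn_integral_mono) (use \<Phi>01 in \<open>simp add: ennreal_le_1\<close>)
      then show ?thesis using 1 by (simp add: \<Phi>_def measure_pmf.emeasure_space_1)
    next
      case 2
      then have "\<Phi> (Suc n) (fun_upd \<omega> n e) = 0" for e
        unfolding \<Phi>_def HS goodS by (simp only: 2 simp_thms if_False)
      then show ?thesis by simp
    next
      case 3
      have new: "\<Phi> (Suc n) (fun_upd \<omega> n e) = (if trace G e \<subseteq> R then k (head (skel G) e) else 0)" for e
        unfolding \<Phi>_def HS goodS wv_new using k(3)[of "head (skel G) e"] 3
        by (cases "trace G e \<subseteq> R"; cases "head (skel G) e \<in> B"; simp)
      have old: "\<Phi> n \<omega> = k (walk_vertex G u \<omega> n)"
        unfolding \<Phi>_def if_not_P[OF 3(1)] if_P[OF 3(2)] ..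
      have nB: "walk_vertex G u \<omega> n \<notin> B"
      proof
        assume "walk_vertex G u \<omega> n \<in> B"
        then have "\<omega> \<in> H n" unfolding H_def using 3(2) by (intro CollectI exI[of _ n]) simp
        with 3(1) show False ..
      qed
      show ?thesis
      proof (cases "walk_vertex G u \<omega> n \<in> verts (skel G)")
        case True
        let ?O = "out_arcs (skel G) (walk_vertex G u \<omega> n)"
        have fin: "finite ?O" using G True unfolding weighted_graph_def by blast
        have "(\<integral>\<^sup>+e. ennreal (\<Phi> (Suc n) (fun_upd \<omega> n e)) \<partial>jump_kernel G u n \<omega>)
          = ennreal (\<Sum>e\<in>?O. norm_weight G e * (if trace G e \<subseteq> R then k (head (skel G) e) else 0))"
          unfolding new by (rule nn_integral_jump_pmf[OF G True]) (simp add: k)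
        also have "(\<Sum>e\<in>?O. norm_weight G e * (if trace G e \<subseteq> R then k (head (skel G) e) else 0))
           = (\<Sum>e\<in>{e \<in> ?O. trace G e \<subseteq> R}. norm_weight G e * k (head (skel G) e))"
          by (rule sum.mono_neutral_cong_right[OF fin]) auto
        also have "ennreal \<dots> \<le> ennreal (\<Phi> n \<omega>)"
          unfolding old by (intro ennreal_leI super True nB)
        finally show ?thesis .
      next
        case False
        have "(\<integral>\<^sup>+e. ennreal (\<Phi> (Suc n) (fun_upd \<omega> n e)) \<partial>jump_kernel G u n \<omega>) \<le> (\<integral>\<^sup>+e. 1 \<partial>jump_kernel G u n \<omega>)"
          by (intro nn_integral_mono) (use \<Phi>01 in \<open>simp add: ennreal_le_1\<close>)
        then show ?thesis using k(4)[OF False] by (simp add: old measure_pmf.emeasure_space_1)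
      qed
    qed
  qed
  have int: "(\<integral>\<^sup>+\<omega>. ennreal (\<Phi> n \<omega>) \<partial>IT.C 0 n ?u) \<le> ennreal (k u)" for n
  proof (induction n)
    case 0
    have "ennreal (\<Phi> 0 ?u) \<le> ennreal (k u)"
      using k by (auto simp: \<Phi>_def H_def walk_vertex_def)
    then show ?case
      using \<Phi>meas[of 0] sp by (simp add: nn_integral_return)
  next
    case (Suc n)
    \<comment> \<open>The law of \<open>n + 1\<close> edges is the law of \<open>n\<close> edges
      followed by one step of the kernel, so \<open>step\<close> can be integrated.\<close>
    have "(\<integral>\<^sup>+\<omega>. ennreal (\<Phi> (Suc n) \<omega>) \<partial>IT.C 0 (Suc n) ?u)
        = (\<integral>\<^sup>+\<omega>. \<integral>\<^sup>+\<omega>'. ennreal (\<Phi> (Suc n) \<omega>') \<partial>IT.eP n \<omega> \<partial>IT.C 0 n ?u)"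
      unfolding IT.C.simps add_0
      by (rule nn_integral_bind[OF \<Phi>meas])
         (use IT.measurable_eP IT.sets_C[OF sp, of n] in \<open>simp cong: measurable_cong_sets\<close>)
    also have "\<dots> \<le> (\<integral>\<^sup>+\<omega>. ennreal (\<Phi> n \<omega>) \<partial>IT.C 0 n ?u)"
    proof (rule nn_integral_mono)
      fix \<omega> assume "\<omega> \<in> space (IT.C 0 n ?u)"
      then have "\<omega> \<in> space (?M n)" using IT.space_C[OF sp] by simp
      then show "(\<integral>\<^sup>+\<omega>'. ennreal (\<Phi> (Suc n) \<omega>') \<partial>IT.eP n \<omega>) \<le> ennreal (\<Phi> n \<omega>)"
        by (subst IT.nn_integral_eP) (auto intro: \<Phi>meas step)
    qed
    also note Suc
    finally show ?case .
  qed
  let ?J = "jump_chain G u"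
  have J: "?J = IT.PF.lim" by (simp add: jump_chain_def)
  have setsJ: "sets ?J = sets (PiM UNIV (\<lambda>_. count_space (UNIV :: 'e set)))"
    unfolding J by (rule IT.PF.sets_lim)
  have HJ: "H n \<in> sets ?J" for n
    using Hmeas[of n UNIV] by (simp add: setsJ space_PiM)
  have restr: "restrict \<omega> {0..<n} \<in> H n \<longleftrightarrow> \<omega> \<in> H n" for \<omega> n
  proof -
    have "walk_vertex G u (restrict \<omega> {0..<n}) j = walk_vertex G u \<omega> j" if "j \<le> n" for j
      using that by (cases j) (auto simp: walk_vertex_def)
    moreover have "(\<forall>i<j. trace G (restrict \<omega> {0..<n} i) \<subseteq> R) \<longleftrightarrow> (\<forall>i<j. trace G (\<omega> i) \<subseteq> R)"
      if "j \<le> n" for j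
      using that by auto
    ultimately show ?thesis unfolding H_def mem_Collect_eq by metis
  qed
  have bound: "emeasure ?J (H n) \<le> ennreal (k u)" for n
  proof -
    let ?X = "{\<omega> \<in> space (?M n). \<omega> \<in> H n}"
    have X: "?X \<in> sets (?M n)" by (rule Hmeas) simp
    have "IT.PF.emb UNIV {0..<n} ?X = H n"
      by (auto simp: prod_emb_def space_PiM restr)
    then have "emeasure ?J (H n) = emeasure IT.PF.lim (IT.PF.emb UNIV {0..<n} ?X)" by (simp add: J)
    also have "\<dots> = emeasure (IT.CI {0..<n}) ?X" by (rule IT.lim[OF _ X]) simp
    also have "\<dots> = emeasure (IT.C 0 n ?u) (IT.PF.emb {0..<n} {0..<n} ?X)"
      by (rule IT.emeasure_CI[OF _ X]) simp
    also have "IT.PF.emb {0..<n} {0..<n} ?X = ?X"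
      by (rule prod_emb_id) (auto simp: space_PiM)
    also have "emeasure (IT.C 0 n ?u) ?X = (\<integral>\<^sup>+\<omega>. indicator ?X \<omega> \<partial>IT.C 0 n ?u)"
      using X IT.sets_C[OF sp, of n] by (intro nn_integral_indicator[symmetric]) simp
    also have "\<dots> \<le> (\<integral>\<^sup>+\<omega>. ennreal (\<Phi> n \<omega>) \<partial>IT.C 0 n ?u)"
      by (intro nn_integral_mono) (auto simp: indicator_def \<Phi>_def)
    also note int
    finally show ?thesis .
  qed
  have inc: "incseq H"
  proof (rule incseq_SucI)
    show "H n \<subseteq> H (Suc n)" for n unfolding H_def using le_SucI by blast
  qed
  have "emeasure ?J (\<Union>n. H n) = (SUP n. emeasure ?J (H n))"
    by (rule SUP_emeasure_incseq[symmetric, OF image_subsetI inc]) (rule HJ)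
  also have "\<dots> \<le> ennreal (k u)" by (rule SUP_least) (rule bound)
  finally have boundU: "emeasure ?J (\<Union>n. H n) \<le> ennreal (k u)" .
  let ?T = "PiM UNIV (\<lambda>_::nat. density lborel (exponential_density 1))"
  interpret E: prob_space "density lborel (exponential_density 1)"
    by (rule prob_space_exponential_density) simp
  interpret T: product_prob_space "\<lambda>_. density lborel (exponential_density 1)" "UNIV :: nat set"
    by standard
  interpret W: prob_space "walk_law G u" by (rule prob_space_walk_law)
  \<comment> \<open>Containment is enough for an upper bound. The cylinder on the right does not
    involve the holding times, which contribute a factor 1.\<close>
  have "{\<xi> \<in> space (walk_law G u). hits_before_exit G u \<xi> B R} \<subseteq> (\<Union>n. H n) \<times> space ?T"
  proof
    fix \<xi> assume "\<xi> \<in> {\<xi> \<in> space (walk_law G u). hits_before_exit G u \<xi> B R}"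
    then obtain n where \<xi>: "\<xi> \<in> space (?J \<Otimes>\<^sub>M ?T)"
      and n: "walk_vertex G u (fst \<xi>) n \<in> B" "\<forall>k<n. trace G (fst \<xi> k) \<subseteq> R"
      unfolding hits_before_exit_def walk_law_def by blast
    have "fst \<xi> \<in> H n" unfolding H_def using n by (intro CollectI exI[of _ n]) simp
    then show "\<xi> \<in> (\<Union>n. H n) \<times> space ?T"
      using \<xi> by (auto simp: space_pair_measure)
  qed
  then have "emeasure (walk_law G u) {\<xi> \<in> space (walk_law G u). hits_before_exit G u \<xi> B R}
      \<le> emeasure (walk_law G u) ((\<Union>n. H n) \<times> space ?T)"
    using HJ by (intro emeasure_mono) (auto simp: walk_law_def)
  also have "\<dots> = emeasure ?J (\<Union>n. H n) * emeasure ?T (space ?T)"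
    unfolding walk_law_def using HJ by (intro T.emeasure_pair_measure_Times) auto
  also have "\<dots> \<le> ennreal (k u)" using boundU by (simp add: T.emeasure_space_1)
  finally show ?thesis
    using k(1) by (simp add: W.emeasure_eq_measure)
qed

section \<open>A separating loop made of four strip crossings\<close>

lemma horizontal_segmentD:
  "x \<in> closed_segment a b \<Longrightarrow> Im a = Im b \<Longrightarrow> Re a \<le> Re b \<Longrightarrow> Im x = Im a \<and> Re a \<le> Re x \<and> Re x \<le> Re b"
  by (simp add: closed_segment_same_Im closed_segment_eq_real_ivl1)

lemma vertical_segmentD:
  "x \<in> closed_segment a b \<Longrightarrow> Re a = Re b \<Longrightarrow> Im a \<le> Im b \<Longrightarrow> Re x = Re a \<and> Im a \<le> Im x \<and> Im x \<le> Im b"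
  by (simp add: closed_segment_same_Re closed_segment_eq_real_ivl1)

text \<open>Straight extensions take \<open>f\<close> to the left and right sides and
  \<open>g\<close> to the top and bottom sides of a large box, where the Fashoda theorem gives a
  common point. The extended \<open>g\<close> remains in its vertical strip, which the extensions of
  \<open>f\<close> avoid; then the extensions of \<open>g\<close> are above and below the strip of
  \<open>f\<close>. So the common point is on both original paths.\<close>

lemma crossing_paths_meet:
  fixes f g :: "real \<Rightarrow> complex"
  assumes f: "path f" and g: "path g"
    and fim: "\<And>x. x \<in> path_image f \<Longrightarrow> \<bar>Im x - b\<bar> \<le> s"
    and gim: "\<And>x. x \<in> path_image g \<Longrightarrow> \<bar>Re x - a\<bar> \<le> s"
    and f0: "Re (pathstart f) < a - s" and f1: "a + s < Re (pathfinish f)"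
    and g0: "b + s < Im (pathstart g)" and g1: "Im (pathfinish g) < b - s"
  shows "path_image f \<inter> path_image g \<noteq> {}"
proof -
  obtain K0 where K0: "\<And>x. x \<in> path_image f \<union> path_image g \<Longrightarrow> norm x \<le> K0"
    using bounded_Un[of "path_image f" "path_image g"] bounded_path_image[OF f] bounded_path_image[OF g]
    by (auto simp: bounded_iff)
  define K where "K = K0"
  have bd: "\<bar>Re x\<bar> \<le> K" "\<bar>Im x\<bar> \<le> K" if "x \<in> path_image f \<union> path_image g" for x
    using K0[OF that] abs_Re_le_cmod[of x] abs_Im_le_cmod[of x] by (auto simp: K_def)
  define \<phi> where "\<phi> z = ((\<chi> i. if i = 1 then Re z else Im z) :: real^2)" for z
  have \<phi>1: "vec_nth (\<phi> z) 1 = Re z" and \<phi>2: "vec_nth (\<phi> z) 2 = Im z" for z by (simp_all add: \<phi>_def)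
  have inj: "z = w" if "\<phi> z = \<phi> w" for z w
    using arg_cong[OF that, of "\<lambda>x. vec_nth x 1"] arg_cong[OF that, of "\<lambda>x. vec_nth x 2"]
    by (simp add: \<phi>1 \<phi>2 complex_eq_iff)
  have cont: "continuous_on A \<phi>" for A
    unfolding \<phi>_def
  proof (rule continuous_on_vec_lambda)
    show "continuous_on A (\<lambda>z. if i = 1 then Re z else Im z)" for i :: 2
      by (cases "i = 1") (auto intro!: continuous_intros)
  qed
  let ?f0 = "pathstart f" and ?f1 = "pathfinish f" and ?g0 = "pathstart g" and ?g1 = "pathfinish g"
  let ?l1 = "linepath (Complex (-K) (Im ?f0)) ?f0" and ?l2 = "linepath ?f1 (Complex K (Im ?f1))"
  let ?m1 = "linepath (Complex (Re ?g0) K) ?g0" and ?m2 = "linepath ?g1 (Complex (Re ?g1) (-K))"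
  \<comment> \<open>\<open>g\<close> runs downwards, whereas the Fashoda theorem wants a path from
    bottom to top; hence \<open>reversepath\<close>.\<close>
  let ?F = "?l1 +++ f +++ ?l2" and ?G = "reversepath (?m1 +++ g +++ ?m2)"
  have ends: "?f0 \<in> path_image f" "?f1 \<in> path_image f" "?g0 \<in> path_image g" "?g1 \<in> path_image g"
    by auto
  note e = bd[OF UnI1[OF ends(1)]] bd[OF UnI1[OF ends(2)]] bd[OF UnI2[OF ends(3)]] bd[OF UnI2[OF ends(4)]]
  have sf: "Im x = Im ?f0 \<and> - K \<le> Re x \<and> Re x \<le> Re ?f0"
    if "x \<in> closed_segment (Complex (-K) (Im ?f0)) ?f0" for x
    using horizontal_segmentD[OF that] e(1) by (simp add: abs_le_iff)
  have sf': "Im x = Im ?f1 \<and> Re ?f1 \<le> Re x \<and> Re x \<le> K"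
    if "x \<in> closed_segment ?f1 (Complex K (Im ?f1))" for x
    using horizontal_segmentD[OF that] e(3) by (simp add: abs_le_iff)
  have sg: "Re x = Re ?g0 \<and> Im ?g0 \<le> Im x \<and> Im x \<le> K"
    if "x \<in> closed_segment (Complex (Re ?g0) K) ?g0" for x
    using vertical_segmentD[of x ?g0 "Complex (Re ?g0) K"] that e(6)
    by (simp add: abs_le_iff closed_segment_commute)
  have sg': "Re x = Re ?g1 \<and> - K \<le> Im x \<and> Im x \<le> Im ?g1"
    if "x \<in> closed_segment ?g1 (Complex (Re ?g1) (-K))" for x
    using vertical_segmentD[of x "Complex (Re ?g1) (-K)" ?g1] that e(8)
    by (simp add: abs_le_iff closed_segment_commute)
  have pF: "path ?F" and pG: "path ?G" using f g by auto
  have imF: "path_image ?F = closed_segment (Complex (-K) (Im ?f0)) ?f0 \<union> path_image f \<union> closed_segment ?f1 (Complex K (Im ?f1))"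
    by (simp add: path_image_join Un_assoc)
  have imG: "path_image ?G = closed_segment (Complex (Re ?g0) K) ?g0 \<union> path_image g \<union> closed_segment ?g1 (Complex (Re ?g1) (-K))"
    by (simp add: path_image_join Un_assoc)
  have Fbd: "\<bar>Re x\<bar> \<le> K \<and> \<bar>Im x\<bar> \<le> K" if "x \<in> path_image ?F" for x
    using that unfolding imF
  proof (elim UnE)
    assume "x \<in> closed_segment (Complex (-K) (Im ?f0)) ?f0" from sf[OF this] e(1,2) show ?thesis by linarith
  next
    assume "x \<in> path_image f" then show ?thesis using bd[of x] by simp
  next
    assume "x \<in> closed_segment ?f1 (Complex K (Im ?f1))" from sf'[OF this] e(3,4) show ?thesis by linarith
  qed
  have Gbd: "\<bar>Re x\<bar> \<le> K \<and> \<bar>Im x\<bar> \<le> K" if "x \<in> path_image ?G" for x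
    using that unfolding imG
  proof (elim UnE)
    assume "x \<in> closed_segment (Complex (Re ?g0) K) ?g0" from sg[OF this] e(5,6) show ?thesis by linarith
  next
    assume "x \<in> path_image g" then show ?thesis using bd[of x] by simp
  next
    assume "x \<in> closed_segment ?g1 (Complex (Re ?g1) (-K))" from sg'[OF this] e(7,8) show ?thesis by linarith
  qed
  let ?lo = "\<phi> (Complex (-K) (-K))" and ?hi = "\<phi> (Complex K K)"
  have box: "\<phi> x \<in> cbox ?lo ?hi" if "\<bar>Re x\<bar> \<le> K \<and> \<bar>Im x\<bar> \<le> K" for x
    using that by (auto simp: mem_box_cart forall_2 \<phi>1 \<phi>2)
  obtain z where z: "z \<in> path_image (\<phi> \<circ> ?F)" "z \<in> path_image (\<phi> \<circ> ?G)"
  proof (rule fashoda[of "\<phi> \<circ> ?F" "\<phi> \<circ> ?G" ?lo ?hi])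
    show "path (\<phi> \<circ> ?F)" "path (\<phi> \<circ> ?G)"
      using pF pG cont by (auto intro!: path_continuous_image)
    show "path_image (\<phi> \<circ> ?F) \<subseteq> cbox ?lo ?hi" "path_image (\<phi> \<circ> ?G) \<subseteq> cbox ?lo ?hi"
      unfolding path_image_compose using box Fbd Gbd by blast+
    show "vec_nth (pathstart (\<phi> \<circ> ?F)) 1 = vec_nth ?lo 1" "vec_nth (pathfinish (\<phi> \<circ> ?F)) 1 = vec_nth ?hi 1"
      "vec_nth (pathstart (\<phi> \<circ> ?G)) 2 = vec_nth ?lo 2" "vec_nth (pathfinish (\<phi> \<circ> ?G)) 2 = vec_nth ?hi 2"
      by (simp_all add: pathstart_compose pathfinish_compose \<phi>1 \<phi>2)
  qed
  then obtain x where x: "x \<in> path_image ?F" "x \<in> path_image ?G"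
    unfolding path_image_compose using inj by blast
  have gx: "\<bar>Re x - a\<bar> \<le> s"
    using x(2) unfolding imG
  proof (elim UnE)
    assume "x \<in> closed_segment (Complex (Re ?g0) K) ?g0"
    from sg[OF this] gim[OF ends(3)] show ?thesis by simp
  next
    assume "x \<in> closed_segment ?g1 (Complex (Re ?g1) (-K))"
    from sg'[OF this] gim[OF ends(4)] show ?thesis by simp
  qed (rule gim)
  have xf: "x \<in> path_image f"
    using x(1) unfolding imF
  proof (elim UnE)
    assume "x \<in> closed_segment (Complex (-K) (Im ?f0)) ?f0"
    from sf[OF this] gx f0 show ?thesis by linarith
  next
    assume "x \<in> closed_segment ?f1 (Complex K (Im ?f1))"
    from sf'[OF this] gx f1 show ?thesis by linarith
  qed
  have "x \<in> path_image g"
    using x(2) unfolding imG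
  proof (elim UnE)
    assume "x \<in> closed_segment (Complex (Re ?g0) K) ?g0"
    from sg[OF this] fim[OF xf] g0 show ?thesis by linarith
  next
    assume "x \<in> closed_segment ?g1 (Complex (Re ?g1) (-K))"
    from sg'[OF this] fim[OF xf] g1 show ?thesis by linarith
  qed
  with xf show ?thesis by blast
qed

text \<open>Both paths stay, at all times, in a common convex set avoiding \<open>z\<close>; the winding numbers of
  such loops around \<open>z\<close> agree.\<close>

definition nearby_paths :: "complex \<Rightarrow> (real \<Rightarrow> complex) \<Rightarrow> (real \<Rightarrow> complex) \<Rightarrow> bool" where
  "nearby_paths z p q \<longleftrightarrow> (\<forall>t\<in>{0..1}. \<exists>H. convex H \<and> z \<notin> H \<and> p t \<in> H \<and> q t \<in> H)"

lemma nearby_linepath: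
  assumes H: "path_image p \<subseteq> H" "convex H" "z \<notin> H" "u \<in> H" "v \<in> H"
  shows "nearby_paths z p (linepath u v)"
proof -
  have "path_image (linepath u v) \<subseteq> H"
    using H by (simp add: closed_segment_subset)
  then show ?thesis
    using H unfolding nearby_paths_def path_image_def by blast
qed

lemma nearby_paths_join:
  assumes "nearby_paths z p q" "nearby_paths z p' q'"
  shows "nearby_paths z (p +++ p') (q +++ q')"
  using assms unfolding nearby_paths_def joinpaths_def by auto

lemma winding_number_nearby:
  assumes near: "nearby_paths z p q" and "path p" "path q"
    "pathfinish p = pathstart p" "pathfinish q = pathstart q"
  shows "winding_number p z = winding_number q z"
proof (rule winding_number_homotopic_loops, rule homotopic_loops_linear)
  fix t :: real assume "t \<in> {0..1}"
  then obtain H where "convex H" "z \<notin> H" "p t \<in> H" "q t \<in> H"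
    using near unfolding nearby_paths_def by blast
  then show "closed_segment (p t) (q t) \<subseteq> - {z}"
    using closed_segment_subset[of "p t" H "q t"] by blast
qed (use assms in auto)

text \<open>\<open>f\<close> runs along the bottom, \<open>r\<close> on the right, \<open>t\<close>
  on top, \<open>g\<close> down the left side. Overshooting the lower left corner, \<open>f\<close>
  and \<open>g\<close> cross. Cut there, the four paths form a loop that winds around
  \<open>z\<close> like the square of half side \<open>a\<close>, and not around \<open>w\<close>;
  the winding number is constant on a connected set that avoids the loop.\<close>

lemma separating_loop:
  fixes a s K :: real and z :: complex
  assumes f: "path f" "\<And>x. x \<in> path_image f \<Longrightarrow> \<bar>Im x + a\<bar> \<le> s"
    and r: "path r" "\<And>x. x \<in> path_image r \<Longrightarrow> a - s \<le> Re x"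
    and t: "path t" "\<And>x. x \<in> path_image t \<Longrightarrow> a - s \<le> Im x"
    and g: "path g" "\<And>x. x \<in> path_image g \<Longrightarrow> \<bar>Re x + a\<bar> \<le> s"
    and join: "pathfinish f = pathstart r" "pathfinish r = pathstart t" "pathfinish t = pathstart g"
    and f0: "Re (pathstart f) < - a - s" and g1: "Im (pathfinish g) < - a - s"
    and s: "0 \<le> s" "s < a"
    and K: "path_image f \<union> path_image r \<union> path_image t \<union> path_image g \<subseteq> ball 0 K"
    and \<Gamma>: "connected \<Gamma>" "z \<in> \<Gamma>" "w \<in> \<Gamma>"
    and z: "\<bar>Re z\<bar> < a - s" "\<bar>Im z\<bar> < a - s" and w: "K \<le> norm w"
  shows "\<Gamma> \<inter> (path_image f \<union> path_image r \<union> path_image t \<union> path_image g) \<noteq> {}"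
proof
  assume disj: "\<Gamma> \<inter> (path_image f \<union> path_image r \<union> path_image t \<union> path_image g) = {}"
  have "path_image f \<inter> path_image g \<noteq> {}"
  proof (rule crossing_paths_meet[of f g "-a" s "-a"])
    show "- a + s < Re (pathfinish f)"
      using r(2)[OF pathstart_in_path_image] join(1) s by simp
    show "- a + s < Im (pathstart g)"
      using t(2)[OF pathfinish_in_path_image] join(3) s by simp
  qed (use f g f0 g1 in auto)
  then obtain c where c: "c \<in> path_image f" "c \<in> path_image g" by blast
  obtain x where x: "x \<in> {0..1}" "f x = c" using c(1) unfolding path_image_def by blast
  obtain y where y: "y \<in> {0..1}" "g y = c" using c(2) unfolding path_image_def by blast
  note xy = x(1) y(1) trans[OF x(2) y(2)[symmetric]]
  let ?f = "subpath x 1 f" and ?g = "subpath 0 y g"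
  let ?L = "?f +++ r +++ t +++ ?g"
  have imf: "path_image ?f \<subseteq> path_image f" and img: "path_image ?g \<subseteq> path_image g"
    by (rule path_image_subpath_subset; use xy f(1) g(1) in simp)+
  have pf: "path ?f" and pg: "path ?g" using xy f g by auto
  have e: "pathstart ?f = f x" "pathfinish ?f = pathstart r" "pathstart ?g = pathfinish t" "pathfinish ?g = g y"
    using join by (simp_all add: pathstart_def pathfinish_def subpath_def)
  have L: "path ?L" "pathfinish ?L = pathstart ?L"
    by (intro path_join_imp pf pg r(1) t(1); simp only: e join pathstart_join pathfinish_join)
       (simp only: e xy(3) pathstart_join pathfinish_join)
  have imL: "path_image ?L \<subseteq> path_image f \<union> path_image r \<union> path_image t \<union> path_image g"
  proof -
    have "path_image ?L \<subseteq> path_image ?f \<union> (path_image r \<union> (path_image t \<union> path_image ?g))"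
      by (intro order_trans[OF path_image_join_subset] Un_mono subset_refl)
    with imf img show "path_image ?L \<subseteq> path_image f \<union> path_image r \<union> path_image t \<union> path_image g"
      by blast
  qed
  let ?a1 = "Complex (-a) (-a)" and ?a3 = "Complex a a"
  let ?a2 = "Complex a (-a)" and ?a4 = "Complex (-a) a"
  have rect: "rectpath ?a1 ?a3 = linepath ?a1 ?a2 +++ linepath ?a2 ?a3 +++ linepath ?a3 ?a4 +++ linepath ?a4 ?a1"
    by (simp add: rectpath_def Let_def)
  \<comment> \<open>Each piece shares with its side of the square a half-plane missing
    \<open>z\<close>, whose coordinates are below \<open>a - s\<close> in absolute value.\<close>
  have near: "nearby_paths z ?L (rectpath ?a1 ?a3)"
    unfolding rect
  proof (intro nearby_paths_join)
    have "path_image ?f \<subseteq> {x. Im x \<le> - a + s}"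
    proof
      fix u assume "u \<in> path_image ?f"
      from f(2)[OF subsetD[OF imf this]] show "u \<in> {x. Im x \<le> - a + s}" by simp
    qed
    then show "nearby_paths z ?f (linepath ?a1 ?a2)"
      by (rule nearby_linepath[OF _ convex_halfspace_Im_le]) (use z s in auto)
    have "path_image r \<subseteq> {x. a - s \<le> Re x}" using r(2) by (simp add: subset_iff)
    then show "nearby_paths z r (linepath ?a2 ?a3)"
      by (rule nearby_linepath[OF _ convex_halfspace_Re_ge]) (use z s in auto)
    have "path_image t \<subseteq> {x. a - s \<le> Im x}" using t(2) by (simp add: subset_iff)
    then show "nearby_paths z t (linepath ?a3 ?a4)"
      by (rule nearby_linepath[OF _ convex_halfspace_Im_ge]) (use z s in auto)
    have "path_image ?g \<subseteq> {x. Re x \<le> - a + s}"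
    proof
      fix u assume "u \<in> path_image ?g"
      from g(2)[OF subsetD[OF img this]] show "u \<in> {x. Re x \<le> - a + s}" by simp
    qed
    then show "nearby_paths z ?g (linepath ?a4 ?a1)"
      by (rule nearby_linepath[OF _ convex_halfspace_Re_le]) (use z s in auto)
  qed
  have "winding_number ?L z = winding_number (rectpath ?a1 ?a3) z"
    by (rule winding_number_nearby[OF near L(1) _ L(2)]) simp_all
  also have "\<dots> = 1"
    using z s by (intro winding_number_rectpath) (auto simp: in_box_complex_iff)
  finally have wz: "winding_number ?L z = 1" .
  have "winding_number ?L w = 0"
    by (rule winding_number_zero_outside[of _ "ball 0 K"]) (use L imL K w in auto)
  moreover have "winding_number ?L z = winding_number ?L w"
    by (rule winding_number_eq[OF L \<Gamma>(2,3,1)]) (use disj imL in auto)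
  ultimately show False using wz by simp
qed

section \<open>Paths along which a supersolution stays small\<close>

definition arc_rel :: "'e plane_graph \<Rightarrow> 'e set \<Rightarrow> (complex \<times> complex) set" where
  "arc_rel G E = (\<lambda>e. (tail (skel G) e, head (skel G) e)) ` E"

text \<open>The strict bound at both ends keeps these arcs from sharing an end with an arc whose
  ends both have value at least \<open>m\<close>.\<close>

definition low_arcs :: "'e plane_graph \<Rightarrow> complex set \<Rightarrow> (complex \<Rightarrow> real) \<Rightarrow> real \<Rightarrow> 'e set" where
  "low_arcs G R h m =
     {e \<in> arcs (skel G). trace G e \<subseteq> R \<and> h (tail (skel G) e) < m \<and> h (head (skel G) e) < m}"

text \<open>Supersolution for the walk killed on using an edge not drawn inside \<Omega>: such edges
  are dropped from the mean. At vertices off \<Omega> only nonnegativity is asked.\<close>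

definition superharmonic_on :: "'e plane_graph \<Rightarrow> complex set \<Rightarrow> (complex \<Rightarrow> real) \<Rightarrow> bool" where
  "superharmonic_on G \<Omega> h \<longleftrightarrow> (\<forall>w\<in>verts (skel G). 0 \<le> h w) \<and>
     (\<forall>w\<in>verts (skel G) \<inter> \<Omega>.
        (\<Sum>e\<in>{e \<in> out_arcs (skel G) w. trace G e \<subseteq> \<Omega>}. norm_weight G e * h (head (skel G) e)) \<le> h w)"

lemma low_arcs_mono: "R \<subseteq> R' \<Longrightarrow> m \<le> m' \<Longrightarrow> low_arcs G R h m \<subseteq> low_arcs G R' h m'"
  unfolding low_arcs_def by force

lemma arc_rel_mono: "E \<subseteq> E' \<Longrightarrow> arc_rel G E \<subseteq> arc_rel G E'"
  unfolding arc_rel_def by blast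

lemma arc_ends:
  assumes "good_embedding G" "weighted_graph G" "e \<in> arcs (skel G)"
  shows "tail (skel G) e \<in> trace G e" "head (skel G) e \<in> trace G e"
    "tail (skel G) e \<in> verts (skel G)" "head (skel G) e \<in> verts (skel G)"
proof -
  have "pathstart (curve G e) = tail (skel G) e" "pathfinish (curve G e) = head (skel G) e"
    using assms(1,3) unfolding good_embedding_def by blast+
  then show "tail (skel G) e \<in> trace G e" "head (skel G) e \<in> trace G e"
    using pathstart_in_path_image[of "curve G e"] pathfinish_in_path_image[of "curve G e"] by simp_all
  show "tail (skel G) e \<in> verts (skel G)" "head (skel G) e \<in> verts (skel G)"
    using assms(2,3) by (auto simp: weighted_graph_def wf_digraph_def)
qed

lemma path_along_arcs:
  assumes G: "good_embedding G" and E: "E \<subseteq> arcs (skel G)"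
    and "(u, v) \<in> (arc_rel G E)\<^sup>+"
  shows "\<exists>p. path p \<and> pathstart p = u \<and> pathfinish p = v \<and> path_image p \<subseteq> (\<Union>e\<in>E. trace G e)"
proof -
  have c: "path (curve G e)" "pathstart (curve G e) = tail (skel G) e"
    "pathfinish (curve G e) = head (skel G) e" if "e \<in> E" for e
    using G E that unfolding good_embedding_def by (auto intro: valid_path_imp_path)
  show ?thesis
    using assms(3)
  proof induction
    case (base y)
    then obtain e where e: "e \<in> E" "u = tail (skel G) e" "y = head (skel G) e"
      by (auto simp: arc_rel_def)
    then show ?case using c[OF e(1)] by (intro exI[of _ "curve G e"]) auto
  next
    case (step y z)
    then obtain e p where e: "e \<in> E" "y = tail (skel G) e" "z = head (skel G) e"
      and p: "path p" "pathstart p = u" "pathfinish p = y" "path_image p \<subseteq> (\<Union>e\<in>E. trace G e)"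
      by (auto simp: arc_rel_def)
    have "path_image (p +++ curve G e) \<subseteq> (\<Union>e\<in>E. trace G e)"
      by (rule order_trans[OF path_image_join_subset]) (use p(4) e(1) in blast)
    then show ?case using c[OF e(1)] e p by (intro exI[of _ "p +++ curve G e"]) simp
  qed
qed

text \<open>Otherwise the set \<open>A\<close> reachable from \<open>u\<close> along low arcs misses
  \<open>B\<close>. Then \<open>h / m\<close> on \<open>A\<close>, extended by 1, is a supersolution
  for hitting \<open>B\<close> inside \<open>R\<close>, because an arc that leaves \<open>A\<close>
  inside \<open>R\<close> ends at a value at least \<open>m\<close>. The hitting probability would
  be at most \<open>h u / m < p\<close>.\<close>

lemma low_path:
  assumes G: "weighted_graph G" "good_embedding G"
    and h: "superharmonic_on G \<Omega> h" and R: "R \<subseteq> \<Omega>" and u: "u \<in> verts (skel G)" "u \<in> R"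
    and m: "0 < m"
    and hit: "p < measure (walk_law G u) {\<xi> \<in> space (walk_law G u). hits_before_exit G u \<xi> B R}"
    and low: "h u < p * m"
  shows "\<exists>v\<in>verts (skel G) \<inter> B. (u, v) \<in> (arc_rel G (low_arcs G R h m))\<^sup>* \<and> h v < m"
proof (rule ccontr)
  assume neg: "\<not> ?thesis"
  interpret W: prob_space "walk_law G u" by (rule prob_space_walk_law)
  define A where "A = {w. (u, w) \<in> (arc_rel G (low_arcs G R h m))\<^sup>*}"
  have "p < 1" using hit W.prob_le_1 less_le_trans by blast
  then have hum: "h u < m" using low m mult_strict_right_mono[of p 1 m] by linarith
  have A: "w \<in> verts (skel G) \<and> w \<in> R \<and> h w < m" if "w \<in> A" for w
  proof -
    have "(u, w) \<in> (arc_rel G (low_arcs G R h m))\<^sup>*" using that by (simp add: A_def)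
    then show ?thesis
    proof induction
      case base then show ?case using u hum by simp
    next
      case (step b w)
      then obtain e where e: "e \<in> low_arcs G R h m" "w = head (skel G) e" by (auto simp: arc_rel_def)
      then have "e \<in> arcs (skel G)" "trace G e \<subseteq> R" "h w < m" by (auto simp: low_arcs_def)
      then show ?case using arc_ends[OF G(2,1) \<open>e \<in> arcs (skel G)\<close>] e(2) by blast
    qed
  qed
  have AB: "w \<notin> B" if "w \<in> A" for w
    using neg A[OF that] that by (auto simp: A_def)
  have h0: "0 \<le> h w" if "w \<in> verts (skel G)" for w using h that by (simp add: superharmonic_on_def)
  define k where "k w = (if w \<in> A then h w / m else 1)" for w
  have k01: "0 \<le> k w" "k w \<le> 1" for w
    using A[of w] h0[of w] m by (auto simp: k_def)
  have "measure (walk_law G u) {\<xi> \<in> space (walk_law G u). hits_before_exit G u \<xi> B R} \<le> k u"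
  proof (rule hitting_probability_le[OF G(1) k01])
    show "k w = 1" if "w \<in> B" for w using AB that by (auto simp: k_def)
    show "k w = 1" if "w \<notin> verts (skel G)" for w using A that by (auto simp: k_def)
  next
    fix w assume w: "w \<in> verts (skel G)"
    let ?O = "{e \<in> out_arcs (skel G) w. trace G e \<subseteq> R}"
    let ?O' = "{e \<in> out_arcs (skel G) w. trace G e \<subseteq> \<Omega>}"
    have fin: "finite (out_arcs (skel G) w)" using G(1) w by (auto simp: weighted_graph_def)
    have out: "e \<in> arcs (skel G)" "tail (skel G) e = w" if "e \<in> out_arcs (skel G) w" for e
      using that by auto
    have nw: "0 \<le> norm_weight G e" if "e \<in> out_arcs (skel G) w" for e
      using norm_weight_pos[OF G(1) out(1)[OF that]] by simp
    show "(\<Sum>e\<in>?O. norm_weight G e * k (head (skel G) e)) \<le> k w"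
    proof (cases "w \<in> A")
      case False
      have "(\<Sum>e\<in>?O. norm_weight G e * k (head (skel G) e)) \<le> (\<Sum>e\<in>?O. norm_weight G e)"
        by (rule sum_mono) (rule mult_left_le[OF k01(2) nw], simp)
      also have "\<dots> \<le> (\<Sum>e\<in>out_arcs (skel G) w. norm_weight G e)"
        by (rule sum_mono2[OF fin]) (auto intro: nw)
      also have "\<dots> = 1" by (rule sum_norm_weight[OF G(1) w])
      also have "1 = k w" unfolding k_def by (rule if_not_P[OF False, symmetric])
      finally show ?thesis .
    next
      case True
      have kh: "k (head (skel G) e) \<le> h (head (skel G) e) / m" if e: "e \<in> ?O" for e
      proof (cases "head (skel G) e \<in> A")
        case False
        have "m \<le> h (head (skel G) e)"
        proof (rule ccontr)
          assume "\<not> m \<le> h (head (skel G) e)"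
          have eO: "e \<in> out_arcs (skel G) w" "trace G e \<subseteq> R" using e by blast+
          have "e \<in> low_arcs G R h m"
            unfolding low_arcs_def mem_Collect_eq out(2)[OF eO(1)]
            using out(1)[OF eO(1)] eO(2) A[OF True] \<open>\<not> m \<le> h (head (skel G) e)\<close>
            by (intro conjI) (assumption | simp only: not_le)+
          then have "(tail (skel G) e, head (skel G) e) \<in> arc_rel G (low_arcs G R h m)"
            unfolding arc_rel_def by (rule imageI)
          then have "(w, head (skel G) e) \<in> arc_rel G (low_arcs G R h m)"
            unfolding out(2)[OF eO(1)] .
          moreover have "(u, w) \<in> (arc_rel G (low_arcs G R h m))\<^sup>*" using True unfolding A_def by simp
          ultimately have "(u, head (skel G) e) \<in> (arc_rel G (low_arcs G R h m))\<^sup>*"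
            by (rule rtrancl_into_rtrancl[rotated])
          then show False using False unfolding A_def by simp
        qed
        then show ?thesis using False m by (simp add: k_def)
      qed (simp add: k_def)
      have "(\<Sum>e\<in>?O. norm_weight G e * k (head (skel G) e)) \<le> (\<Sum>e\<in>?O. norm_weight G e * (h (head (skel G) e) / m))"
        by (rule sum_mono, rule mult_left_mono[OF kh nw]) simp_all
      also have "\<dots> \<le> (\<Sum>e\<in>?O'. norm_weight G e * (h (head (skel G) e) / m))"
      proof (rule sum_mono2)
        show "finite ?O'" by (rule finite_subset[OF _ fin]) blast
        show "?O \<subseteq> ?O'" using R by blast
        fix e assume "e \<in> ?O' - ?O"
        then have "e \<in> out_arcs (skel G) w" by simp
        then show "0 \<le> norm_weight G e * (h (head (skel G) e) / m)"
          using nw h0[OF arc_ends(4)[OF G(2,1) out(1)]] m by simp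
      qed
      also have "\<dots> = (\<Sum>e\<in>?O'. norm_weight G e * h (head (skel G) e)) / m"
        by (simp add: sum_divide_distrib)
      also have "\<dots> \<le> h w / m"
      proof (rule divide_right_mono)
        have "w \<in> verts (skel G) \<inter> \<Omega>" using w A[OF True] R by blast
        then show "(\<Sum>e\<in>?O'. norm_weight G e * h (head (skel G) e)) \<le> h w"
          using h unfolding superharmonic_on_def by blast
      qed (use m in simp)
      finally show ?thesis using True by (simp add: k_def)
    qed
  qed
  moreover have "k u = h u / m" by (simp add: k_def A_def)
  moreover have "h u / m < p" using low m by (simp add: field_simps)
  ultimately show False using hit by linarith
qed

text \<open>If the open traces are disjoint, a common point is an end of both, as open traces
  contain no vertices. If they coincide, so do their closures, the traces; an end of one is then in
  the trace of the other but not in its open part, since a simple path does not revisit its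
  ends.\<close>

lemma traces_share_end:
  assumes emb: "good_embedding G" and G: "weighted_graph G" and e: "e \<in> arcs (skel G)" "e' \<in> arcs (skel G)"
    and x: "x \<in> trace G e" "x \<in> trace G e'"
  shows "{tail (skel G) e, head (skel G) e} \<inter> {tail (skel G) e', head (skel G) e'} \<noteq> {}"
proof -
  have c: "simple_path (curve G e)" "pathstart (curve G e) = tail (skel G) e"
      "pathfinish (curve G e) = head (skel G) e" "open_trace G e \<inter> verts (skel G) = {}"
    if "e \<in> arcs (skel G)" for e
    using emb that unfolding good_embedding_def by blast+
  have split: "trace G e = open_trace G e \<union> {tail (skel G) e, head (skel G) e}"
    if "e \<in> arcs (skel G)" for e
  proof -
    have "{0..1} = {0<..<1} \<union> {0, 1::real}" by auto
    then show ?thesis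
      using c(2,3)[OF that] unfolding open_trace_def path_image_def pathstart_def pathfinish_def
      by (metis image_Un image_empty image_insert)
  qed
  have notopen: "tail (skel G) e \<notin> open_trace G e" "head (skel G) e \<notin> open_trace G e"
    if "e \<in> arcs (skel G)" for e
  proof -
    have "curve G e t \<noteq> curve G e 0 \<and> curve G e t \<noteq> curve G e 1" if "t \<in> {0<..<1}" for t
      using c(1)[OF \<open>e \<in> arcs (skel G)\<close>] that unfolding simple_path_def loop_free_def by force
    then show "tail (skel G) e \<notin> open_trace G e" "head (skel G) e \<notin> open_trace G e"
      using c(2,3)[OF that] unfolding open_trace_def pathstart_def pathfinish_def by force+
  qed
  show ?thesis
  proof (cases "open_trace G e \<inter> open_trace G e' = {}")
    case False
    then have eq: "open_trace G e = open_trace G e'"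
      using emb e unfolding good_embedding_def by blast
    have cl: "closure (open_trace G e) = trace G e" if "e \<in> arcs (skel G)" for e
    proof -
      have path: "continuous_on {0..1} (curve G e)"
        using simple_path_imp_path[OF c(1)[OF that]] by (simp add: path_def)
      have "curve G e ` closure {0<..<1} \<subseteq> closure (curve G e ` {0<..<1})"
      proof (rule image_closure_subset)
        show "continuous_on (closure {0<..<1}) (curve G e)" using path by simp
      qed (rule closed_closure, rule closure_subset)
      then have "trace G e \<subseteq> closure (open_trace G e)"
        by (simp add: path_image_def open_trace_def)
      moreover have "closure (open_trace G e) \<subseteq> trace G e"
      proof (rule closure_minimal)
        show "open_trace G e \<subseteq> trace G e" using split[OF that] by blast
        show "closed (trace G e)" using simple_path_imp_path[OF c(1)[OF that]] by (rule closed_path_image)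
      qed
      ultimately show ?thesis by blast
    qed
    have "trace G e = trace G e'" using cl[OF e(1)] cl[OF e(2)] eq by simp
    then have "tail (skel G) e \<in> trace G e'" using split[OF e(1)] by blast
    moreover have "tail (skel G) e \<notin> open_trace G e'" using notopen(1)[OF e(1)] eq by simp
    ultimately have "tail (skel G) e \<in> {tail (skel G) e', head (skel G) e'}"
      unfolding split[OF e(2)] by blast
    then show ?thesis by blast
  next
    case True
    have "x \<notin> open_trace G e"
    proof
      assume x': "x \<in> open_trace G e"
      then have "x \<notin> open_trace G e'" using True by blast
      then have "x \<in> {tail (skel G) e', head (skel G) e'}"
        using x(2) unfolding split[OF e(2)] by (elim UnE) simp_all
      then have "x \<in> verts (skel G)" using arc_ends(3,4)[OF emb G e(2)] by (elim insertE) simp_all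
      then show False using c(4)[OF e(1)] x' by blast
    qed
    moreover have "x \<notin> open_trace G e'"
    proof
      assume x': "x \<in> open_trace G e'"
      then have "x \<notin> open_trace G e" using True by blast
      then have "x \<in> {tail (skel G) e, head (skel G) e}"
        using x(1) unfolding split[OF e(1)] by (elim UnE) simp_all
      then have "x \<in> verts (skel G)" using arc_ends(3,4)[OF emb G e(1)] by (elim insertE) simp_all
      then show False using c(4)[OF e(2)] x' by blast
    qed
    ultimately have "x \<in> {tail (skel G) e, head (skel G) e}" "x \<in> {tail (skel G) e', head (skel G) e'}"
      using x unfolding split[OF e(1)] split[OF e(2)] by blast+
    then show ?thesis by blast
  qed
qed

section \<open>Chains of crossings\<close>

definition dirs :: "complex set" where
  "dirs = {1, -1, \<i>, -\<i>}"

text \<open>The rectangle swept by \<open>n\<close> consecutive crossings in direction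
  \<open>d\<close>: half width \<open>\<eta> / 2\<close> and a margin \<open>\<eta> / 2\<close>
  beyond the first and the last centre, which are \<open>2 * n * \<eta>\<close> apart.
  Multiplication with \<open>cnj d\<close> turns the direction into the positive real axis. For
  \<open>n = 1\<close> it is the 3 by 1 rectangle of the crossing hypothesis.\<close>

definition strip :: "complex \<Rightarrow> real \<Rightarrow> complex \<Rightarrow> nat \<Rightarrow> complex set" where
  "strip z \<eta> d n = {w. - \<eta> / 2 \<le> Re ((w - z) * cnj d) \<and>
     Re ((w - z) * cnj d) \<le> (2 * real n + 1 / 2) * \<eta> \<and>
     - \<eta> / 2 \<le> Im ((w - z) * cnj d) \<and> Im ((w - z) * cnj d) \<le> \<eta> / 2}"

lemma dirs_mult_cnj: "d \<in> dirs \<Longrightarrow> d * cnj d = 1"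
  by (auto simp: dirs_def)

lemma strip_Suc:
  assumes "0 \<le> \<eta>" "d \<in> dirs"
  shows "strip z \<eta> d n \<subseteq> strip z \<eta> d (Suc n)"
    "strip (z + of_real (2 * \<eta> * real n) * d) \<eta> d 1 \<subseteq> strip z \<eta> d (Suc n)"
proof -
  show "strip z \<eta> d n \<subseteq> strip z \<eta> d (Suc n)"
    using assms(1) by (auto simp: strip_def algebra_simps)
  show "strip (z + of_real (2 * \<eta> * real n) * d) \<eta> d 1 \<subseteq> strip z \<eta> d (Suc n)"
  proof
    fix w assume w: "w \<in> strip (z + of_real (2 * \<eta> * real n) * d) \<eta> d 1"
    define c where "c = (w - z) * cnj d"
    have eq: "(w - (z + of_real (2 * \<eta> * real n) * d)) * cnj d = c - of_real (2 * \<eta> * real n)"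
      using dirs_mult_cnj[OF assms(2)] by (simp add: c_def algebra_simps)
    have p: "0 \<le> \<eta> * real n" using assms(1) by simp
    show "w \<in> strip z \<eta> d (Suc n)"
      using w p assms(1) unfolding strip_def mem_Collect_eq eq c_def[symmetric]
      by (simp add: algebra_simps; linarith?)
  qed
qed

text \<open>A fixed mesh, with the crossing estimate in four directions at every scale from
  \<open>\<eta>0\<close> on; \<open>\<eta>0\<close> will be a multiple of the mesh.\<close>

locale planar_walk =
  fixes G :: "'e plane_graph" and p0 \<eta>0 :: real
  assumes graph: "weighted_graph G" and embedding: "good_embedding G"
    and p0: "0 < p0" and \<eta>0: "0 < \<eta>0"
    and cross: "\<And>z \<eta> d u. \<eta>0 \<le> \<eta> \<Longrightarrow> d \<in> dirs \<Longrightarrow> u \<in> verts (skel G) \<inter> ball z (\<eta> / 4) \<Longrightarrow>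
      p0 < measure (walk_law G u) {\<xi> \<in> space (walk_law G u).
        hits_before_exit G u \<xi> (ball (z + of_real (2 * \<eta>) * d) (\<eta> / 4)) (strip z \<eta> d 1)}"
begin

lemma p0_less_1:
  assumes "u \<in> verts (skel G)"
  shows "p0 < 1"
proof -
  interpret W: prob_space "walk_law G u" by (rule prob_space_walk_law)
  have "u \<in> verts (skel G) \<inter> ball u (\<eta>0 / 4)" using assms \<eta>0 by simp
  from less_le_trans[OF cross[OF order_refl _ this, of 1] W.prob_le_1] show ?thesis
    by (simp add: dirs_def)
qed

lemma ball_in_strip:
  assumes "u \<in> ball z (\<eta> / 4)" "d \<in> dirs"
  shows "u \<in> strip z \<eta> d n"
proof -
  have "0 < \<eta>" using assms(1) le_less_trans[OF zero_le_dist[of z u], of "\<eta> / 4"] by simp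
  have "norm ((u - z) * cnj d) < \<eta> / 4"
    using assms by (auto simp: dirs_def dist_norm norm_minus_commute norm_mult)
  then have "\<bar>Re ((u - z) * cnj d)\<bar> < \<eta> / 4" "\<bar>Im ((u - z) * cnj d)\<bar> < \<eta> / 4"
    using abs_Re_le_cmod[of "(u - z) * cnj d"] abs_Im_le_cmod[of "(u - z) * cnj d"] by linarith+
  moreover have "\<eta> / 4 \<le> (2 * real n + 1 / 2) * \<eta>"
    using \<open>0 < \<eta>\<close> by (simp add: field_simps)
  ultimately show ?thesis
    using \<open>0 < \<eta>\<close> unfolding strip_def mem_Collect_eq by (intro conjI; linarith)
qed

text \<open>Each crossing ends in the ball where the next one begins and raises the threshold by a
  factor \<open>1 / p0\<close>, so \<open>p0 ^ n\<close> is the price of \<open>n\<close>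
  crossings.\<close>

lemma low_line:
  assumes h: "superharmonic_on G \<Omega> h" and \<eta>: "\<eta>0 \<le> \<eta>" and d: "d \<in> dirs"
    and \<Omega>: "strip z \<eta> d n \<subseteq> \<Omega>" and u: "u \<in> verts (skel G) \<inter> ball z (\<eta> / 4)"
    and m: "0 < m" and low: "h u < p0 ^ n * m"
  shows "\<exists>v\<in>verts (skel G) \<inter> ball (z + of_real (2 * \<eta> * real n) * d) (\<eta> / 4).
    (u, v) \<in> (arc_rel G (low_arcs G (strip z \<eta> d n) h m))\<^sup>* \<and> h v < m"
  using \<Omega> m low
proof (induction n arbitrary: m)
  case 0
  then show ?case using u by auto
next
  case (Suc n)
  have \<eta>pos: "0 \<le> \<eta>" using \<eta> \<eta>0 by simp
  let ?z = "z + of_real (2 * \<eta> * real n) * d"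
  have pm: "0 < p0 * m" using p0 Suc.prems by simp
  have "p0 * m \<le> m" using p0_less_1[of u] u Suc.prems by simp
  from Suc.IH[OF order_trans[OF strip_Suc(1)[OF \<eta>pos d] Suc.prems(1)] pm] Suc.prems(3)
  obtain v where v: "v \<in> verts (skel G) \<inter> ball ?z (\<eta> / 4)"
    and uv: "(u, v) \<in> (arc_rel G (low_arcs G (strip z \<eta> d n) h (p0 * m)))\<^sup>*" "h v < p0 * m"
    by (auto simp: mult_ac)
  have "strip ?z \<eta> d 1 \<subseteq> \<Omega>" using strip_Suc(2)[OF \<eta>pos d] Suc.prems(1) by blast
  from low_path[OF graph embedding h this _ _ Suc.prems(2) cross[OF \<eta> d v] uv(2)]
  obtain w where w: "w \<in> verts (skel G) \<inter> ball (?z + of_real (2 * \<eta>) * d) (\<eta> / 4)"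
    and vw: "(v, w) \<in> (arc_rel G (low_arcs G (strip ?z \<eta> d 1) h m))\<^sup>*" "h w < m"
    using v ball_in_strip[OF _ d] by blast
  have eq: "?z + of_real (2 * \<eta>) * d = z + of_real (2 * \<eta> * real (Suc n)) * d"
    by (simp add: algebra_simps)
  have "(u, w) \<in> (arc_rel G (low_arcs G (strip z \<eta> d (Suc n)) h m))\<^sup>*"
  proof (rule rtrancl_trans)
    show "(u, v) \<in> (arc_rel G (low_arcs G (strip z \<eta> d (Suc n)) h m))\<^sup>*"
      using rtrancl_mono[OF arc_rel_mono[OF low_arcs_mono[OF strip_Suc(1)[OF \<eta>pos d] \<open>p0 * m \<le> m\<close>]]] uv(1)
      by blast
    show "(v, w) \<in> (arc_rel G (low_arcs G (strip z \<eta> d (Suc n)) h m))\<^sup>*"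
      using rtrancl_mono[OF arc_rel_mono[OF low_arcs_mono[OF strip_Suc(2)[OF \<eta>pos d] order_refl]]] vw(1)
      by blast
  qed
  then show ?case using w[unfolded eq] vw(2) by blast
qed

text \<open>The ends lie in balls of radius \<open>\<eta> / 4\<close> with centres at least
  \<open>2 * \<eta>\<close> apart, so they differ; at least one arc is used, and the chain of arcs
  is a path in the plane.\<close>

lemma low_curve:
  assumes h: "superharmonic_on G \<Omega> h" and \<eta>: "\<eta>0 \<le> \<eta>" and d: "d \<in> dirs" and n: "0 < n"
    and \<Omega>: "strip z \<eta> d n \<subseteq> \<Omega>" and u: "u \<in> verts (skel G) \<inter> ball z (\<eta> / 4)"
    and m: "0 < m" and low: "h u < p0 ^ n * m"
  shows "\<exists>v\<in>verts (skel G) \<inter> ball (z + of_real (2 * \<eta> * real n) * d) (\<eta> / 4). h v < m \<and>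
    (\<exists>p. path p \<and> pathstart p = u \<and> pathfinish p = v \<and>
      path_image p \<subseteq> (\<Union>e\<in>low_arcs G (strip z \<eta> d n) h m. trace G e))"
proof -
  obtain v where v: "v \<in> verts (skel G) \<inter> ball (z + of_real (2 * \<eta> * real n) * d) (\<eta> / 4)"
    and uv: "(u, v) \<in> (arc_rel G (low_arcs G (strip z \<eta> d n) h m))\<^sup>*" "h v < m"
    using low_line[OF h \<eta> d \<Omega> u m low] by blast
  have "u \<noteq> v"
  proof
    assume eq: "u = v"
    have "norm d = 1" using d by (auto simp: dirs_def)
    then have "dist z (z + of_real (2 * \<eta> * real n) * d) = 2 * \<eta> * real n"
      using \<eta> \<eta>0 by (simp add: dist_norm norm_mult)
    moreover have "dist z (z + of_real (2 * \<eta> * real n) * d) \<le> dist z u + dist (z + of_real (2 * \<eta> * real n) * d) u"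
      by (rule dist_triangle2)
    ultimately have "2 * \<eta> * real n < \<eta> / 2" using u v eq by simp
    moreover have "2 * \<eta> * 1 \<le> 2 * \<eta> * real n" using n \<eta> \<eta>0 by (intro mult_left_mono) auto
    ultimately show False using \<eta> \<eta>0 by simp
  qed
  then have "(u, v) \<in> (arc_rel G (low_arcs G (strip z \<eta> d n) h m))\<^sup>+"
    using rtranclD[OF uv(1)] by blast
  moreover have "low_arcs G (strip z \<eta> d n) h m \<subseteq> arcs (skel G)" unfolding low_arcs_def by blast
  ultimately have "\<exists>p. path p \<and> pathstart p = u \<and> pathfinish p = v \<and>
      path_image p \<subseteq> (\<Union>e\<in>low_arcs G (strip z \<eta> d n) h m. trace G e)"
    by (intro path_along_arcs[OF embedding])
  with uv(2) show ?thesis by (intro bexI[OF _ v] conjI)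
qed

lemma low_arcs_strip:
  assumes "strip z \<eta> d n \<subseteq> R" "m \<le> m'" "x \<in> (\<Union>e\<in>low_arcs G (strip z \<eta> d n) h m. trace G e)"
  shows "x \<in> strip z \<eta> d n" "x \<in> (\<Union>e\<in>low_arcs G R h m'. trace G e)"
proof -
  show "x \<in> strip z \<eta> d n" using assms(3) by (auto simp: low_arcs_def)
  show "x \<in> (\<Union>e\<in>low_arcs G R h m'. trace G e)"
    using low_arcs_mono[OF assms(1,2), of G h] assms(3) by blast
qed


lemma superharmonic_zero: "superharmonic_on G \<Omega> (\<lambda>_. 0)"
  by (simp add: superharmonic_on_def)

lemma p0_power_le:
  assumes "u \<in> verts (skel G)" "n \<le> N" "0 \<le> m"
  shows "p0 ^ N * m \<le> p0 ^ n * m"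
  using power_decreasing[OF assms(2), of p0] p0 p0_less_1[OF assms(1)] assms(3)
  by (intro mult_right_mono) auto

text \<open>In units of \<open>2 * \<eta>\<close> around \<open>v\<close>: left 5 and down 4 to the
  starting point \<open>(-5, -4)\<close>, then a loop, right 9, up 8, left 8, down 9, to
  \<open>(-4, -5)\<close>. The overshoot by one unit makes the first and the last side cross. The
  price is \<open>5 + 4 + 9 + 8 + 8 + 9 = 43\<close> crossings. The sides are about
  \<open>8 * \<eta>\<close> away from \<open>v\<close>, hence around \<open>z\<close>, and inside
  \<open>ball v (30 * \<eta>)\<close>.\<close>

lemma low_loop:
  assumes h: "superharmonic_on G \<Omega> h" and \<eta>: "\<eta>0 \<le> \<eta>" and v: "v \<in> verts (skel G)"
    and \<Omega>: "ball v (30 * \<eta>) \<subseteq> \<Omega>" and m: "0 < m" and low: "h v < p0 ^ 43 * m"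
    and \<Gamma>: "connected \<Gamma>" "z \<in> \<Gamma>" "w \<in> \<Gamma>" and z: "dist v z \<le> 4 * \<eta>" and w: "30 * \<eta> \<le> dist v w"
  shows "\<exists>e\<in>low_arcs G (ball v (30 * \<eta>)) h m. trace G e \<inter> \<Gamma> \<noteq> {}"
proof -
  have \<eta>pos: "0 < \<eta>" using \<eta> \<eta>0 by simp
  let ?c = "\<lambda>a b. v + Complex (2 * \<eta> * a) (2 * \<eta> * b)"
  have d: "1 \<in> dirs" "-1 \<in> dirs" "\<i> \<in> dirs" "-\<i> \<in> dirs" by (auto simp: dirs_def)
  have pw: "0 < p0 ^ n * m" "p0 ^ n * m \<le> m" for n
    using p0 m p0_power_le[OF v, of 0 n m] by auto
  have add: "p0 ^ (i + j) * m = p0 ^ i * (p0 ^ j * m)" for i j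
    by (simp add: power_add mult_ac)
  have S1: "x \<in> strip z \<eta> 1 n \<longleftrightarrow> - \<eta> / 2 \<le> Re (x - z) \<and> Re (x - z) \<le> (2 * real n + 1 / 2) * \<eta> \<and> - \<eta> / 2 \<le> Im (x - z) \<and> Im (x - z) \<le> \<eta> / 2"
    and S2: "x \<in> strip z \<eta> (-1) n \<longleftrightarrow> - \<eta> / 2 \<le> - Re (x - z) \<and> - Re (x - z) \<le> (2 * real n + 1 / 2) * \<eta> \<and> - \<eta> / 2 \<le> Im (x - z) \<and> Im (x - z) \<le> \<eta> / 2"
    and S3: "x \<in> strip z \<eta> \<i> n \<longleftrightarrow> - \<eta> / 2 \<le> Im (x - z) \<and> Im (x - z) \<le> (2 * real n + 1 / 2) * \<eta> \<and> - \<eta> / 2 \<le> Re (x - z) \<and> Re (x - z) \<le> \<eta> / 2"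
    and S4: "x \<in> strip z \<eta> (-\<i>) n \<longleftrightarrow> - \<eta> / 2 \<le> - Im (x - z) \<and> - Im (x - z) \<le> (2 * real n + 1 / 2) * \<eta> \<and> - \<eta> / 2 \<le> Re (x - z) \<and> Re (x - z) \<le> \<eta> / 2"
    for x z n by (auto simp: strip_def)
  \<comment> \<open>Relative to \<open>v\<close>, the strips have coordinates at most
    \<open>(10 + 1 / 2) * \<eta>\<close>; the norm is at most the sum of the two.\<close>
  have inball: "x \<in> ball v (30 * \<eta>)" if "\<bar>Re (x - v)\<bar> \<le> 12 * \<eta>" "\<bar>Im (x - v)\<bar> \<le> 12 * \<eta>" for x
    using cmod_le[of "x - v"] that \<eta>pos by (simp add: dist_norm norm_minus_commute)
  note S = S1 S2 S3 S4
  have s1: "strip (?c 0 0) \<eta> (-1) 5 \<subseteq> ball v (30 * \<eta>)"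
    using \<eta>pos by (intro subsetI inball; clarsimp simp: S abs_le_iff; linarith)
  have s2: "strip (?c (-5) 0) \<eta> (-\<i>) 4 \<subseteq> ball v (30 * \<eta>)"
    using \<eta>pos by (intro subsetI inball; clarsimp simp: S abs_le_iff; linarith)
  have sf: "strip (?c (-5) (-4)) \<eta> 1 9 \<subseteq> ball v (30 * \<eta>)"
    using \<eta>pos by (intro subsetI inball; clarsimp simp: S abs_le_iff; linarith)
  have sr: "strip (?c 4 (-4)) \<eta> \<i> 8 \<subseteq> ball v (30 * \<eta>)"
    using \<eta>pos by (intro subsetI inball; clarsimp simp: S abs_le_iff; linarith)
  have st: "strip (?c 4 4) \<eta> (-1) 8 \<subseteq> ball v (30 * \<eta>)"
    using \<eta>pos by (intro subsetI inball; clarsimp simp: S abs_le_iff; linarith)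
  have sg: "strip (?c (-4) 4) \<eta> (-\<i>) 9 \<subseteq> ball v (30 * \<eta>)"
    using \<eta>pos by (intro subsetI inball; clarsimp simp: S abs_le_iff; linarith)
  have C: "?c a b + of_real (2 * \<eta> * real n) * 1 = ?c (a + real n) b"
    "?c a b + of_real (2 * \<eta> * real n) * (-1) = ?c (a - real n) b"
    "?c a b + of_real (2 * \<eta> * real n) * \<i> = ?c a (b + real n)"
    "?c a b + of_real (2 * \<eta> * real n) * (-\<i>) = ?c a (b - real n)" for a b n
    by (simp_all add: complex_eq_iff algebra_simps)
  have v0: "v \<in> verts (skel G) \<inter> ball (?c 0 0) (\<eta> / 4)"
    using v \<eta>pos by (simp add: zero_complex.code[symmetric])
  \<comment> \<open>The exponents \<open>38, 34, 25, 17, 9, 0\<close> count the crossings still to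
    be paid for.\<close>
  obtain v1 where v1: "v1 \<in> verts (skel G) \<inter> ball (?c (-5) 0) (\<eta> / 4)" "h v1 < p0 ^ 38 * m"
    using low_line[OF h \<eta> d(2) order_trans[OF s1 \<Omega>] v0 pw(1)[of 38]] low add[of 5 38]
    unfolding C by auto
  obtain v2 where v2: "v2 \<in> verts (skel G) \<inter> ball (?c (-5) (-4)) (\<eta> / 4)" "h v2 < p0 ^ 34 * m"
    using low_line[OF h \<eta> d(4) order_trans[OF s2 \<Omega>] v1(1) pw(1)[of 34]] v1(2) add[of 4 34]
    unfolding C by auto
  obtain v3 f where v3: "v3 \<in> verts (skel G) \<inter> ball (?c 4 (-4)) (\<eta> / 4)" "h v3 < p0 ^ 25 * m"
    and f: "path f" "pathstart f = v2" "pathfinish f = v3"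
      "path_image f \<subseteq> (\<Union>e\<in>low_arcs G (strip (?c (-5) (-4)) \<eta> 1 9) h (p0 ^ 25 * m). trace G e)"
    using low_curve[OF h \<eta> d(1) _ order_trans[OF sf \<Omega>] v2(1) pw(1)[of 25]] v2(2) add[of 9 25]
    unfolding C by auto
  obtain v4 r where v4: "v4 \<in> verts (skel G) \<inter> ball (?c 4 4) (\<eta> / 4)" "h v4 < p0 ^ 17 * m"
    and r: "path r" "pathstart r = v3" "pathfinish r = v4"
      "path_image r \<subseteq> (\<Union>e\<in>low_arcs G (strip (?c 4 (-4)) \<eta> \<i> 8) h (p0 ^ 17 * m). trace G e)"
    using low_curve[OF h \<eta> d(3) _ order_trans[OF sr \<Omega>] v3(1) pw(1)[of 17]] v3(2) add[of 8 17]
    unfolding C by auto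
  obtain v5 t where v5: "v5 \<in> verts (skel G) \<inter> ball (?c (-4) 4) (\<eta> / 4)" "h v5 < p0 ^ 9 * m"
    and t: "path t" "pathstart t = v4" "pathfinish t = v5"
      "path_image t \<subseteq> (\<Union>e\<in>low_arcs G (strip (?c 4 4) \<eta> (-1) 8) h (p0 ^ 9 * m). trace G e)"
    using low_curve[OF h \<eta> d(2) _ order_trans[OF st \<Omega>] v4(1) pw(1)[of 9]] v4(2) add[of 8 9]
    unfolding C by auto
  obtain v6 g where v6: "v6 \<in> verts (skel G) \<inter> ball (?c (-4) (-5)) (\<eta> / 4)" "h v6 < m"
    and g: "path g" "pathstart g = v5" "pathfinish g = v6"
      "path_image g \<subseteq> (\<Union>e\<in>low_arcs G (strip (?c (-4) 4) \<eta> (-\<i>) 9) h m. trace G e)"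
    using low_curve[OF h \<eta> d(4) _ order_trans[OF sg \<Omega>] v5(1) m] v5(2)
    unfolding C by auto
  let ?E = "\<Union>e\<in>low_arcs G (ball v (30 * \<eta>)) h m. trace G e"
  have near: "Re x < Re (?c a b) + \<eta> / 4" "Im x < Im (?c a b) + \<eta> / 4"
    if "x \<in> verts (skel G) \<inter> ball (?c a b) (\<eta> / 4)" for x a b
  proof -
    have "norm (x - ?c a b) < \<eta> / 4" using that by (simp only: Int_iff mem_ball dist_norm norm_minus_commute)
    then show "Re x < Re (?c a b) + \<eta> / 4" "Im x < Im (?c a b) + \<eta> / 4"
      using complex_Re_le_cmod[of "x - ?c a b"] abs_Im_le_cmod[of "x - ?c a b"]
      by (simp_all only: minus_complex.sel)
  qed
  have img: "x \<in> strip c \<eta> d n" "x \<in> ?E"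
    if "path_image p \<subseteq> (\<Union>e\<in>low_arcs G (strip c \<eta> d n) h m'. trace G e)" "x \<in> path_image p"
      "strip c \<eta> d n \<subseteq> ball v (30 * \<eta>)" "m' \<le> m" for x p c d n m'
    using low_arcs_strip[OF that(3,4), of x h] that(1,2) by blast+
  let ?T = "\<lambda>p. (\<lambda>x. x - v) \<circ> p"
  have T: "path (?T p)" if "path p" for p
    by (rule path_continuous_image[OF that]) (intro continuous_intros)
  have "(\<lambda>x. x - v) ` \<Gamma> \<inter> (path_image (?T f) \<union> path_image (?T r) \<union> path_image (?T t) \<union> path_image (?T g)) \<noteq> {}"
  proof (rule separating_loop[where a = "8 * \<eta>" and s = "\<eta> / 2" and K = "30 * \<eta>" and z = "z - v" and w = "w - v"])
    have shift: "\<exists>y. y \<in> path_image p \<and> x = y - v" if "x \<in> path_image (?T p)" for x p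
      using that unfolding path_image_compose by blast
    show "\<bar>Im x + 8 * \<eta>\<bar> \<le> \<eta> / 2" if x: "x \<in> path_image (?T f)" for x
    proof -
      obtain y where y: "y \<in> path_image f" "x = y - v" using shift[OF x] by blast
      note I = img(1)[OF f(4) y(1) sf pw(2)]
      from I[unfolded S1 minus_complex.sel plus_complex.sel complex.sel] show ?thesis unfolding y(2) minus_complex.sel abs_le_iff by (elim conjE) (intro conjI | linarith)+
    qed
    show "8 * \<eta> - \<eta> / 2 \<le> Re x" if x: "x \<in> path_image (?T r)" for x
    proof -
      obtain y where y: "y \<in> path_image r" "x = y - v" using shift[OF x] by blast
      note I = img(1)[OF r(4) y(1) sr pw(2)]
      from I[unfolded S3 minus_complex.sel plus_complex.sel complex.sel] show ?thesis unfolding y(2) minus_complex.sel abs_le_iff by (elim conjE) (intro conjI | linarith)+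
    qed
    show "8 * \<eta> - \<eta> / 2 \<le> Im x" if x: "x \<in> path_image (?T t)" for x
    proof -
      obtain y where y: "y \<in> path_image t" "x = y - v" using shift[OF x] by blast
      note I = img(1)[OF t(4) y(1) st pw(2)]
      from I[unfolded S2 minus_complex.sel plus_complex.sel complex.sel] show ?thesis unfolding y(2) minus_complex.sel abs_le_iff by (elim conjE) (intro conjI | linarith)+
    qed
    show "\<bar>Re x + 8 * \<eta>\<bar> \<le> \<eta> / 2" if x: "x \<in> path_image (?T g)" for x
    proof -
      obtain y where y: "y \<in> path_image g" "x = y - v" using shift[OF x] by blast
      note I = img(1)[OF g(4) y(1) sg order_refl]
      from I[unfolded S4 minus_complex.sel plus_complex.sel complex.sel] show ?thesis unfolding y(2) minus_complex.sel abs_le_iff by (elim conjE) (intro conjI | linarith)+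
    qed
    have "pathstart (?T f) = v2 - v" "pathfinish (?T g) = v6 - v"
      by (simp_all add: pathstart_compose pathfinish_compose f g)
    then show "Re (pathstart (?T f)) < - (8 * \<eta>) - \<eta> / 2" "Im (pathfinish (?T g)) < - (8 * \<eta>) - \<eta> / 2"
      using near(1)[OF v2(1)] near(2)[OF v6(1)] \<eta>pos by simp_all
    have sub: "x - v \<in> ball 0 (30 * \<eta>)" if "x \<in> ball v (30 * \<eta>)" for x
      using that by (simp add: dist_norm norm_minus_commute)
    have im: "path_image (?T p) \<subseteq> ball 0 (30 * \<eta>)"
      if "\<And>x. x \<in> path_image p \<Longrightarrow> x \<in> strip c \<eta> d n" "strip c \<eta> d n \<subseteq> ball v (30 * \<eta>)" for p c d n
      unfolding path_image_compose by (intro image_subsetI sub subsetD[OF that(2)] that(1))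
    show "path_image (?T f) \<union> path_image (?T r) \<union> path_image (?T t) \<union> path_image (?T g) \<subseteq> ball 0 (30 * \<eta>)"
      using im[OF img(1)[OF f(4) _ sf pw(2)] sf] im[OF img(1)[OF r(4) _ sr pw(2)] sr]
        im[OF img(1)[OF t(4) _ st pw(2)] st] im[OF img(1)[OF g(4) _ sg order_refl] sg]
      by (intro Un_least)
    show "connected ((\<lambda>x. x - v) ` \<Gamma>)"
      by (rule connected_continuous_image[OF _ \<Gamma>(1)]) (intro continuous_intros)
    show "\<bar>Re (z - v)\<bar> < 8 * \<eta> - \<eta> / 2" "\<bar>Im (z - v)\<bar> < 8 * \<eta> - \<eta> / 2"
      using z abs_Re_le_cmod[of "z - v"] abs_Im_le_cmod[of "z - v"] \<eta>pos
      unfolding dist_norm norm_minus_commute[of v z] by linarith+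
    show "30 * \<eta> \<le> norm (w - v)" using w by (simp add: dist_norm norm_minus_commute)
  qed (use T f r t g \<Gamma> \<eta>pos in \<open>auto simp: pathstart_compose pathfinish_compose\<close>)
  then obtain y where y: "y \<in> (\<lambda>x. x - v) ` \<Gamma>"
    "y \<in> (\<lambda>x. x - v) ` (path_image f \<union> path_image r \<union> path_image t \<union> path_image g)"
    unfolding path_image_compose image_Un by blast
  from y(1) obtain x where x1: "x \<in> \<Gamma>" "y = x - v" by blast
  from y(2) obtain x' where x2: "x' \<in> path_image f \<union> path_image r \<union> path_image t \<union> path_image g" "y = x' - v"
    by (rule imageE)
  have "x' = x" using x1(2) x2(2) by simp
  with x1(1) x2(1) have x: "x \<in> \<Gamma>" "x \<in> path_image f \<union> path_image r \<union> path_image t \<union> path_image g"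
    by simp_all
  from x(2) have "x \<in> ?E"
  proof (elim UnE)
    assume "x \<in> path_image f" then show ?thesis by (rule img(2)[OF f(4) _ sf pw(2)])
  next
    assume "x \<in> path_image r" then show ?thesis by (rule img(2)[OF r(4) _ sr pw(2)])
  next
    assume "x \<in> path_image t" then show ?thesis by (rule img(2)[OF t(4) _ st pw(2)])
  next
    assume "x \<in> path_image g" then show ?thesis by (rule img(2)[OF g(4) _ sg order_refl])
  qed
  then obtain e where "e \<in> low_arcs G (ball v (30 * \<eta>)) h m" "x \<in> trace G e" by (rule UN_E)
  then show ?thesis using x(1) by blast
qed

end

section \<open>Reaching a neighbourhood of a given point\<close>

context planar_walk
begin

text \<open>One horizontal and one vertical line, with coordinates rounded towards zero to multiples
  of \<open>2 * \<eta>\<close>. Their lengths add up to at most \<open>2 * dist u y\<close>, so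
  there are at most \<open>dist u y / \<eta>\<close> crossings to pay for.\<close>

lemma low_reach:
  assumes h: "superharmonic_on G \<Omega> h" and \<eta>: "\<eta>0 \<le> \<eta>" and u: "u \<in> verts (skel G)"
    and \<Omega>: "ball u (2 * dist u y + 4 * \<eta>) \<subseteq> \<Omega>" and N: "dist u y / \<eta> \<le> real N"
    and m: "0 < m" and low: "h u < p0 ^ N * m"
  shows "\<exists>v\<in>verts (skel G). dist v y \<le> 4 * \<eta> \<and> h v < m \<and> (u, v) \<in> (arc_rel G (low_arcs G \<Omega> h m))\<^sup>*"
proof -
  have \<eta>pos: "0 < \<eta>" using \<eta> \<eta>0 by simp
  have split: "\<exists>n d::real. d \<in> {1, -1} \<and> \<bar>x - 2 * \<eta> * real n * d\<bar> \<le> 2 * \<eta> \<and> 2 * \<eta> * real n \<le> \<bar>x\<bar>" for x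
  proof -
    define n where "n = nat \<lfloor>\<bar>x\<bar> / (2 * \<eta>)\<rfloor>"
    have n: "real n \<le> \<bar>x\<bar> / (2 * \<eta>)" "\<bar>x\<bar> / (2 * \<eta>) < real n + 1"
      using \<eta>pos unfolding n_def by (auto simp: of_nat_nat)
    then have n': "2 * \<eta> * real n \<le> \<bar>x\<bar>" "\<bar>x\<bar> < 2 * \<eta> * real n + 2 * \<eta>"
      using \<eta>pos by (simp_all add: field_simps)
    define d :: real where "d = (if 0 \<le> x then 1 else -1)"
    have "d \<in> {1, -1}" by (simp add: d_def)
    moreover have "\<bar>x - 2 * \<eta> * real n * d\<bar> \<le> 2 * \<eta>"
    proof (cases "0 \<le> x")
      case True
      then have "\<bar>x\<bar> = x" by simp
      with n' \<eta>pos True show ?thesis unfolding d_def by (simp add: abs_le_iff)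
    next
      case False
      then have "\<bar>x\<bar> = - x" by simp
      with n' \<eta>pos False show ?thesis unfolding d_def by (simp add: abs_le_iff)
    qed
    ultimately show ?thesis using n'(1) by (intro exI conjI)
  qed
  obtain a and d1 :: real where a: "d1 \<in> {1, -1}" "\<bar>Re (y - u) - 2 * \<eta> * real a * d1\<bar> \<le> 2 * \<eta>"
    "2 * \<eta> * real a \<le> \<bar>Re (y - u)\<bar>" using split[of "Re (y - u)"] by (elim exE conjE)
  obtain b and d2 :: real where b: "d2 \<in> {1, -1}" "\<bar>Im (y - u) - 2 * \<eta> * real b * d2\<bar> \<le> 2 * \<eta>"
    "2 * \<eta> * real b \<le> \<bar>Im (y - u)\<bar>" using split[of "Im (y - u)"] by (elim exE conjE)
  have nrm: "\<bar>Re (y - u)\<bar> \<le> dist u y" "\<bar>Im (y - u)\<bar> \<le> dist u y"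
    using abs_Re_le_cmod[of "y - u"] abs_Im_le_cmod[of "y - u"] by (simp_all add: dist_norm norm_minus_commute)
  define e1 where "e1 = complex_of_real d1"
  define e2 where "e2 = of_real d2 * \<i>"
  have e: "e1 \<in> dirs" "e2 \<in> dirs" using a(1) b(1) by (auto simp: dirs_def e1_def e2_def)
  define z where "z = u + of_real (2 * \<eta> * real a) * e1"
  have e1d: "Re e1 = d1" "Im e1 = 0" and e2d: "Re e2 = 0" "Im e2 = d2" by (auto simp: e1_def e2_def)
  have inball: "x \<in> ball u (2 * dist u y + 4 * \<eta>)"
    if "\<bar>Re (x - u)\<bar> \<le> dist u y + \<eta>" "\<bar>Im (x - u)\<bar> \<le> dist u y + \<eta>" for x
    using cmod_le[of "x - u"] that \<eta>pos by (simp add: dist_norm norm_minus_commute)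
  have s1: "strip u \<eta> e1 a \<subseteq> \<Omega>"
  proof (rule order_trans[OF _ \<Omega>], rule subsetI, rule inball)
    fix x assume "x \<in> strip u \<eta> e1 a"
    then have *: "- \<eta> / 2 \<le> Re (x - u) * d1" "Re (x - u) * d1 \<le> (2 * real a + 1 / 2) * \<eta>"
      "- \<eta> / 2 \<le> Im (x - u) * d1" "Im (x - u) * d1 \<le> \<eta> / 2"
      unfolding strip_def by (simp_all add: e1d)
    have 1: "(2 * real a + 1 / 2) * \<eta> \<le> dist u y + \<eta> / 2" using a(3) nrm(1) by (simp add: algebra_simps)
    have ab: "\<bar>Re (x - u)\<bar> = \<bar>Re (x - u) * d1\<bar>" "\<bar>Im (x - u)\<bar> = \<bar>Im (x - u) * d1\<bar>"
      using a(1) by auto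
    have d0: "0 \<le> dist u y" by simp
    show "\<bar>Re (x - u)\<bar> \<le> dist u y + \<eta>" unfolding ab(1) using *(1,2) 1 \<eta>pos d0 by (intro abs_leI) linarith+
    show "\<bar>Im (x - u)\<bar> \<le> dist u y + \<eta>" unfolding ab(2) using *(3,4) \<eta>pos d0 by (intro abs_leI) linarith+
  qed
  have s2: "strip z \<eta> e2 b \<subseteq> \<Omega>"
  proof (rule order_trans[OF _ \<Omega>], rule subsetI, rule inball)
    fix x assume "x \<in> strip z \<eta> e2 b"
    then have *: "- \<eta> / 2 \<le> Im (x - z) * d2" "Im (x - z) * d2 \<le> (2 * real b + 1 / 2) * \<eta>"
      "- \<eta> / 2 \<le> - (Re (x - z) * d2)" "- (Re (x - z) * d2) \<le> \<eta> / 2"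
      unfolding strip_def by (simp_all add: e2d)
    have 1: "(2 * real b + 1 / 2) * \<eta> \<le> dist u y + \<eta> / 2" using b(3) nrm(2) by (simp add: algebra_simps)
    have ab: "\<bar>Re (x - z)\<bar> = \<bar>Re (x - z) * d2\<bar>" "\<bar>Im (x - z)\<bar> = \<bar>Im (x - z) * d2\<bar>"
      using b(1) by auto
    have d0: "0 \<le> dist u y" by simp
    have i: "Im (x - u) = Im (x - z)" by (simp add: z_def e1d)
    have r: "Re (x - u) = Re (x - z) + 2 * \<eta> * real a * d1" by (simp add: z_def e1d)
    have "\<bar>2 * \<eta> * real a * d1\<bar> \<le> dist u y" using a(1,3) nrm(1) \<eta>pos by (auto simp: abs_mult)
    moreover have "\<bar>Re (x - z)\<bar> \<le> \<eta> / 2" unfolding ab(1) using *(3,4) by (intro abs_leI) linarith+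
    ultimately show "\<bar>Re (x - u)\<bar> \<le> dist u y + \<eta>" unfolding r using \<eta>pos by linarith
    show "\<bar>Im (x - u)\<bar> \<le> dist u y + \<eta>" unfolding i ab(2) using *(1,2) 1 \<eta>pos d0 by (intro abs_leI) linarith+
  qed
  have "2 * \<eta> * real (a + b) \<le> 2 * dist u y" using a(3) b(3) nrm by (simp add: algebra_simps)
  then have "real (a + b) \<le> dist u y / \<eta>" using \<eta>pos by (simp add: field_simps)
  then have "a + b \<le> N" using N by linarith
  then have low': "h u < p0 ^ a * (p0 ^ b * m)"
    using less_le_trans[OF low p0_power_le[OF u \<open>a + b \<le> N\<close> less_imp_le[OF m]]]
    by (simp only: power_add mult.assoc)
  have u': "u \<in> verts (skel G) \<inter> ball u (\<eta> / 4)" using u \<eta>pos by simp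
  have pb: "0 < p0 ^ b * m" "p0 ^ b * m \<le> m" using p0 m p0_power_le[OF u, of 0 b m] by auto
  obtain w where w: "w \<in> verts (skel G) \<inter> ball z (\<eta> / 4)" "h w < p0 ^ b * m"
    "(u, w) \<in> (arc_rel G (low_arcs G (strip u \<eta> e1 a) h (p0 ^ b * m)))\<^sup>*"
    using low_line[OF h \<eta> e(1) s1 u' pb(1) low'] unfolding z_def by blast
  obtain v where v: "v \<in> verts (skel G) \<inter> ball (z + of_real (2 * \<eta> * real b) * e2) (\<eta> / 4)" "h v < m"
    "(w, v) \<in> (arc_rel G (low_arcs G (strip z \<eta> e2 b) h m))\<^sup>*"
    using low_line[OF h \<eta> e(2) s2 w(1) m w(2)] by blast
  have "(u, w) \<in> (arc_rel G (low_arcs G \<Omega> h m))\<^sup>*"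
    using rtrancl_mono[OF arc_rel_mono[OF low_arcs_mono[OF s1 pb(2)]]] w(3) by blast
  moreover have "(w, v) \<in> (arc_rel G (low_arcs G \<Omega> h m))\<^sup>*"
    using rtrancl_mono[OF arc_rel_mono[OF low_arcs_mono[OF s2 order_refl]]] v(3) by blast
  ultimately have "(u, v) \<in> (arc_rel G (low_arcs G \<Omega> h m))\<^sup>*" by (rule rtrancl_trans)
  moreover have "dist v y \<le> 4 * \<eta>"
  proof -
    let ?c = "z + of_real (2 * \<eta> * real b) * e2"
    have "Re (y - ?c) = Re (y - u) - 2 * \<eta> * real a * d1" "Im (y - ?c) = Im (y - u) - 2 * \<eta> * real b * d2"
      by (simp_all add: z_def e1d e2d)
    then have "\<bar>Re (y - ?c)\<bar> \<le> 2 * \<eta>" "\<bar>Im (y - ?c)\<bar> \<le> 2 * \<eta>" using a(2) b(2) by simp_all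
    from power_mono[OF this(1) abs_ge_zero, of 2] power_mono[OF this(2) abs_ge_zero, of 2]
    have "(Re (y - ?c))\<^sup>2 \<le> (2 * \<eta>)\<^sup>2" "(Im (y - ?c))\<^sup>2 \<le> (2 * \<eta>)\<^sup>2" by (simp_all only: power2_abs)
    \<comment> \<open>An error of \<open>2 * \<eta>\<close> in each coordinate gives
      \<open>sqrt 8 * \<eta>\<close>, rounded up to \<open>3 * \<eta>\<close>; the final ball adds
      \<open>\<eta> / 4\<close>.\<close>
    then have "(norm (y - ?c))\<^sup>2 \<le> 8 * \<eta>\<^sup>2" unfolding cmod_power2 by (simp add: power_mult_distrib)
    also have "\<dots> \<le> (3 * \<eta>)\<^sup>2" by (simp add: power_mult_distrib)
    finally have "norm (y - ?c) \<le> 3 * \<eta>" by (rule power2_le_imp_le) (use \<eta>pos in simp)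
    moreover have "dist v y \<le> dist ?c v + norm (y - ?c)"
      using dist_triangle[of v y ?c] by (simp add: dist_norm norm_minus_commute)
    ultimately show ?thesis using v(1) \<eta>pos by simp
  qed
  ultimately show ?thesis using v by blast
qed

text \<open>For the zero function every arc is low, so the statement on small values becomes one on
  reachability.\<close>

lemma reach_everywhere:
  assumes u: "u \<in> verts (skel G)"
  shows "\<exists>v\<in>verts (skel G). dist v y \<le> 4 * \<eta>0 \<and> (u, v) \<in> (arc_rel G (arcs (skel G)))\<^sup>*"
proof -
  obtain N :: nat where N: "dist u y / \<eta>0 \<le> real N" using real_arch_simple by blast
  have "low_arcs G UNIV (\<lambda>_. 0) 1 = arcs (skel G)" by (simp add: low_arcs_def)
  then show ?thesis
    using low_reach[OF superharmonic_zero order_refl u subset_UNIV N, of 1] p0 by simp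
qed

end

section \<open>Edges are short\<close>

context planar_walk
begin

text \<open>The walk can turn around an intermediate point of an edge. As edges do not cross, it meets the
  edge at one of its ends, which is therefore close.\<close>

lemma trace_subset_ball:
  assumes e: "e \<in> arcs (skel G)"
  shows "trace G e \<subseteq> ball (tail (skel G) e) (120 * \<eta>0)"
proof (rule ccontr)
  let ?u = "tail (skel G) e" and ?v = "head (skel G) e"
  assume "\<not> ?thesis"
  then obtain x0 where x0: "x0 \<in> trace G e" "120 * \<eta>0 \<le> dist ?u x0" by force
  note ends = arc_ends[OF embedding graph e]
  have conn: "connected (trace G e)"
  proof (rule connected_path_image)
    have "valid_path (curve G e)" using embedding e unfolding good_embedding_def by blast
    then show "path (curve G e)" by (rule valid_path_imp_path)
  qed
  have ivt: "\<exists>z\<in>trace G e. dist ?u z = r" if "0 \<le> r" "r \<le> dist ?u x" "x \<in> trace G e" for r x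
  proof -
    have "connected (dist ?u ` trace G e)"
      by (rule connected_continuous_image[OF _ conn]) (intro continuous_intros)
    then have "r \<in> dist ?u ` trace G e"
      by (rule connectedD_interval[OF _ imageI[OF ends(1)] imageI[OF that(3)]]) (use that in simp_all)
    then show ?thesis by (metis imageE)
  qed
  \<comment> \<open>A point of the edge far from both ends: if the ends are
    \<open>80 * \<eta>0\<close> apart, a point at distance \<open>40 * \<eta>0\<close> from the
    tail; otherwise \<open>x0\<close>, which is \<open>120 * \<eta>0\<close> from the tail.\<close>
  obtain z where z: "z \<in> trace G e" "40 * \<eta>0 \<le> dist ?u z" "40 * \<eta>0 \<le> dist ?v z"
  proof (cases "80 * \<eta>0 \<le> dist ?u ?v")
    case True
    obtain z where z: "z \<in> trace G e" "dist ?u z = 40 * \<eta>0"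
      using ivt[of "40 * \<eta>0" ?v] True ends(2) \<eta>0 by auto
    have "dist ?u ?v \<le> dist ?u z + dist ?v z" by (rule dist_triangle2)
    then show ?thesis using that[OF z(1)] z(2) True by simp
  next
    case False
    have "dist ?u x0 \<le> dist ?u ?v + dist ?v x0" by (rule dist_triangle)
    then show ?thesis using that[OF x0(1)] x0(2) False \<eta>0 by simp
  qed
  obtain v where v: "v \<in> verts (skel G)" "dist v z \<le> 4 * \<eta>0"
    using reach_everywhere[OF ends(3)] by blast
  have far1: "30 * \<eta>0 \<le> dist v x" if "40 * \<eta>0 \<le> dist x z" for x
  proof -
    have "dist x z \<le> dist v x + dist v z" by (rule dist_triangle3)
    then show ?thesis using that v(2) \<eta>0 by linarith
  qed
  note far = far1[OF z(2)] far1[OF z(3)]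
  \<comment> \<open>With the zero function, \<open>low_loop\<close> is about a plain loop of edges
    around \<open>z\<close> inside \<open>ball v (30 * \<eta>0)\<close>. The edge runs from
    \<open>z\<close> out of this ball and meets the loop, but its ends are outside the ball, so no
    end can be shared.\<close>
  have "(0::real) < 1" "(0::real) < p0 ^ 43 * 1" using p0 by simp_all
  from low_loop[OF superharmonic_zero order_refl v(1) subset_UNIV this conn z(1) ends(1) v(2) far(1)]
  obtain e' where e': "e' \<in> low_arcs G (ball v (30 * \<eta>0)) (\<lambda>_. 0) 1" "trace G e' \<inter> trace G e \<noteq> {}"
    by blast
  from e'(1) have e'': "e' \<in> arcs (skel G)" "trace G e' \<subseteq> ball v (30 * \<eta>0)"
    unfolding low_arcs_def by simp_all
  obtain x where x: "x \<in> trace G e'" "x \<in> trace G e" using e'(2) by blast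
  have in_ball: "tail (skel G) e' \<in> ball v (30 * \<eta>0)" "head (skel G) e' \<in> ball v (30 * \<eta>0)"
    using subsetD[OF e''(2) arc_ends(1)[OF embedding graph e''(1)]]
      subsetD[OF e''(2) arc_ends(2)[OF embedding graph e''(1)]] by simp_all
  have "?u \<notin> ball v (30 * \<eta>0)" "?v \<notin> ball v (30 * \<eta>0)" using far by simp_all
  with in_ball have "{tail (skel G) e', head (skel G) e'} \<inter> {?u, ?v} = {}" by (simp add: set_eq_iff) metis
  then show False
    using traces_share_end[OF embedding graph e''(1) e x] by (rule notE[rotated])
qed

end

section \<open>A local Harnack inequality\<close>

context planar_walk
begin

text \<open>Otherwise the set \<open>A\<close> reachable along arcs of value at least
  \<open>h s\<close> is finite. At a maximum point of \<open>h\<close> on \<open>A\<close>, a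
  successor of value at least \<open>h s\<close> is in \<open>A\<close>, any other is smaller; as
  the value is at most the mean, all successors are in \<open>A\<close> and maximal. So everything
  reachable from this point is in \<open>A\<close>, including vertices outside the ball.\<close>

lemma high_path:
  assumes fin: "finite (verts (skel G) \<inter> ball s \<rho>)" and s: "s \<in> verts (skel G)" and \<rho>: "0 < \<rho>"
    and sub: "\<And>w. w \<in> verts (skel G) \<inter> ball s \<rho> \<Longrightarrow>
      h w \<le> (\<Sum>e\<in>out_arcs (skel G) w. norm_weight G e * h (head (skel G) e))"
  shows "\<exists>w. w \<notin> ball s \<rho> \<and> (s, w) \<in> (arc_rel G {e \<in> arcs (skel G). h s \<le> h (tail (skel G) e) \<and> h s \<le> h (head (skel G) e)})\<^sup>+"
proof (rule ccontr)
  assume neg: "\<not> ?thesis"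
  let ?E = "{e \<in> arcs (skel G). h s \<le> h (tail (skel G) e) \<and> h s \<le> h (head (skel G) e)}"
  define A where "A = {w. (s, w) \<in> (arc_rel G ?E)\<^sup>*}"
  have sA: "s \<in> A" by (simp add: A_def)
  have Ab: "A \<subseteq> verts (skel G) \<inter> ball s \<rho>"
  proof
    fix w assume "w \<in> A"
    then have w: "(s, w) \<in> (arc_rel G ?E)\<^sup>*" by (simp add: A_def)
    then show "w \<in> verts (skel G) \<inter> ball s \<rho>"
    proof (cases rule: rtranclE)
      case base then show ?thesis using s \<rho> by simp
    next
      case (step y)
      then obtain e where "e \<in> arcs (skel G)" "w = head (skel G) e" by (auto simp: arc_rel_def)
      then have "w \<in> verts (skel G)" using arc_ends(4)[OF embedding graph] by blast
      moreover have "w \<in> ball s \<rho>"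
        using neg rtrancl_into_trancl1[OF step(1,2)] by blast
      ultimately show ?thesis by simp
    qed
  qed
  have finA: "finite A" using Ab fin finite_subset by blast
  define M where "M = Max (h ` A)"
  have hM: "h w \<le> M" if "w \<in> A" for w unfolding M_def using finA that by simp
  have Mh: "h s \<le> M" by (rule hM[OF sA])
  have Ah: "h s \<le> h w" if "w \<in> A" for w
  proof -
    have "(s, w) \<in> (arc_rel G ?E)\<^sup>*" using that by (simp add: A_def)
    then show ?thesis
    proof (cases rule: rtranclE)
      case (step y) then show ?thesis by (auto simp: arc_rel_def)
    qed simp
  qed
  have next_max: "head (skel G) e \<in> A \<and> h (head (skel G) e) = M"
    if w: "w \<in> A" "h w = M" and e: "e \<in> out_arcs (skel G) w" for w e
  proof -
    let ?O = "out_arcs (skel G) w"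
    have wv: "w \<in> verts (skel G) \<inter> ball s \<rho>" using w(1) Ab by blast
    have finO: "finite ?O" using graph wv unfolding weighted_graph_def by blast
    have inA: "head (skel G) e \<in> A" if "e \<in> ?O" "h s \<le> h (head (skel G) e)" for e
    proof -
      have "e \<in> ?E" using that Ah[OF w(1)] by simp
      then have "(tail (skel G) e, head (skel G) e) \<in> arc_rel G ?E" unfolding arc_rel_def by (rule imageI)
      then have "(w, head (skel G) e) \<in> arc_rel G ?E" using that(1) by simp
      then show ?thesis using w(1) unfolding A_def mem_Collect_eq by (rule rtrancl_into_rtrancl[rotated])
    qed
    have le: "h (head (skel G) e) \<le> M" if "e \<in> ?O" for e
      using hM[OF inA[OF that]] Mh by linarith
    have pos: "0 < norm_weight G e" if "e \<in> ?O" for e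
      using norm_weight_pos[OF graph, of e] that by simp
    have "h (head (skel G) e) = M"
    proof (rule ccontr)
      assume "h (head (skel G) e) \<noteq> M"
      then have lt: "h (head (skel G) e) < M" using le[OF e] by simp
      have "M \<le> (\<Sum>e\<in>?O. norm_weight G e * h (head (skel G) e))" using sub[OF wv] w(2) by simp
      also have "\<dots> < (\<Sum>e\<in>?O. norm_weight G e * M)"
      proof (rule sum_strict_mono_ex1[OF finO])
        show "\<forall>e\<in>?O. norm_weight G e * h (head (skel G) e) \<le> norm_weight G e * M"
          by (intro ballI mult_left_mono le less_imp_le[OF pos])
        show "\<exists>e\<in>?O. norm_weight G e * h (head (skel G) e) < norm_weight G e * M"
          by (rule bexI[OF _ e]) (rule mult_strict_left_mono[OF lt pos[OF e]])
      qed
      also have "\<dots> = M" using sum_norm_weight[OF graph, of w] wv by (simp add: sum_distrib_right[symmetric])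
      finally show False by simp
    qed
    then show ?thesis using inA[OF e] Mh by simp
  qed
  have "M \<in> h ` A" unfolding M_def using finA sA by (intro Max_in) auto
  then obtain w0 where w0: "w0 \<in> A" "h w0 = M" by auto
  then have w0v: "w0 \<in> verts (skel G)" using Ab by blast
  \<comment> \<open>\<open>5 * \<eta>0\<close> beyond the ball, so that vertices within
    \<open>4 * \<eta>0\<close> of this point are outside.\<close>
  let ?y = "s + of_real (\<rho> + 5 * \<eta>0)"
  obtain v where v: "dist v ?y \<le> 4 * \<eta>0" "(w0, v) \<in> (arc_rel G (arcs (skel G)))\<^sup>*"
    using reach_everywhere[OF w0v] by blast
  from v(2) have "v \<in> A \<and> h v = M"
  proof induction
    case base show ?case using w0 by simp
  next
    case (step y z)
    then obtain e where e: "e \<in> arcs (skel G)" "y = tail (skel G) e" "z = head (skel G) e"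
      by (auto simp: arc_rel_def)
    then have "e \<in> out_arcs (skel G) y" by simp
    then show ?case using next_max step.IH e(3) by blast
  qed
  then have "dist s v < \<rho>" using Ab by auto
  moreover have "dist s ?y = \<rho> + 5 * \<eta>0"
  proof -
    have "s - ?y = - of_real (\<rho> + 5 * \<eta>0)" by (simp only: diff_diff_eq[symmetric] diff_self diff_0)
    then show ?thesis using \<rho> \<eta>0 by (simp only: dist_norm norm_minus_cancel norm_of_real)
  qed
  moreover have "dist s ?y \<le> dist s v + dist v ?y" by (rule dist_triangle)
  ultimately show False using v(1) \<eta>0 by simp
qed

text \<open>Otherwise a loop of arcs with values below \<open>h s\<close> goes around
  \<open>s\<close>, while arcs with values at least \<open>h s\<close> lead from \<open>s\<close> to
  distance \<open>40 * \<eta>\<close>. The two meet, and edges that meet share an end, whose value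
  would be both below \<open>h s\<close> and not.\<close>

lemma harnack_local:
  assumes h: "superharmonic_on G \<Omega> h" and \<eta>: "\<eta>0 \<le> \<eta>"
    and v: "v \<in> verts (skel G)" and s: "s \<in> verts (skel G)" and vs: "dist v s \<le> 4 * \<eta>"
    and \<Omega>: "ball s (40 * \<eta>) \<subseteq> \<Omega>" and fin: "finite (verts (skel G) \<inter> ball s (40 * \<eta>))"
    and sub: "\<And>w. w \<in> verts (skel G) \<inter> ball s (40 * \<eta>) \<Longrightarrow>
      h w \<le> (\<Sum>e\<in>out_arcs (skel G) w. norm_weight G e * h (head (skel G) e))"
  shows "p0 ^ 43 * h s \<le> h v"
proof (rule ccontr)
  assume "\<not> ?thesis"
  then have low: "h v < p0 ^ 43 * h s" by simp
  have "0 \<le> h v" using h v by (simp add: superharmonic_on_def)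
  then have "0 < p0 ^ 43 * h s" using low by linarith
  then have m: "0 < h s" using p0 by (simp add: zero_less_mult_iff)
  have \<eta>pos: "0 < \<eta>" using \<eta> \<eta>0 by simp
  have "0 < 40 * \<eta>" using \<eta>pos by simp
  from high_path[OF fin s this sub] obtain w where w: "w \<notin> ball s (40 * \<eta>)"
    "(s, w) \<in> (arc_rel G {e \<in> arcs (skel G). h s \<le> h (tail (skel G) e) \<and> h s \<le> h (head (skel G) e)})\<^sup>+"
    by blast
  obtain p where p: "path p" "pathstart p = s" "pathfinish p = w"
    "path_image p \<subseteq> (\<Union>e\<in>{e \<in> arcs (skel G). h s \<le> h (tail (skel G) e) \<and> h s \<le> h (head (skel G) e)}. trace G e)"
    using path_along_arcs[OF embedding _ w(2)] by blast
  have sub: "ball v (30 * \<eta>) \<subseteq> \<Omega>"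
  proof (rule order_trans[OF _ \<Omega>], rule subsetI)
    fix x assume "x \<in> ball v (30 * \<eta>)"
    then show "x \<in> ball s (40 * \<eta>)"
      using dist_triangle[of s x v] vs \<eta>pos by (simp add: dist_commute)
  qed
  have far: "30 * \<eta> \<le> dist v w"
    using w(1) dist_triangle[of s w v] vs \<eta>pos by (simp add: dist_commute)
  have sp: "s \<in> path_image p" "w \<in> path_image p"
    using pathstart_in_path_image[of p] pathfinish_in_path_image[of p] p(2,3) by simp_all
  from low_loop[OF h \<eta> v sub m low connected_path_image[OF p(1)] sp vs far]
  obtain e where e: "e \<in> low_arcs G (ball v (30 * \<eta>)) h (h s)" "trace G e \<inter> path_image p \<noteq> {}" by blast
  then obtain x where x: "x \<in> trace G e" "x \<in> path_image p" by blast
  from x(2) p(4) obtain e' where e': "e' \<in> arcs (skel G)" "h s \<le> h (tail (skel G) e')" "h s \<le> h (head (skel G) e')"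
    "x \<in> trace G e'" by blast
  have "e \<in> arcs (skel G)" "h (tail (skel G) e) < h s" "h (head (skel G) e) < h s"
    using e(1) by (simp_all add: low_arcs_def)
  moreover have "{tail (skel G) e, head (skel G) e} \<inter> {tail (skel G) e', head (skel G) e'} \<noteq> {}"
    by (rule traces_share_end[OF embedding graph \<open>e \<in> arcs (skel G)\<close> e'(1) x(1) e'(4)])
  ultimately show False using e'(2,3) by auto
qed

end

section \<open>Uniformity in the scale\<close>

lemma affine_image_iff:
  assumes "0 < \<eta>"
  shows "w \<in> affine_image z \<eta> S \<longleftrightarrow> (w - z) / of_real \<eta> \<in> S"
proof
  assume "w \<in> affine_image z \<eta> S"
  then show "(w - z) / of_real \<eta> \<in> S" using assms by (auto simp: affine_image_def)
next
  assume "(w - z) / of_real \<eta> \<in> S"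
  moreover have "w = z + of_real \<eta> * ((w - z) / of_real \<eta>)" using assms by simp
  ultimately show "w \<in> affine_image z \<eta> S" unfolding affine_image_def by blast
qed

lemma affine_image_ball:
  assumes "0 < \<eta>"
  shows "affine_image z \<eta> (ball a r) = ball (z + of_real \<eta> * a) (\<eta> * r)"
proof (intro Set.set_eqI)
  fix w
  have "a - (w - z) / of_real \<eta> = (z + of_real \<eta> * a - w) / of_real \<eta>"
    using assms by (simp add: field_simps)
  then have *: "norm (a - (w - z) / of_real \<eta>) = norm (z + of_real \<eta> * a - w) / \<eta>"
    using assms by (simp only: norm_divide norm_of_real abs_of_pos)
  show "w \<in> affine_image z \<eta> (ball a r) \<longleftrightarrow> w \<in> ball (z + of_real \<eta> * a) (\<eta> * r)"
    unfolding affine_image_iff[OF assms] mem_ball dist_norm * using assms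
    by (simp add: pos_divide_less_eq mult.commute)
qed

lemma affine_image_cbox:
  assumes "0 < \<eta>"
  shows "w \<in> affine_image z \<eta> (cbox 0 (Complex a b)) \<longleftrightarrow>
    0 \<le> Re (w - z) \<and> Re (w - z) \<le> \<eta> * a \<and> 0 \<le> Im (w - z) \<and> Im (w - z) \<le> \<eta> * b"
  using assms by (simp add: affine_image_iff in_cbox_complex_iff field_simps)

text \<open>Horizontal and vertical crossings, each in both orientations, are the four directions of
  \<open>dirs\<close>; the rectangle is translated so that its starting ball is centred at
  \<open>z\<close>. At mesh \<open>\<delta>\<close> all scales from
  \<open>\<delta> / \<delta>0\<close> on are allowed, hence
  \<open>c = 1 / \<delta>0\<close>.\<close>

lemma uniform_crossing_planar_walk:
  assumes "uniform_crossing G"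
    and graph: "\<And>\<delta>. \<delta> > 0 \<Longrightarrow> weighted_graph (G \<delta>)"
    and embedding: "\<And>\<delta>. \<delta> > 0 \<Longrightarrow> good_embedding (G \<delta>)"
  shows "\<exists>p c. 0 < p \<and> 0 < c \<and> (\<forall>\<delta>>0. planar_walk (G \<delta>) p (c * \<delta>))"
proof -
  let ?H = "cbox 0 (Complex 3 1)" and ?V = "cbox 0 (Complex 1 3)"
  let ?B1 = "ball (Complex (1/2) (1/2)) (1/4)" and ?B2 = "ball (Complex (5/2) (1/2)) (1/4)"
    and ?B3 = "ball (Complex (1/2) (5/2)) (1/4)"
  obtain p0 \<delta>0 where p0: "0 < p0" "0 < \<delta>0"
    and cr: "crossing G p0 \<delta>0 ?H ?B1 ?B2" "crossing G p0 \<delta>0 ?H ?B2 ?B1"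
      "crossing G p0 \<delta>0 ?V ?B1 ?B3" "crossing G p0 \<delta>0 ?V ?B3 ?B1"
    using assms(1) unfolding uniform_crossing_def Let_def by blast
  have "planar_walk (G \<delta>) p0 (1 / \<delta>0 * \<delta>)" if \<delta>: "0 < \<delta>" for \<delta>
  proof
    show "weighted_graph (G \<delta>)" "good_embedding (G \<delta>)" using graph embedding \<delta> by auto
    show "0 < p0" by (rule p0)
    show "0 < 1 / \<delta>0 * \<delta>" using p0 \<delta> by simp
    fix z \<eta> d u
    assume \<eta>: "1 / \<delta>0 * \<delta> \<le> \<eta>" and d: "d \<in> dirs" and u: "u \<in> verts (skel (G \<delta>)) \<inter> ball z (\<eta> / 4)"
    have "0 < 1 / \<delta>0 * \<delta>" using p0 \<delta> by simp
    then have \<eta>pos: "0 < \<eta>" using \<eta> by linarith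
    have scale: "\<delta> \<le> \<eta> * \<delta>0" using \<eta> p0 by (simp add: field_simps)
    have go: "p0 < measure (walk_law (G \<delta>) u) {\<xi> \<in> space (walk_law (G \<delta>) u).
        hits_before_exit (G \<delta>) u \<xi> (ball (z + of_real (2 * \<eta>) * d) (\<eta> / 4)) (strip z \<eta> d 1)}"
      if c: "crossing G p0 \<delta>0 R (ball a (1/4)) (ball b (1/4))" and b: "b = a + 2 * d"
        and R: "affine_image (z - of_real \<eta> * a) \<eta> R = strip z \<eta> d 1" for R a b
    proof -
      let ?z = "z - of_real \<eta> * a"
      have 1: "affine_image ?z \<eta> (ball a (1/4)) = ball z (\<eta> / 4)"
        by (simp add: affine_image_ball[OF \<eta>pos])
      have 2: "affine_image ?z \<eta> (ball b (1/4)) = ball (z + of_real (2 * \<eta>) * d) (\<eta> / 4)"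
        by (simp add: affine_image_ball[OF \<eta>pos] b algebra_simps)
      show ?thesis
        using c \<eta>pos \<delta> scale u unfolding crossing_def 1[symmetric] 2[symmetric] R[symmetric] by blast
    qed
    have S: "affine_image (z - of_real \<eta> * a) \<eta> (cbox 0 (Complex x y)) = strip z \<eta> d 1"
      if "\<And>w. 0 \<le> Re (w - z) + \<eta> * Re a \<and> Re (w - z) + \<eta> * Re a \<le> \<eta> * x \<and> 0 \<le> Im (w - z) + \<eta> * Im a \<and> Im (w - z) + \<eta> * Im a \<le> \<eta> * y
        \<longleftrightarrow> w \<in> strip z \<eta> d 1" for a x y
      using that by (intro Set.set_eqI) (simp add: affine_image_cbox[OF \<eta>pos] algebra_simps)
    consider "d = 1" | "d = -1" | "d = \<i>" | "d = -\<i>" using d by (auto simp: dirs_def)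
    then show "p0 < measure (walk_law (G \<delta>) u) {\<xi> \<in> space (walk_law (G \<delta>) u).
        hits_before_exit (G \<delta>) u \<xi> (ball (z + of_real (2 * \<eta>) * d) (\<eta> / 4)) (strip z \<eta> d 1)}"
    proof cases
      case 1
      show ?thesis by (rule go[OF cr(1)], simp add: complex_eq_iff 1, rule S) (auto simp: strip_def 1)
    next
      case 2
      show ?thesis by (rule go[OF cr(2)], simp add: complex_eq_iff 2, rule S) (auto simp: strip_def 2)
    next
      case 3
      show ?thesis by (rule go[OF cr(3)], simp add: complex_eq_iff 3, rule S) (auto simp: strip_def 3)
    next
      case 4
      show ?thesis by (rule go[OF cr(4)], simp add: complex_eq_iff 4, rule S) (auto simp: strip_def 4)
    qed
  qed
  then show ?thesis using p0 by (intro exI[of _ p0] exI[of _ "1 / \<delta>0"]) simp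
qed

lemma finite_verts_bounded:
  assumes "bounded_density G" "0 < \<delta>" "bounded S"
  shows "finite (verts (skel (G \<delta>)) \<inter> S)"
proof -
  let ?Q = "\<lambda>z. cbox z (z + Complex \<delta> \<delta>)"
  have fin: "finite (verts (skel (G \<delta>)) \<inter> ?Q z)" for z
    using assms(1,2) unfolding bounded_density_def by blast
  have comp: "compact (closure S)" using assms(3) by (simp only: compact_closure)
  have cov: "closure S \<subseteq> (\<Union>z\<in>UNIV. box z (z + Complex \<delta> \<delta>))"
  proof
    fix x :: complex
    have "x \<in> box (x - Complex (\<delta>/2) (\<delta>/2)) (x - Complex (\<delta>/2) (\<delta>/2) + Complex \<delta> \<delta>)"
      using assms(2) by (simp add: in_box_complex_iff)
    then show "x \<in> (\<Union>z\<in>UNIV. box z (z + Complex \<delta> \<delta>))" by blast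
  qed
  obtain Z where Z: "finite Z" "closure S \<subseteq> (\<Union>z\<in>Z. box z (z + Complex \<delta> \<delta>))"
    using compactE_image[OF comp open_box cov] by metis
  have "verts (skel (G \<delta>)) \<inter> S \<subseteq> (\<Union>z\<in>Z. verts (skel (G \<delta>)) \<inter> ?Q z)"
  proof
    fix x assume x: "x \<in> verts (skel (G \<delta>)) \<inter> S"
    have "x \<in> closure S" by (rule subsetD[OF closure_subset IntD2[OF x]])
    from subsetD[OF Z(2) this] obtain z where z: "z \<in> Z" "x \<in> box z (z + Complex \<delta> \<delta>)" by (rule UN_E)
    have "x \<in> ?Q z" by (rule subsetD[OF box_subset_cbox z(2)])
    then show "x \<in> (\<Union>z\<in>Z. verts (skel (G \<delta>)) \<inter> ?Q z)"
      by (intro UN_I[OF z(1)] IntI IntD1[OF x])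
  qed
  then show ?thesis by (rule finite_subset) (intro finite_UN_I Z(1) fin)
qed

section \<open>Propagation of small values, uniformly in the mesh\<close>

locale walk_family =
  fixes G :: "real \<Rightarrow> 'e plane_graph" and p0 c :: real
  assumes walk: "\<And>\<delta>. 0 < \<delta> \<Longrightarrow> planar_walk (G \<delta>) p0 (c * \<delta>)"
    and p0: "0 < p0" and c: "0 < c"
    and finite_verts: "\<And>\<delta> S. 0 < \<delta> \<Longrightarrow> bounded S \<Longrightarrow> finite (verts (skel (G \<delta>)) \<inter> S)"
begin

text \<open>One number \<open>e\<close> bounds the mesh, the radius around \<open>x\<close> and the
  ratio of the values at once. It is chosen before the mesh, and having a single number makes the
  relation easy to compose.\<close>

definition spreads_at :: "complex set \<Rightarrow> complex \<Rightarrow> complex \<Rightarrow> real \<Rightarrow> real \<Rightarrow> bool" where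
  "spreads_at \<Omega> x y r e \<longleftrightarrow> (\<forall>\<delta> h m s. 0 < \<delta> \<longrightarrow> \<delta> < e \<longrightarrow> superharmonic_on (G \<delta>) \<Omega> h \<longrightarrow> 0 < m \<longrightarrow>
     s \<in> verts (skel (G \<delta>)) \<inter> ball x e \<longrightarrow> h s < e * m \<longrightarrow> (\<exists>v\<in>verts (skel (G \<delta>)) \<inter> ball y r. h v < m))"

definition spreads :: "complex set \<Rightarrow> complex \<Rightarrow> complex \<Rightarrow> bool" where
  "spreads \<Omega> x y \<longleftrightarrow> (\<forall>r>0. \<exists>e>0. spreads_at \<Omega> x y r e)"

lemma spreads_atD:
  assumes "spreads_at \<Omega> x y r e" "0 < \<delta>" "\<delta> < e" "superharmonic_on (G \<delta>) \<Omega> h" "0 < m"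
    "s \<in> verts (skel (G \<delta>)) \<inter> ball x e" "h s < e * m"
  obtains v where "v \<in> verts (skel (G \<delta>))" "v \<in> ball y r" "h v < m"
  using assms unfolding spreads_at_def by blast

lemma spreadsD:
  assumes "spreads \<Omega> x y" "0 < r"
  obtains e where "0 < e" "spreads_at \<Omega> x y r e"
  using assms unfolding spreads_def by blast

lemma spreads_trans:
  assumes xy: "spreads \<Omega> x y" and yz: "spreads \<Omega> y z"
  shows "spreads \<Omega> x z"
  unfolding spreads_def
proof (intro allI impI)
  fix r :: real assume r: "0 < r"
  obtain e where e: "0 < e" and ez: "spreads_at \<Omega> y z r e"
    by (rule spreadsD[OF yz r])
  obtain e' where e': "0 < e'" and ey: "spreads_at \<Omega> x y e e'"
    by (rule spreadsD[OF xy e])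
  \<comment> \<open>Mesh and radius have to suit both steps; the ratios multiply.\<close>
  define e'' where "e'' = min (min e e') (e * e')"
  have e'': "0 < e''" "e'' \<le> e" "e'' \<le> e'" "e'' \<le> e' * e" using e e' by (auto simp: e''_def mult.commute)
  have "spreads_at \<Omega> x z r e''"
    unfolding spreads_at_def
  proof (intro allI impI)
    fix \<delta> h m s
    assume A: "0 < \<delta>" "\<delta> < e''" "superharmonic_on (G \<delta>) \<Omega> h" "0 < m" "s \<in> verts (skel (G \<delta>)) \<inter> ball x e''" "h s < e'' * m"
    have 1: "0 < e * m" using e A(4) by simp
    have 2: "s \<in> verts (skel (G \<delta>)) \<inter> ball x e'" using A(5) e''(3) by simp
    have "e'' * m \<le> e' * e * m" using e''(4) A(4) by (intro mult_right_mono) auto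
    then have 3: "h s < e' * (e * m)" using A(6) by (simp add: mult.assoc)
    obtain v where v: "v \<in> verts (skel (G \<delta>))" "v \<in> ball y e" "h v < e * m"
      by (rule spreads_atD[OF ey A(1) less_le_trans[OF A(2) e''(3)] A(3) 1 2 3])
    obtain w where "w \<in> verts (skel (G \<delta>))" "w \<in> ball z r" "h w < m"
      by (rule spreads_atD[OF ez A(1) less_le_trans[OF A(2) e''(2)] A(3,4) IntI[OF v(1,2)] v(3)])
    then show "\<exists>v\<in>verts (skel (G \<delta>)) \<inter> ball z r. h v < m" by (intro bexI[of _ w]) simp_all
  qed
  then show "\<exists>e>0. spreads_at \<Omega> x z r e" using e''(1) by (intro exI[of _ e'']) simp
qed

text \<open>At the macroscopic scale \<open>\<eta>\<close> the number of crossings from near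
  \<open>y\<close> to near \<open>z\<close> is at most \<open>N\<close> for every mesh with
  \<open>c * \<delta> \<le> \<eta>\<close>; so the loss \<open>p0 ^ N\<close> is uniform.\<close>

lemma spreads_local:
  assumes \<Omega>: "ball x \<rho> \<subseteq> \<Omega>" and yz: "y \<in> ball x (\<rho> / 16)" "z \<in> ball x (\<rho> / 16)"
  shows "spreads \<Omega> y z"
  unfolding spreads_def
proof (intro allI impI)
  fix r :: real assume r: "0 < r"
  have \<rho>: "0 < \<rho>" using yz(1) le_less_trans[OF zero_le_dist[of x y], of "\<rho> / 16"] by simp
  define \<eta> where "\<eta> = min r \<rho> / 40"
  have \<eta>: "0 < \<eta>" "\<eta> \<le> r / 40" "\<eta> \<le> \<rho> / 40" using r \<rho> by (auto simp: \<eta>_def)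
  obtain N :: nat where N: "\<rho> / \<eta> \<le> real N" using real_arch_simple by blast
  define e where "e = min (min (\<eta> / c) (\<rho> / 16)) (p0 ^ N)"
  have e: "0 < e" "e \<le> \<eta> / c" "e \<le> \<rho> / 16" "e \<le> p0 ^ N"
  proof -
    show "0 < e" using \<eta>(1) c \<rho> p0 by (simp add: e_def)
    show "e \<le> \<eta> / c" "e \<le> \<rho> / 16" "e \<le> p0 ^ N"
      unfolding e_def by (rule min.coboundedI1[OF min.cobounded1], rule min.coboundedI1[OF min.cobounded2], rule min.cobounded2)
  qed
  have "spreads_at \<Omega> y z r e"
    unfolding spreads_at_def
  proof (intro allI impI)
    fix \<delta> h m s
    assume A: "0 < \<delta>" "\<delta> < e" "superharmonic_on (G \<delta>) \<Omega> h" "0 < m" "s \<in> verts (skel (G \<delta>)) \<inter> ball y e" "h s < e * m"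
    interpret planar_walk "G \<delta>" p0 "c * \<delta>" by (rule walk[OF A(1)])
    have "\<delta> < \<eta> / c" using A(2) e(2) by simp
    then have s\<eta>: "c * \<delta> \<le> \<eta>" using c by (simp add: field_simps)
    have sy: "dist s y < \<rho> / 16" using A(5) e(3) by (simp add: dist_commute)
    have xy: "dist x y < \<rho> / 16" and xz: "dist x z < \<rho> / 16" using yz by simp_all
    have dsz: "dist s z < 3 * \<rho> / 16"
      using dist_triangle[of s z y] dist_triangle3[of y z x] sy xy xz by linarith
    have dsx: "dist x s < 2 * \<rho> / 16"
      using dist_triangle2[of x s y] sy xy by linarith
    \<comment> \<open>The distance from \<open>x\<close> to \<open>s\<close> is below
      \<open>2 * \<rho> / 16\<close>, the radius below \<open>6 * \<rho> / 16 + \<rho> / 10\<close>;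
      together less than \<open>\<rho>\<close>.\<close>
    have sub: "ball s (2 * dist s z + 4 * \<eta>) \<subseteq> \<Omega>"
    proof (rule order_trans[OF _ \<Omega>], rule subsetI)
      fix t assume "t \<in> ball s (2 * dist s z + 4 * \<eta>)"
      then have "dist s t < 2 * dist s z + 4 * \<eta>" by simp
      then show "t \<in> ball x \<rho>" using dist_triangle[of x t s] dsx dsz \<eta>(3) \<rho> by simp
    qed
    have "dist s z / \<eta> \<le> \<rho> / \<eta>" using dsz \<rho> \<eta>(1) by (intro divide_right_mono) linarith+
    then have N': "dist s z / \<eta> \<le> real N" using N by linarith
    have "e * m \<le> p0 ^ N * m" using e(4) A(4) by (intro mult_right_mono) auto
    then have low: "h s < p0 ^ N * m" using A(6) by linarith
    have sv: "s \<in> verts (skel (G \<delta>))" using A(5) by simp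
    obtain v where v: "v \<in> verts (skel (G \<delta>))" "dist v z \<le> 4 * \<eta>" "h v < m"
      using low_reach[OF A(3) s\<eta> sv sub N' A(4) low] by (elim bexE conjE)
    have "v \<in> ball z r" using v(2) \<eta>(2) r by (simp add: dist_commute)
    then show "\<exists>v\<in>verts (skel (G \<delta>)) \<inter> ball z r. h v < m" using v(1,3) by (intro bexI[of _ v]) simp_all
  qed
  then show "\<exists>e>0. spreads_at \<Omega> y z r e" using e(1) by (intro exI[of _ e]) simp
qed

text \<open>Local spreading works in both directions, so the symmetrised relation has open classes
  in \<Omega>, and connectedness leaves a single class.\<close>

lemma spreads_connected:
  assumes \<Omega>: "open \<Omega>" "connected \<Omega>" and xy: "x \<in> \<Omega>" "y \<in> \<Omega>"
  shows "spreads \<Omega> x y"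
proof -
  have "spreads \<Omega> x y \<and> spreads \<Omega> y x"
  proof (rule connected_equivalence_relation[OF \<Omega>(2) xy, of "\<lambda>x y. spreads \<Omega> x y \<and> spreads \<Omega> y x"])
    fix a assume a: "a \<in> \<Omega>"
    obtain \<rho> where \<rho>: "0 < \<rho>" "ball a \<rho> \<subseteq> \<Omega>" using \<Omega>(1) a open_contains_ball by blast
    have aa: "a \<in> ball a (\<rho> / 16)" using \<rho>(1) by simp
    show "\<exists>T. openin (top_of_set \<Omega>) T \<and> a \<in> T \<and> (\<forall>x\<in>T. spreads \<Omega> a x \<and> spreads \<Omega> x a)"
    proof (intro exI[of _ "ball a (\<rho> / 16)"] conjI ballI)
      have "ball a (\<rho> / 16) \<subseteq> \<Omega>" using subset_ball[of "\<rho> / 16" \<rho> a] \<rho> by (simp add: order_trans)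
      then show "openin (top_of_set \<Omega>) (ball a (\<rho> / 16))" by (simp add: openin_open_eq[OF \<Omega>(1)])
      show "a \<in> ball a (\<rho> / 16)" by (rule aa)
      fix z assume z: "z \<in> ball a (\<rho> / 16)"
      show "spreads \<Omega> a z" by (rule spreads_local[OF \<rho>(2) aa z])
      show "spreads \<Omega> z a" by (rule spreads_local[OF \<rho>(2) z aa])
    qed
  qed (simp, meson spreads_trans)
  then show ?thesis by simp
qed

end

text \<open>A bound that is uniform near each point and monotone in its constant holds with the
  least of finitely many constants.\<close>

lemma compact_uniform:
  fixes S :: "'a::topological_space set" and Q :: "real \<Rightarrow> 'a \<Rightarrow> bool"
  assumes S: "compact S"
    and loc: "\<And>p. p \<in> S \<Longrightarrow> \<exists>e>0. \<exists>U. open U \<and> p \<in> U \<and> (\<forall>q\<in>S \<inter> U. Q e q)"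
    and mono: "\<And>e e' q. 0 < e' \<Longrightarrow> e' \<le> e \<Longrightarrow> Q e q \<Longrightarrow> Q e' q"
  shows "\<exists>e>0. \<forall>q\<in>S. Q e q"
proof -
  obtain e U where eU: "\<And>p. p \<in> S \<Longrightarrow> 0 < e p \<and> open (U p) \<and> p \<in> U p \<and> (\<forall>q\<in>S \<inter> U p. Q (e p) q)"
    using loc by metis
  have cov: "S \<subseteq> (\<Union>p\<in>S. U p)" using eU by blast
  have op: "open (U p)" if "p \<in> S" for p using eU[OF that] by simp
  obtain F where F: "F \<subseteq> S" "finite F" "S \<subseteq> (\<Union>p\<in>F. U p)"
    by (rule compactE_image[OF S op cov])
  define e0 where "e0 = Min (insert 1 (e ` F))"
  have "0 < e0" unfolding e0_def using F(1,2) eU by (subst Min_gr_iff) auto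
  moreover have "Q e0 q" if q: "q \<in> S" for q
  proof -
    from subsetD[OF F(3) q] obtain p where p: "p \<in> F" "q \<in> U p" by (rule UN_E)
    have "Q (e p) q" using eU[OF subsetD[OF F(1) p(1)]] p(2) q by simp
    moreover have "e0 \<le> e p" unfolding e0_def using F(2) p(1) by simp
    ultimately show ?thesis using mono \<open>0 < e0\<close> by blast
  qed
  ultimately show ?thesis by blast
qed

section \<open>Harnack and escape estimates on compact sets\<close>

context walk_family
begin

definition subharmonic_on :: "real \<Rightarrow> complex set \<Rightarrow> (complex \<Rightarrow> real) \<Rightarrow> bool" where
  "subharmonic_on \<delta> \<Omega> h \<longleftrightarrow> (\<forall>w\<in>verts (skel (G \<delta>)) \<inter> \<Omega>.
     h w \<le> (\<Sum>e\<in>out_arcs (skel (G \<delta>)) w. norm_weight (G \<delta>) e * h (head (skel (G \<delta>)) e)))"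

text \<open>If \<open>h s\<close> were much smaller than \<open>h s'\<close>, smallness would spread
  from \<open>s\<close> to a vertex close to \<open>s'\<close>, where \<open>harnack_local\<close>
  forbids it. The constant of spreading depends on both points, so compactness is applied to
  pairs.\<close>

lemma harnack_compact:
  assumes \<Omega>: "open \<Omega>" "connected \<Omega>" and K: "compact K" "K \<subseteq> \<Omega>"
  shows "\<exists>e>0. \<forall>\<delta> h s s'. 0 < \<delta> \<longrightarrow> \<delta> < e \<longrightarrow> superharmonic_on (G \<delta>) \<Omega> h \<longrightarrow> subharmonic_on \<delta> \<Omega> h \<longrightarrow>
    s \<in> verts (skel (G \<delta>)) \<inter> K \<longrightarrow> s' \<in> verts (skel (G \<delta>)) \<inter> K \<longrightarrow> e * h s' \<le> h s"
proof -
  define Q where "Q e q \<longleftrightarrow> (\<forall>\<delta> h. 0 < \<delta> \<longrightarrow> \<delta> < e \<longrightarrow> superharmonic_on (G \<delta>) \<Omega> h \<longrightarrow> subharmonic_on \<delta> \<Omega> h \<longrightarrow>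
    fst q \<in> verts (skel (G \<delta>)) \<longrightarrow> snd q \<in> verts (skel (G \<delta>)) \<longrightarrow> e * h (snd q) \<le> h (fst q))" for e :: real and q
  have "\<exists>e>0. \<forall>q\<in>K \<times> K. Q e q"
  proof (rule compact_uniform[OF compact_Times[OF K(1) K(1)]])
    fix e e' q assume e: "0 < e'" "e' \<le> e" "Q e q"
    show "Q e' q"
      unfolding Q_def
    proof (intro allI impI)
      fix \<delta> h assume A: "0 < \<delta>" "\<delta> < e'" "superharmonic_on (G \<delta>) \<Omega> h" "subharmonic_on \<delta> \<Omega> h"
        "fst q \<in> verts (skel (G \<delta>))" "snd q \<in> verts (skel (G \<delta>))"
      have "\<delta> < e" using A(2) e(2) by simp
      then have "e * h (snd q) \<le> h (fst q)" using e(3) A(1,3-6) unfolding Q_def by simp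
      moreover have "0 \<le> h (snd q)" using A(3,6) unfolding superharmonic_on_def by simp
      then have "e' * h (snd q) \<le> e * h (snd q)" using e(2) by (intro mult_right_mono)
      ultimately show "e' * h (snd q) \<le> h (fst q)" by simp
    qed
  next
    fix q assume q: "q \<in> K \<times> K"
    obtain x y where xy: "q = (x, y)" "x \<in> \<Omega>" "y \<in> \<Omega>" using q K(2) by auto
    obtain \<rho> where \<rho>: "0 < \<rho>" "ball y \<rho> \<subseteq> \<Omega>" using \<Omega>(1) xy(3) open_contains_ball by blast
    define \<eta> where "\<eta> = \<rho> / 100"
    have \<eta>: "0 < \<eta>" using \<rho> by (simp add: \<eta>_def)
    obtain k where k: "0 < k" and kk: "spreads_at \<Omega> x y \<eta> k"
      by (rule spreadsD[OF spreads_connected[OF \<Omega> xy(2,3)] \<eta>])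
    \<comment> \<open>\<open>k\<close> is the loss in spreading from \<open>x\<close> to
      \<open>y\<close>, \<open>p0 ^ 43\<close> the loss in \<open>harnack_local\<close>;
      \<open>\<eta> / c\<close> bounds the mesh so that scale \<open>\<eta>\<close> is
      allowed.\<close>
    define e where "e = min (min k (\<eta> / c)) (k * p0 ^ 43)"
    have e: "0 < e" "e \<le> k" "e \<le> \<eta> / c" "e \<le> k * p0 ^ 43" using k \<eta> c p0 by (auto simp: e_def)
    have "Q e t" if t: "t \<in> ball x k \<times> ball y \<eta>" for t
      unfolding Q_def
    proof (intro allI impI)
      fix \<delta> h assume A: "0 < \<delta>" "\<delta> < e" "superharmonic_on (G \<delta>) \<Omega> h" "subharmonic_on \<delta> \<Omega> h"
        "fst t \<in> verts (skel (G \<delta>))" "snd t \<in> verts (skel (G \<delta>))"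
      interpret planar_walk "G \<delta>" p0 "c * \<delta>" by (rule walk[OF A(1)])
      let ?s = "fst t" and ?s' = "snd t"
      have ts: "?s \<in> ball x k" "?s' \<in> ball y \<eta>" using t by (auto simp: mem_Times_iff)
      have "\<delta> < \<eta> / c" using A(2) e(3) by simp
      then have s\<eta>: "c * \<delta> \<le> \<eta>" using c by (simp add: field_simps)
      have h0: "0 \<le> h ?s" "0 \<le> h ?s'" using A(3,5,6) unfolding superharmonic_on_def by simp_all
      show "e * h ?s' \<le> h ?s"
      proof (rule ccontr)
        assume "\<not> ?thesis"
        then have lt: "h ?s < e * h ?s'" by simp
        have "h ?s' \<noteq> 0"
        proof
          assume "h ?s' = 0"
          with lt have "h ?s < 0" by simp
          with h0(1) show False by simp
        qed
        with h0(2) have "0 < h ?s'" by simp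
        then have m: "0 < p0 ^ 43 * h ?s'" using p0 by simp
        have "e * h ?s' \<le> k * p0 ^ 43 * h ?s'" using e(4) h0 by (intro mult_right_mono)
        then have low: "h ?s < k * (p0 ^ 43 * h ?s')" using lt by (simp add: mult.assoc)
        have sx: "?s \<in> verts (skel (G \<delta>)) \<inter> ball x k" using A(5) ts(1) by simp
        obtain v where v: "v \<in> verts (skel (G \<delta>))" "v \<in> ball y \<eta>" "h v < p0 ^ 43 * h ?s'"
          by (rule spreads_atD[OF kk A(1) less_le_trans[OF A(2) e(2)] A(3) m sx low])
        have vs: "dist v ?s' \<le> 4 * \<eta>"
          using dist_triangle3[of v ?s' y] v(2) ts(2) \<eta> by simp
        have sub: "ball ?s' (40 * \<eta>) \<subseteq> \<Omega>"
        proof (rule order_trans[OF _ \<rho>(2)], rule subsetI)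
          fix w assume "w \<in> ball ?s' (40 * \<eta>)"
          then show "w \<in> ball y \<rho>" using dist_triangle[of y w ?s'] ts(2) \<eta> by (simp add: \<eta>_def)
        qed
        have "p0 ^ 43 * h ?s' \<le> h v"
        proof (rule harnack_local[OF A(3) s\<eta> v(1) A(6) vs sub])
          show "finite (verts (skel (G \<delta>)) \<inter> ball ?s' (40 * \<eta>))" by (rule finite_verts[OF A(1) bounded_ball])
          fix w assume "w \<in> verts (skel (G \<delta>)) \<inter> ball ?s' (40 * \<eta>)"
          then have "w \<in> verts (skel (G \<delta>)) \<inter> \<Omega>" using sub by blast
          then show "h w \<le> (\<Sum>e\<in>out_arcs (skel (G \<delta>)) w. norm_weight (G \<delta>) e * h (head (skel (G \<delta>)) e))"
            using A(4) unfolding subharmonic_on_def by blast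
        qed
        then show False using v(3) by simp
      qed
    qed
    then have "\<forall>t\<in>(K \<times> K) \<inter> (ball x k \<times> ball y \<eta>). Q e t" by blast
    moreover have "q \<in> ball x k \<times> ball y \<eta>" using k \<eta> by (simp add: xy(1))
    moreover have "open (ball x k \<times> ball y \<eta>)" by (intro open_Times open_ball)
    ultimately show "\<exists>e>0. \<exists>U. open U \<and> q \<in> U \<and> (\<forall>t\<in>(K \<times> K) \<inter> U. Q e t)"
      using e(1) by (intro exI[of _ e] exI[of _ "ball x k \<times> ball y \<eta>"] conjI)
  qed
  then obtain e where e: "0 < e" "\<forall>q\<in>K \<times> K. Q e q" by (elim exE conjE)
  show ?thesis
  proof (intro exI[of _ e] conjI allI impI)
    fix \<delta> h s s' assume A: "0 < \<delta>" "\<delta> < e" "superharmonic_on (G \<delta>) \<Omega> h" "subharmonic_on \<delta> \<Omega> h"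
      "s \<in> verts (skel (G \<delta>)) \<inter> K" "s' \<in> verts (skel (G \<delta>)) \<inter> K"
    have "Q e (s, s')" by (rule bspec[OF e(2)]) (use A(5,6) in simp)
    from this[unfolded Q_def fst_conv snd_conv, rule_format, OF A(1-4) IntD1[OF A(5)] IntD1[OF A(6)]]
    show "e * h s' \<le> h s" .
  qed (rule e(1))
qed

text \<open>A very small value at \<open>s\<close> would spread to a value below 1 in the ball
  around \<open>y\<close>. For hitting probabilities this bounds below the chance of reaching the
  ball before leaving \<Omega>.\<close>

lemma escape_compact:
  assumes \<Omega>: "open \<Omega>" "connected \<Omega>" and K: "compact K" "K \<subseteq> \<Omega>" and y: "y \<in> \<Omega>" and r: "0 < r"
  shows "\<exists>e>0. \<forall>\<delta> h s. 0 < \<delta> \<longrightarrow> \<delta> < e \<longrightarrow> superharmonic_on (G \<delta>) \<Omega> h \<longrightarrow>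
    (\<forall>v\<in>verts (skel (G \<delta>)) \<inter> ball y r. 1 \<le> h v) \<longrightarrow> s \<in> verts (skel (G \<delta>)) \<inter> K \<longrightarrow> e \<le> h s"
proof -
  define Q where "Q e s \<longleftrightarrow> (\<forall>\<delta> h. 0 < \<delta> \<longrightarrow> \<delta> < e \<longrightarrow> superharmonic_on (G \<delta>) \<Omega> h \<longrightarrow>
    (\<forall>v\<in>verts (skel (G \<delta>)) \<inter> ball y r. 1 \<le> h v) \<longrightarrow> s \<in> verts (skel (G \<delta>)) \<longrightarrow> e \<le> h s)" for e :: real and s
  have "\<exists>e>0. \<forall>q\<in>K. Q e q"
  proof (rule compact_uniform[OF K(1)])
    fix e e' q assume e: "0 < e'" "e' \<le> e" "Q e q"
    show "Q e' q"
      unfolding Q_def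
    proof (intro allI impI)
      fix \<delta> h assume A: "0 < \<delta>" "\<delta> < e'" "superharmonic_on (G \<delta>) \<Omega> h"
        "\<forall>v\<in>verts (skel (G \<delta>)) \<inter> ball y r. 1 \<le> h v" "q \<in> verts (skel (G \<delta>))"
      have "\<delta> < e" using A(2) e(2) by simp
      then have "e \<le> h q" using e(3) A(1,3-5) unfolding Q_def by blast
      then show "e' \<le> h q" using e(2) by simp
    qed
  next
    fix x assume x: "x \<in> K"
    obtain k where k: "0 < k" and kk: "spreads_at \<Omega> x y r k"
      by (rule spreadsD[OF spreads_connected[OF \<Omega> subsetD[OF K(2) x] y] r])
    have "Q k s" if s: "s \<in> ball x k" for s
      unfolding Q_def
    proof (intro allI impI)
      fix \<delta> h assume A: "0 < \<delta>" "\<delta> < k" "superharmonic_on (G \<delta>) \<Omega> h"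
        "\<forall>v\<in>verts (skel (G \<delta>)) \<inter> ball y r. 1 \<le> h v" "s \<in> verts (skel (G \<delta>))"
      show "k \<le> h s"
      proof (rule ccontr)
        assume "\<not> k \<le> h s"
        then have low: "h s < k * 1" by simp
        have one: "(0::real) < 1" by simp
        obtain v where "v \<in> verts (skel (G \<delta>))" "v \<in> ball y r" "h v < 1"
          by (rule spreads_atD[OF kk A(1-3) one IntI[OF A(5) s] low])
        then show False using A(4) by force
      qed
    qed
    then have "\<forall>t\<in>K \<inter> ball x k. Q k t" by blast
    moreover have "x \<in> ball x k" using k by simp
    ultimately show "\<exists>e>0. \<exists>U. open U \<and> x \<in> U \<and> (\<forall>t\<in>K \<inter> U. Q e t)"
      using k open_ball by (intro exI[of _ k] exI[of _ "ball x k"] conjI)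
  qed
  then obtain e where e: "0 < e" "\<forall>q\<in>K. Q e q" by (elim exE conjE)
  show ?thesis
  proof (intro exI[of _ e] conjI allI impI)
    fix \<delta> h s assume A: "0 < \<delta>" "\<delta> < e" "superharmonic_on (G \<delta>) \<Omega> h"
      "\<forall>v\<in>verts (skel (G \<delta>)) \<inter> ball y r. 1 \<le> h v" "s \<in> verts (skel (G \<delta>)) \<inter> K"
    have "Q e s" by (rule bspec[OF e(2) IntD2[OF A(5)]])
    from this[unfolded Q_def, rule_format, OF A(1-3) _ IntD1[OF A(5)]] bspec[OF A(4)]
    show "e \<le> h s" .
  qed (rule e(1))
qed

end

section \<open>Nested discs around the common domain\<close>

lemma winding_number_zero_Int:
  assumes "simply_connected D1" "simply_connected D2"
    and "path p" "path_image p \<subseteq> D1 \<inter> D2" "pathfinish p = pathstart p" "z \<notin> D1 \<inter> D2"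
  shows "winding_number p z = 0"
proof (cases "z \<in> D1")
  case True
  with assms(6) have "z \<notin> D2" by blast
  with assms(2-5) show ?thesis by (intro simply_connected_imp_winding_number_zero[of D2]) auto
next
  case False
  with assms(1,3-5) show ?thesis by (intro simply_connected_imp_winding_number_zero[of D1]) auto
qed

text \<open>Tested by winding numbers. A point off \<open>D1 \<inter> D2\<close> is off one of two
  simply connected sets. A point of another component is joined inside the closure of this bounded
  component to a frontier point, which is off \<open>D1 \<inter> D2\<close>, and the winding number
  does not change on the way.\<close>

lemma simply_connected_component_Int:
  fixes D1 D2 :: "complex set"
  assumes D1: "open D1" "bounded D1" "simply_connected D1" and D2: "open D2" "simply_connected D2"
  shows "simply_connected (connected_component_set (D1 \<inter> D2) x)"
proof -
  let ?W = "\<lambda>x. connected_component_set (D1 \<inter> D2) x"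
  have op: "open (D1 \<inter> D2)" using D1 D2 by blast
  have Wsub: "?W x \<subseteq> D1 \<inter> D2" by (rule connected_component_subset)
  have "winding_number p z = 0"
    if p: "path p" "path_image p \<subseteq> ?W x" "pathfinish p = pathstart p" and z: "z \<notin> ?W x" for p z
  proof (cases "z \<in> D1 \<inter> D2")
    case False
    show ?thesis
      by (rule winding_number_zero_Int[OF D1(3) D2(2) p(1) order_trans[OF p(2) Wsub] p(3) False])
  next
    case True
    have zz: "z \<in> ?W z" using True by simp
    have "bounded (?W z)"
      by (rule bounded_subset[OF D1(2)]) (rule order_trans[OF connected_component_subset], simp)
    then have "?W z \<noteq> UNIV" by (metis not_bounded_UNIV)
    then have "frontier (?W z) \<noteq> {}" unfolding frontier_eq_empty using zz by blast
    then obtain y where y: "y \<in> frontier (?W z)" by blast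
    have yD: "y \<notin> D1 \<inter> D2"
      using frontier_of_connected_component_subset[of "D1 \<inter> D2" z] y frontier_disjoint_eq[of "D1 \<inter> D2"] op by blast
    have ycl: "y \<in> closure (?W z)" using y by (simp add: frontier_def)
    have con: "connected (insert y (?W z))"
    proof (rule connected_intermediate_closure[of "?W z"])
      show "insert y (?W z) \<subseteq> closure (?W z)" by (rule insert_subsetI[OF ycl closure_subset])
    qed (simp_all add: subset_insertI)
    have "x \<notin> ?W z" using z connected_component_sym[of "D1 \<inter> D2" z x] by auto
    then have dis: "?W x \<inter> ?W z = {}" by (rule iffD2[OF connected_component_disjoint])
    have "insert y (?W z) \<inter> path_image p = {}" using dis p(2) yD Wsub by blast
    then have "winding_number p z = winding_number p y"
      by (intro winding_number_eq[OF p(1,3) _ _ con]) (use zz in auto)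
    also have "\<dots> = 0"
      by (rule winding_number_zero_Int[OF D1(3) D2(2) p(1) order_trans[OF p(2) Wsub] p(3) yD])
    finally show ?thesis .
  qed
  then show ?thesis
    unfolding simply_connected_eq_winding_number_zero[OF open_connected_component[OF op]] by blast
qed

text \<open>Images of concentric discs under a homeomorphism from the unit disc: the radii
  \<open>r1\<close>, \<open>r2\<close>, \<open>r3\<close> give \<open>I\<close>, \<open>C\<close>
  (open version \<open>J\<close>) and \<open>E\<close>, and \<open>R\<close> is the annulus from
  \<open>r0\<close> to \<open>r3\<close>, with \<open>r0\<close> beyond the image of
  \<open>U\<close>. The ring \<open>C - I\<close> is compact in the connected open set
  \<open>R\<close>, as the Harnack inequality requires; the complement of \<open>C\<close> is
  connected, as the escape estimate requires.\<close>

lemma concentric_discs: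
  fixes U W :: "complex set"
  assumes W: "open W" "simply_connected W" and U: "bounded U" "U \<noteq> {}" "closure U \<subseteq> W"
  obtains I J C E R where "open I" "open J" "compact C" "open E" "open R" "connected R"
    "U \<subseteq> I" "closure I \<subseteq> J" "J \<subseteq> C" "C - I \<subseteq> R" "R \<subseteq> E" "R \<inter> U = {}" "C \<subseteq> E" "compact (closure E)" "closure E \<subseteq> W"
    "connected (- C)"
proof -
  have "W \<noteq> {}" using U closure_subset by blast
  then obtain f g where fg: "homeomorphism W (ball 0 1 :: complex set) f g"
    using W(2) simply_connected_eq_homeomorphic_to_disc[OF W(1)] unfolding homeomorphic_def by blast
  have cf: "continuous_on W f" and cg: "continuous_on (ball 0 1) g"
    using fg by (simp_all add: homeomorphism_def)
  have gf: "g (f w) = w" "f w \<in> ball 0 1" if "w \<in> W" for w using fg that by (auto simp: homeomorphism_def)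
  have fgz: "f (g z) = z" "g z \<in> W" if "z \<in> ball 0 1" for z using fg that by (auto simp: homeomorphism_def)
  have compU: "compact (closure U)" using U(1) by simp
  have "compact (f ` closure U)"
    by (rule compact_continuous_image[OF continuous_on_subset[OF cf U(3)] compU])
  moreover have "f ` closure U \<subseteq> ball 0 1" using gf(2) U(3) by blast
  moreover have "f ` closure U \<noteq> {}" using U(2) by simp
  ultimately obtain \<rho> where \<rho>: "\<rho> < 1" "\<And>w. w \<in> closure U \<Longrightarrow> norm (f w) \<le> \<rho>"
  proof -
    assume 1: "compact (f ` closure U)" and 2: "f ` closure U \<subseteq> ball 0 1" and 3: "f ` closure U \<noteq> {}"
      and T: "\<And>\<rho>. \<rho> < 1 \<Longrightarrow> (\<And>w. w \<in> closure U \<Longrightarrow> norm (f w) \<le> \<rho>) \<Longrightarrow> thesis"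
    obtain z where z: "z \<in> f ` closure U" "\<forall>y\<in>f ` closure U. norm y \<le> norm z"
      using continuous_attains_sup[OF 1 3 continuous_on_norm[OF continuous_on_id]] by blast
    show thesis
    proof (rule T[of "norm z"])
      show "norm z < 1" using z(1) 2 by (metis mem_ball_0 subsetD)
      show "norm (f w) \<le> norm z" if "w \<in> closure U" for w using z(2) that by blast
    qed
  qed
  \<comment> \<open>Each radius is the midpoint of its predecessor and 1;
    \<open>max \<rho> 0\<close> makes \<open>r0\<close> positive.\<close>
  define r0 where "r0 = (max \<rho> 0 + 1) / 2"
  define r1 where "r1 = (r0 + 1) / 2"
  define r2 where "r2 = (r1 + 1) / 2"
  define r3 where "r3 = (r2 + 1) / 2"
  have r: "\<rho> < r0" "0 < r0" "r0 < r1" "r1 < r2" "r2 < r3" "r3 < 1"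
    using \<rho>(1) by (auto simp: r0_def r1_def r2_def r3_def)
  have og: "open (g ` S)" if "open S" "S \<subseteq> ball 0 1" for S
  proof -
    have "openin (top_of_set W) (g ` S)"
      by (rule homeomorphism_imp_open_map[OF homeomorphism_symD[OF fg]])
        (use that in \<open>simp add: openin_open_eq\<close>)
    then show ?thesis using W(1) by (simp add: openin_open_eq)
  qed
  have kg: "compact (g ` S)" if "compact S" "S \<subseteq> ball 0 1" for S
    by (rule compact_continuous_image[OF continuous_on_subset[OF cg that(2)] that(1)])
  have sub: "ball 0 r1 \<subseteq> ball (0::complex) 1" "ball 0 r2 \<subseteq> ball (0::complex) 1" "ball 0 r3 \<subseteq> ball (0::complex) 1"
    "cball 0 r1 \<subseteq> ball (0::complex) 1" "cball 0 r2 \<subseteq> ball (0::complex) 1" "cball 0 r3 \<subseteq> ball (0::complex) 1"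
    using r by auto
  define A where "A = {z::complex. r0 < norm (z - 0) \<and> norm (z - 0) < r3}"
  have A: "A \<subseteq> ball 0 1" "connected A" "open A"
  proof -
    show "A \<subseteq> ball 0 1" using r by (auto simp: A_def)
    show "connected A" unfolding A_def by (rule connected_annulus) simp
    have "A = ball 0 r3 - cball 0 r0" by (auto simp: A_def)
    then show "open A" by (simp add: open_Diff)
  qed
  have clI: "closure (g ` ball 0 r1) \<subseteq> g ` cball 0 r1"
    by (rule closure_minimal[OF image_mono[OF ball_subset_cball] compact_imp_closed[OF kg[OF compact_cball sub(4)]]])
  have clE: "closure (g ` ball 0 r3) \<subseteq> g ` cball 0 r3"
    by (rule closure_minimal[OF image_mono[OF ball_subset_cball] compact_imp_closed[OF kg[OF compact_cball sub(6)]]])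
  show thesis
  proof (rule that[of "g ` ball 0 r1" "g ` ball 0 r2" "g ` cball 0 r2" "g ` ball 0 r3" "g ` A"])
    show "open (g ` ball 0 r1)" "open (g ` ball 0 r2)" "open (g ` ball 0 r3)" "open (g ` A)"
      by (intro og open_ball sub A)+
    show "compact (g ` cball 0 r2)" by (rule kg[OF compact_cball sub(5)])
    show "connected (g ` A)" by (rule connected_continuous_image[OF continuous_on_subset[OF cg A(1)] A(2)])
    show "U \<subseteq> g ` ball 0 r1"
    proof
      fix u assume "u \<in> U"
      then have u: "u \<in> closure U" using closure_subset by blast
      have "f u \<in> ball 0 r1" using \<rho>(2)[OF u] r by simp
      then show "u \<in> g ` ball 0 r1" using gf(1)[OF subsetD[OF U(3) u]] by (intro image_eqI[of _ _ "f u"]) simp_all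
    qed
    show "closure (g ` ball 0 r1) \<subseteq> g ` ball 0 r2"
      by (rule order_trans[OF clI image_mono]) (use r in auto)
    show "g ` ball 0 r2 \<subseteq> g ` cball 0 r2" by (intro image_mono ball_subset_cball)
    show "g ` cball 0 r2 - g ` ball 0 r1 \<subseteq> g ` A"
    proof
      fix x assume x: "x \<in> g ` cball 0 r2 - g ` ball 0 r1"
      then obtain z where z: "x = g z" "z \<in> cball 0 r2" by blast
      then have "z \<notin> ball 0 r1" using x by blast
      then have "z \<in> A" using z(2) r by (simp add: A_def)
      then show "x \<in> g ` A" using z(1) by blast
    qed
    show "g ` A \<subseteq> g ` ball 0 r3" by (rule image_mono) (auto simp: A_def)
    show "g ` A \<inter> U = {}"
    proof (rule ccontr)
      assume "g ` A \<inter> U \<noteq> {}"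
      then obtain z where z: "z \<in> A" "g z \<in> U" by blast
      have "g z \<in> closure U" using z(2) closure_subset by blast
      then have "norm z \<le> \<rho>" using \<rho>(2) fgz(1)[OF subsetD[OF A(1) z(1)]] by metis
      then show False using z(1) r by (simp add: A_def)
    qed
    show "g ` cball 0 r2 \<subseteq> g ` ball 0 r3" by (rule image_mono) (use r in auto)
    show "compact (closure (g ` ball 0 r3))"
      using bounded_subset[OF compact_imp_bounded[OF kg[OF compact_cball sub(6)]] clE]
      by (simp add: compact_eq_bounded_closed)
    show "closure (g ` ball 0 r3) \<subseteq> W"
      by (rule order_trans[OF clE]) (use fgz(2) sub(6) in blast)
    have "g ` cball 0 r2 \<subseteq> W" using fgz(2) sub(5) by blast
    from homeomorphism_of_subsets[OF homeomorphism_symD[OF fg] sub(5) this refl]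
    have "cball (0::complex) r2 homeomorphic (g ` cball 0 r2)" unfolding homeomorphic_def by (intro exI)
    then have "(g ` cball 0 r2) homeomorphic cball (0::complex) r2" by (rule iffD1[OF homeomorphic_sym])
    then show "connected (- (g ` cball 0 r2))"
      by (rule connected_complement_homeomorphic_convex_compact) simp_all
  qed
qed

section \<open>Spanning trees with a given restriction\<close>

definition tree_rel :: "'e plane_graph \<Rightarrow> complex set \<Rightarrow> 'e set \<Rightarrow> (complex \<times> complex) set" where
  "tree_rel G D T = arc_rel G {e \<in> T. trace G e \<subseteq> D}"

lemma tree_relI: "e \<in> T \<Longrightarrow> trace G e \<subseteq> D \<Longrightarrow> (tail (skel G) e, head (skel G) e) \<in> tree_rel G D T"
  by (auto simp: tree_rel_def arc_rel_def)

text \<open>The cemetery has no outgoing edge, so a cycle stays among the vertices and uses only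
  edges drawn inside \<open>D\<close>.\<close>

lemma acyclic_arcs_ends_wired:
  assumes T: "T \<subseteq> arcs (wired_graph G D)"
  shows "acyclic (arcs_ends (wired_graph G D \<lparr>arcs := T\<rparr>)) \<longleftrightarrow> acyclic (tree_rel G D T)"
proof -
  let ?H = "wired_graph G D \<lparr>arcs := T\<rparr>"
  have E0: "arcs_ends ?H = (\<lambda>e. (Some (tail (skel G) e), if trace G e \<subseteq> D then Some (head (skel G) e) else None)) ` T"
    by (simp add: arcs_ends_def arc_to_ends_def wired_graph_def)
  have E: "(x, y) \<in> arcs_ends ?H \<longleftrightarrow> (\<exists>e\<in>T. x = Some (tail (skel G) e) \<and>
      y = (if trace G e \<subseteq> D then Some (head (skel G) e) else None))" for x y
    unfolding E0 by (simp add: image_iff)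
  have R: "(u, v) \<in> tree_rel G D T \<longleftrightarrow> (\<exists>e\<in>T. trace G e \<subseteq> D \<and> u = tail (skel G) e \<and> v = head (skel G) e)" for u v
    by (auto simp: tree_rel_def arc_rel_def)
  have RE: "(Some u, Some v) \<in> arcs_ends ?H" if "(u, v) \<in> tree_rel G D T" for u v
    using that unfolding R E by auto
  have up: "(Some u, Some v) \<in> (arcs_ends ?H)\<^sup>+" if "(u, v) \<in> (tree_rel G D T)\<^sup>+" for u v
    using that
  proof induction
    case (base y)
    then show ?case by (intro r_into_trancl RE)
  next
    case (step y z)
    from step.IH RE[OF step.hyps(2)] show ?case by (rule trancl_into_trancl)
  qed
  have down: "\<exists>u. x = Some u \<and> (\<forall>v. y = Some v \<longrightarrow> (u, v) \<in> (tree_rel G D T)\<^sup>+)"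
    if "(x, y) \<in> (arcs_ends ?H)\<^sup>+" for x y
    using that
  proof induction
    case (base y)
    then obtain e where e: "e \<in> T" "x = Some (tail (skel G) e)"
      "y = (if trace G e \<subseteq> D then Some (head (skel G) e) else None)"
      unfolding E by (elim bexE conjE)
    have "(tail (skel G) e, v) \<in> tree_rel G D T" if "y = Some v" for v
      using that e unfolding R by (auto split: if_splits)
    then show ?case using e(2) by blast
  next
    case (step y z)
    obtain u where u: "x = Some u" "\<And>v. y = Some v \<Longrightarrow> (u, v) \<in> (tree_rel G D T)\<^sup>+"
      using step.IH by blast
    obtain e where e: "e \<in> T" "y = Some (tail (skel G) e)"
      "z = (if trace G e \<subseteq> D then Some (head (skel G) e) else None)"
      using step.hyps(2) unfolding E by (elim bexE conjE)
    have "(u, v) \<in> (tree_rel G D T)\<^sup>+" if "z = Some v" for v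
    proof -
      from that e have "(tail (skel G) e, v) \<in> tree_rel G D T"
        unfolding R by (auto split: if_splits)
      with u(2)[OF e(2)] show ?thesis by (rule trancl_into_trancl)
    qed
    with u(1) show ?case by blast
  qed
  show ?thesis
    unfolding acyclic_def
  proof
    assume A: "\<forall>x. (x, x) \<notin> (arcs_ends ?H)\<^sup>+"
    show "\<forall>x. (x, x) \<notin> (tree_rel G D T)\<^sup>+"
    proof (intro allI notI)
      fix x assume "(x, x) \<in> (tree_rel G D T)\<^sup>+"
      from up[OF this] A show False by simp
    qed
  next
    assume A: "\<forall>x. (x, x) \<notin> (tree_rel G D T)\<^sup>+"
    show "\<forall>x. (x, x) \<notin> (arcs_ends ?H)\<^sup>+"
    proof (intro allI notI)
      fix x assume "(x, x) \<in> (arcs_ends ?H)\<^sup>+"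
      from down[OF this] obtain u where "x = Some u" "\<forall>v. x = Some v \<longrightarrow> (u, v) \<in> (tree_rel G D T)\<^sup>+"
        by (elim exE conjE)
      then show False using A by simp
    qed
  qed
qed

text \<open>A closed walk exists exactly if a cycle does, so the absence of cycles is acyclicity of
  a relation on vertices, the form in which the matrix-tree theorem provides it.\<close>

lemma wired_trees_iff:
  assumes G: "weighted_graph G" "good_embedding G"
  shows "T \<in> wired_trees G D \<longleftrightarrow> T \<subseteq> {e \<in> arcs (skel G). tail (skel G) e \<in> D} \<and>
    (\<forall>v\<in>verts (skel G) \<inter> D. \<exists>!e. e \<in> T \<and> tail (skel G) e = v) \<and> acyclic (tree_rel G D T)"
proof -
  have cyc: "(\<nexists>p. pre_digraph.cycle (wired_graph G D \<lparr>arcs := T\<rparr>) p) \<longleftrightarrow> acyclic (tree_rel G D T)"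
    if T: "T \<subseteq> arcs (wired_graph G D)"
  proof -
    let ?H = "wired_graph G D \<lparr>arcs := T\<rparr>"
    interpret wf_digraph ?H
    proof
      fix e assume "e \<in> arcs ?H"
      then have e: "e \<in> arcs (skel G)" "tail (skel G) e \<in> D" using T by (auto simp: wired_graph_def)
      note ends = arc_ends[OF G(2,1) e(1)]
      show "tail ?H e \<in> verts ?H" using e ends by (simp add: wired_graph_def)
      show "head ?H e \<in> verts ?H" using ends by (auto simp: wired_graph_def)
    qed
    have "(\<exists>p. cycle p) \<longleftrightarrow> (\<exists>u. u \<rightarrow>\<^sup>+\<^bsub>?H\<^esub> u)"
    proof
      assume "\<exists>p. cycle p"
      then show "\<exists>u. u \<rightarrow>\<^sup>+\<^bsub>?H\<^esub> u" unfolding cycle_def reachable1_awalk by blast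
    next
      assume "\<exists>u. u \<rightarrow>\<^sup>+\<^bsub>?H\<^esub> u"
      then obtain p where "closed_w p" unfolding closed_w_def reachable1_awalk by blast
      then show "\<exists>p. cycle p" by (rule closed_w_imp_cycle)
    qed
    then have "(\<nexists>p. cycle p) \<longleftrightarrow> acyclic (arcs_ends ?H)" by (simp add: acyclic_def)
    then show ?thesis using acyclic_arcs_ends_wired[OF T] by simp
  qed
  have "verts (wired_graph G D) - {None} = Some ` (verts (skel G) \<inter> D)" by (auto simp: wired_graph_def)
  moreover have "tail (wired_graph G D) e = Some (tail (skel G) e)" for e by (simp add: wired_graph_def)
  moreover have "arcs (wired_graph G D) = {e \<in> arcs (skel G). tail (skel G) e \<in> D}" by (simp add: wired_graph_def)
  ultimately show ?thesis using cyc unfolding wired_trees_def by auto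
qed

text \<open>The edges which may leave \<open>v\<close> in a wired tree whose restriction to \<open>U\<close> is \<open>F\<close>.\<close>

definition choices :: "'e plane_graph \<Rightarrow> complex set \<Rightarrow> 'e set \<Rightarrow> complex \<Rightarrow> 'e set" where
  "choices G U F v = {e \<in> out_arcs (skel G) v.
     (trace G e \<subseteq> U \<longrightarrow> e \<in> F) \<and> (v \<in> tail (skel G) ` F \<longrightarrow> e \<in> F)}"

definition cond_weight :: "'e plane_graph \<Rightarrow> complex set \<Rightarrow> 'e set \<Rightarrow> complex \<Rightarrow> real" where
  "cond_weight G U F v = (\<Sum>e\<in>choices G U F v. norm_weight G e)"

text \<open>The walk picks an allowed edge with its conditional probability and dies if the edge is
  not drawn inside \<open>D\<close>. At a tail of \<open>F\<close> the edge is taken from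
  \<open>F\<close>; elsewhere in \<open>U\<close> the edges inside \<open>U\<close> are forbidden;
  off \<open>U\<close> nothing changes.\<close>

definition cond_kernel :: "'e plane_graph \<Rightarrow> complex set \<Rightarrow> 'e set \<Rightarrow> complex set \<Rightarrow> complex \<Rightarrow> complex \<Rightarrow> real" where
  "cond_kernel G U F D v w = (if v \<in> D then
     \<Sum>e\<in>choices G U F v. if trace G e \<subseteq> D \<and> head (skel G) e = w then norm_weight G e / cond_weight G U F v else 0
   else 0)"

text \<open>What the restriction of a wired tree inherits from it. By \<open>choices_ne\<close>
  every vertex keeps an allowed edge, so the conditional weights can be normalised.\<close>

locale restricted_forest =
  fixes G :: "'e plane_graph" and U :: "complex set" and F :: "'e set"
  assumes graph: "weighted_graph G" and embedding: "good_embedding G"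
    and F: "\<And>e. e \<in> F \<Longrightarrow> e \<in> arcs (skel G) \<and> trace G e \<subseteq> U"
    and F_inj: "inj_on (tail (skel G)) F"
    and choices_ne: "\<And>v. v \<in> verts (skel G) \<Longrightarrow> choices G U F v \<noteq> {}"
begin

lemma finite_choices: "v \<in> verts (skel G) \<Longrightarrow> finite (choices G U F v)"
  using graph unfolding weighted_graph_def
  by (intro finite_subset[of "choices G U F v" "out_arcs (skel G) v"]) (auto simp: choices_def)

lemma choicesD:
  assumes "e \<in> choices G U F v"
  shows "e \<in> arcs (skel G)" "tail (skel G) e = v" "0 < norm_weight G e"
  using assms norm_weight_pos[OF graph] by (auto simp: choices_def)

lemma cond_weight_pos:
  assumes "v \<in> verts (skel G)"
  shows "0 < cond_weight G U F v"
  unfolding cond_weight_def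
  by (rule sum_pos[OF finite_choices[OF assms] choices_ne[OF assms] choicesD(3)])

text \<open>An edge inside \<open>U\<close> starts in \<open>U\<close>, so conditioning leaves
  vertices off \<open>U\<close> alone. This is why outer determinants do not depend on
  \<open>F\<close>.\<close>

lemma choices_outside:
  assumes "v \<notin> U"
  shows "choices G U F v = out_arcs (skel G) v"
proof -
  have "trace G e \<subseteq> U \<Longrightarrow> e \<notin> out_arcs (skel G) v" for e
    using arc_ends(1)[OF embedding graph, of e] assms by auto
  moreover have "v \<notin> tail (skel G) ` F"
    using arc_ends(1)[OF embedding graph] F assms by blast
  ultimately show ?thesis unfolding choices_def by blast
qed

lemma cond_weight_outside:
  assumes "v \<in> verts (skel G)" "v \<notin> U"
  shows "cond_weight G U F v = 1"
  unfolding cond_weight_def choices_outside[OF assms(2)] by (rule sum_norm_weight[OF graph assms(1)])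

lemma sum_choices:
  assumes "v \<in> verts (skel G)"
  shows "(\<Sum>e\<in>choices G U F v. norm_weight G e / cond_weight G U F v) = 1"
  using cond_weight_pos[OF assms] by (simp add: sum_divide_distrib[symmetric] cond_weight_def)

lemma sum_cond_kernel:
  assumes V: "finite V" "verts (skel G) \<inter> D \<subseteq> V" and v: "v \<in> D"
  shows "(\<Sum>w\<in>V. cond_kernel G U F D v w * h w) =
    (\<Sum>e\<in>choices G U F v. if trace G e \<subseteq> D then norm_weight G e / cond_weight G U F v * h (head (skel G) e) else 0)"
proof -
  let ?q = "\<lambda>e. norm_weight G e / cond_weight G U F v"
  have "(\<Sum>w\<in>V. cond_kernel G U F D v w * h w) =
      (\<Sum>w\<in>V. \<Sum>e\<in>choices G U F v. (if trace G e \<subseteq> D \<and> head (skel G) e = w then ?q e * h w else 0))"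
    using v by (auto simp: cond_kernel_def sum_distrib_right intro!: sum.cong)
  also have "\<dots> = (\<Sum>e\<in>choices G U F v. \<Sum>w\<in>V. (if trace G e \<subseteq> D \<and> head (skel G) e = w then ?q e * h w else 0))"
    by (rule sum.swap)
  also have "\<dots> = (\<Sum>e\<in>choices G U F v. if trace G e \<subseteq> D then ?q e * h (head (skel G) e) else 0)"
  proof (rule sum.cong[OF refl])
    fix e assume e: "e \<in> choices G U F v"
    show "(\<Sum>w\<in>V. (if trace G e \<subseteq> D \<and> head (skel G) e = w then ?q e * h w else 0)) =
      (if trace G e \<subseteq> D then ?q e * h (head (skel G) e) else 0)"
    proof (cases "trace G e \<subseteq> D")
      case True
      then have "head (skel G) e \<in> V"
        using arc_ends(2,4)[OF embedding graph choicesD(1)[OF e]] V(2) by blast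
      then show ?thesis using True V(1) by (simp add: sum.delta)
    qed simp
  qed
  finally show ?thesis .
qed

lemma cond_kernel_nonneg:
  assumes "v \<in> verts (skel G)"
  shows "0 \<le> cond_kernel G U F D v w"
proof -
  have "0 \<le> norm_weight G e / cond_weight G U F v" if "e \<in> choices G U F v" for e
    using cond_weight_pos[OF assms] choicesD(3)[OF that] by simp
  then show ?thesis unfolding cond_kernel_def by (simp add: sum_nonneg)
qed

lemma cond_kernel_pos:
  assumes v: "v \<in> verts (skel G)" "v \<in> D" and e: "e \<in> choices G U F v" "trace G e \<subseteq> D"
  shows "0 < cond_kernel G U F D v (head (skel G) e)"
proof -
  have q: "0 < norm_weight G e' / cond_weight G U F v" if "e' \<in> choices G U F v" for e'
    using cond_weight_pos[OF v(1)] choicesD(3)[OF that] by simp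
  show ?thesis
    unfolding cond_kernel_def if_P[OF v(2)]
  proof (rule sum_pos2[OF finite_choices[OF v(1)] e(1)])
    show "0 < (if trace G e \<subseteq> D \<and> head (skel G) e = head (skel G) e then norm_weight G e / cond_weight G U F v else 0)"
      using q[OF e(1)] e(2) by simp
    show "0 \<le> (if trace G e' \<subseteq> D \<and> head (skel G) e' = head (skel G) e then norm_weight G e' / cond_weight G U F v else 0)"
      if "e' \<in> choices G U F v" for e' using less_imp_le[OF q[OF that]] by simp
  qed
qed

lemma sum_cond_kernel_1:
  assumes V: "finite V" "verts (skel G) \<inter> D \<subseteq> V" and v: "v \<in> D"
  shows "(\<Sum>w\<in>V. cond_kernel G U F D v w) =
    (\<Sum>e\<in>choices G U F v. if trace G e \<subseteq> D then norm_weight G e / cond_weight G U F v else 0)"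
  using sum_cond_kernel[OF assms, of "\<lambda>_. 1"] by (simp cong: if_cong)

lemma substochastic_cond_kernel:
  assumes V: "finite V" "verts (skel G) \<inter> D \<subseteq> V" "V \<subseteq> verts (skel G)"
  shows "substochastic V (cond_kernel G U F D)"
proof (rule substochastic.intro)
  show "finite V" by (rule V(1))
  show "0 \<le> cond_kernel G U F D v w" if "v \<in> V" for v w using that V(3) by (intro cond_kernel_nonneg) blast
  fix v assume v: "v \<in> V"
  have vv: "v \<in> verts (skel G)" using v V(3) by blast
  show "(\<Sum>w\<in>V. cond_kernel G U F D v w) \<le> 1"
  proof (cases "v \<in> D")
    case True
    have "(\<Sum>w\<in>V. cond_kernel G U F D v w) \<le> (\<Sum>e\<in>choices G U F v. norm_weight G e / cond_weight G U F v)"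
      unfolding sum_cond_kernel_1[OF V(1,2) True]
    proof (rule sum_mono)
      fix e assume "e \<in> choices G U F v"
      then have "0 \<le> norm_weight G e / cond_weight G U F v"
        using cond_weight_pos[OF vv] choicesD(3) by (intro divide_nonneg_nonneg) (auto intro: less_imp_le)
      then show "(if trace G e \<subseteq> D then norm_weight G e / cond_weight G U F v else 0) \<le> norm_weight G e / cond_weight G U F v"
        by simp
    qed
    then show ?thesis by (simp add: sum_choices[OF vv])
  qed (simp add: cond_kernel_def)
qed

text \<open>Off \<open>U\<close> every edge is allowed with positive weight, so a path out of
  \<open>V\<close> can be followed until it leaves \<open>A\<close> or uses an edge not drawn inside
  \<open>D\<close>, where mass is lost.\<close>

lemma escapes_walk:
  assumes V: "finite V" "verts (skel G) \<inter> D \<subseteq> V" "V \<subseteq> verts (skel G)" and A: "A \<subseteq> V" "A \<inter> U = {}"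
    and path: "(v, z) \<in> (arc_rel G (arcs (skel G)))\<^sup>*" and z: "z \<notin> V" and v: "v \<in> A"
  shows "escapes V (cond_kernel G U F D) A v"
  using path v
proof (induction rule: converse_rtrancl_induct)
  case base
  then show ?case using z A(1) by blast
next
  case (step v w)
  obtain e where e: "e \<in> arcs (skel G)" "tail (skel G) e = v" "head (skel G) e = w"
    using step.hyps(1) by (auto simp: arc_rel_def)
  have vv: "v \<in> verts (skel G)" "v \<notin> U" using step.prems A V(3) by auto
  have ec: "e \<in> choices G U F v" unfolding choices_outside[OF vv(2)] using e by simp
  have q: "0 < norm_weight G e' / cond_weight G U F v" if "e' \<in> choices G U F v" for e'
    using cond_weight_pos[OF vv(1)] choicesD(3)[OF that] by simp
  show ?case
  proof (cases "v \<in> D")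
    case False
    then show ?thesis by (intro escapes.die step.prems) (simp add: cond_kernel_def)
  next
    case vD: True
    show ?thesis
    proof (cases "trace G e \<subseteq> D")
      case True
      then have wV: "w \<in> V" using arc_ends(2,4)[OF embedding graph e(1)] V(2) e(3) by blast
      have pos: "0 < cond_kernel G U F D v w" using cond_kernel_pos[OF vv(1) vD ec True] e(3) by simp
      show ?thesis
      proof (cases "w \<in> A")
        case True
        show ?thesis by (rule escapes.step[where P="cond_kernel G U F D", OF step.prems wV pos step.IH[OF True]])
      next
        case False
        show ?thesis by (rule escapes.leave[where P="cond_kernel G U F D", OF step.prems wV pos False])
      qed
    next
      case False
      have "(\<Sum>w\<in>V. cond_kernel G U F D v w) < (\<Sum>e\<in>choices G U F v. norm_weight G e / cond_weight G U F v)"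
        unfolding sum_cond_kernel_1[OF V(1,2) vD]
      proof (rule sum_strict_mono_ex1[OF finite_choices[OF vv(1)]])
        show "\<forall>e\<in>choices G U F v. (if trace G e \<subseteq> D then norm_weight G e / cond_weight G U F v else 0)
            \<le> norm_weight G e / cond_weight G U F v"
          using q by (auto intro: less_imp_le)
        show "\<exists>e\<in>choices G U F v. (if trace G e \<subseteq> D then norm_weight G e / cond_weight G U F v else 0)
            < norm_weight G e / cond_weight G U F v"
          using False q[OF ec] ec by (intro bexI[of _ e]) simp_all
      qed
      then show ?thesis by (intro escapes.die step.prems) (simp add: sum_choices[OF vv(1)])
    qed
  qed
qed

lemma tree_choice:
  assumes T: "T \<in> wired_trees G D" "{e \<in> T. trace G e \<subseteq> U} = F" and e: "e \<in> T"
  shows "e \<in> choices G U F (tail (skel G) e)"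
proof -
  have T': "T \<subseteq> {e \<in> arcs (skel G). tail (skel G) e \<in> D}"
    "\<forall>v\<in>verts (skel G) \<inter> D. \<exists>!e. e \<in> T \<and> tail (skel G) e = v"
    using T(1) unfolding wired_trees_iff[OF graph embedding] by simp_all
  have ea: "e \<in> arcs (skel G)" "tail (skel G) e \<in> D" using e T'(1) by auto
  note ends = arc_ends[OF embedding graph ea(1)]
  have ex1: "\<exists>!e'. e' \<in> T \<and> tail (skel G) e' = tail (skel G) e" by (rule bspec[OF T'(2) IntI[OF ends(3) ea(2)]])
  have eF: "e \<in> F" if vF: "tail (skel G) e \<in> tail (skel G) ` F"
  proof -
    from vF obtain e' where e': "tail (skel G) e = tail (skel G) e'" "e' \<in> F" by (rule imageE)
    from e'(2) have "e' \<in> {e \<in> T. trace G e \<subseteq> U}" unfolding T(2) .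
    then have "e' \<in> T" by simp
    with ex1 e e'(1) have "e' = e" by auto
    from this e'(2) show ?thesis by (rule subst)
  qed
  have eU: "e \<in> F" if "trace G e \<subseteq> U" unfolding T(2)[symmetric] using that e by simp
  show ?thesis unfolding choices_def by (intro CollectI conjI impI eU eF) (simp_all add: ea)
qed

text \<open>Inside \<open>U\<close> the conditioning may forbid the edges of a given path, so the
  tree \<open>T\<close> is followed instead: its edges are allowed, and being acyclic they leave the
  finite set \<open>A\<close>. The tree may belong to another domain \<open>D'\<close>, which gives
  access to every \<open>F\<close> in the support of either law.\<close>

lemma escapes_tree:
  assumes V: "finite V" "verts (skel G) \<inter> D \<subseteq> V" "V \<subseteq> verts (skel G)" and A: "A \<subseteq> V" "A \<subseteq> D" "A \<subseteq> D'"
    and tr: "\<And>v e. v \<in> A \<Longrightarrow> e \<in> out_arcs (skel G) v \<Longrightarrow> trace G e \<subseteq> D \<inter> D'"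
    and T: "T \<in> wired_trees G D'" "{e \<in> T. trace G e \<subseteq> U} = F" and v: "v \<in> A"
  shows "escapes V (cond_kernel G U F D) A v"
proof -
  define r where "r = tree_rel G D' T \<inter> A \<times> A"
  have T': "T \<subseteq> {e \<in> arcs (skel G). tail (skel G) e \<in> D'}"
    "\<forall>v\<in>verts (skel G) \<inter> D'. \<exists>!e. e \<in> T \<and> tail (skel G) e = v" "acyclic (tree_rel G D' T)"
    using T(1) unfolding wired_trees_iff[OF graph embedding] by blast+
  have finA: "finite A" using A(1) V(1) by (rule finite_subset)
  have "finite r" using finA by (simp add: r_def)
  moreover have "acyclic r" using T'(3) by (rule acyclic_subset) (simp add: r_def)
  ultimately have wf: "wf (r\<inverse>)" by (rule finite_acyclic_wf_converse)
  show ?thesis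
    using wf v
  proof (induction v rule: wf_induct_rule)
    case (less v)
    have vv: "v \<in> verts (skel G)" "v \<in> D" "v \<in> D'" using less.prems A V(3) by auto
    then obtain e where e: "e \<in> T" "tail (skel G) e = v" using T'(2) by blast
    have ea: "e \<in> out_arcs (skel G) v" using e(1,2) T'(1) by auto
    have tre: "trace G e \<subseteq> D" "trace G e \<subseteq> D'" using tr[OF less.prems ea] by auto
    have ec: "e \<in> choices G U F v" using tree_choice[OF T e(1)] unfolding e(2) .
    note ends = arc_ends[OF embedding graph choicesD(1)[OF ec]]
    have wV: "head (skel G) e \<in> V" by (rule subsetD[OF V(2) IntI[OF ends(4) subsetD[OF tre(1) ends(2)]]])
    have pos: "0 < cond_kernel G U F D v (head (skel G) e)" by (rule cond_kernel_pos[OF vv(1,2) ec tre(1)])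
    show ?case
    proof (cases "head (skel G) e \<in> A")
      case True
      have "(v, head (skel G) e) \<in> tree_rel G D' T" using tree_relI[OF e(1) tre(2)] by (simp only: e(2))
      then have "(v, head (skel G) e) \<in> r" unfolding r_def by (intro IntI SigmaI less.prems True)
      then have "(head (skel G) e, v) \<in> r\<inverse>" by (rule converseI)
      from less.IH[OF this True] show ?thesis by (rule escapes.step[where P="cond_kernel G U F D", OF less.prems wV pos])
    next
      case False
      show ?thesis by (rule escapes.leave[where P="cond_kernel G U F D", OF less.prems wV pos False])
    qed
  qed
qed

text \<open>Wired trees with restriction \<open>F\<close> are the acyclic selections of an allowed
  edge at each vertex of \<open>D\<close>. The matrix-tree theorem applies to the conditional
  weights, and undoing their normalisation yields the product of \<open>cond_weight\<close>, with
  factors one off \<open>U\<close>. Vertices of \<open>V\<close> off \<open>D\<close> have zero rows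
  and do no harm.\<close>

theorem tree_sum:
  assumes V: "finite V" "verts (skel G) \<inter> D \<subseteq> V" "V \<subseteq> verts (skel G)" and UD: "U \<subseteq> D"
  shows "(\<Sum>T | T \<in> wired_trees G D \<and> {e \<in> T. trace G e \<subseteq> U} = F. tree_weight G T) =
    (\<Prod>v\<in>verts (skel G) \<inter> U. cond_weight G U F v) * vdet V (lap V (cond_kernel G U F D))"
proof -
  define A where "A = verts (skel G) \<inter> D"
  define q where "q e = norm_weight G e / cond_weight G U F (tail (skel G) e)" for e
  define tgt where "tgt e = (if trace G e \<subseteq> D then Some (head (skel G) e) else None)" for e
  define FF where "FF = {f \<in> PiE A (choices G U F). acyclic {(v, w). v \<in> A \<and> w \<in> V \<and> tgt (f v) = Some w}}"
  let ?P = "cond_kernel G U F D"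
  have finA: "finite A" using V(1,2) unfolding A_def by (rule finite_subset[rotated])
  have Av: "v \<in> verts (skel G)" "v \<in> D" if "v \<in> A" for v using that by (simp_all add: A_def)
  have tgt: "tgt e = Some w \<longleftrightarrow> trace G e \<subseteq> D \<and> head (skel G) e = w" for e w by (simp add: tgt_def)
  have "vdet V (lap V ?P) = vdet V (lap A ?P)"
  proof (rule vdet_cong)
    fix v w assume "v \<in> V" "w \<in> V"
    then show "lap V ?P v w = lap A ?P v w"
      using V(3) by (auto simp: lap_def A_def cond_kernel_def)
  qed
  also have "\<dots> = (\<Sum>f\<in>FF. \<Prod>v\<in>A. q (f v))"
    unfolding FF_def
  proof (rule matrix_tree[OF V(1)])
    show "A \<subseteq> V" unfolding A_def by (rule V(2))
    show "finite (choices G U F v)" if "v \<in> A" for v by (rule finite_choices[OF Av(1)[OF that]])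
    show "(\<Sum>e\<in>choices G U F v. q e) = 1" if "v \<in> A" for v
      unfolding sum_choices[OF Av(1)[OF that], symmetric]
      by (intro sum.cong refl) (simp add: q_def choicesD(2))
    show "?P v w = (\<Sum>e\<in>choices G U F v. if tgt e = Some w then q e else 0)" if "v \<in> A" "w \<in> V" for v w
      unfolding cond_kernel_def if_P[OF Av(2)[OF that(1)]] tgt
      by (intro sum.cong refl) (simp add: q_def choicesD(2))
  qed
  finally have det: "vdet V (lap V ?P) = (\<Sum>f\<in>FF. \<Prod>v\<in>A. q (f v))" .
  have fc: "f v \<in> choices G U F v" if "f \<in> FF" "v \<in> A" for f v
    using that unfolding FF_def by (auto simp: PiE_mem)
  have ft: "tail (skel G) (f v) = v" if "f \<in> FF" "v \<in> A" for f v by (rule choicesD(2)[OF fc[OF that]])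
  have inj: "inj_on f A" if "f \<in> FF" for f
    by (rule inj_on_inverseI[of _ "tail (skel G)"]) (rule ft[OF that])
  have rel: "{(v, w). v \<in> A \<and> w \<in> V \<and> tgt (f v) = Some w} = tree_rel G D (f ` A)"
    if f: "\<And>v. v \<in> A \<Longrightarrow> f v \<in> choices G U F v" for f
  proof -
    have 1: "(v, w) \<in> tree_rel G D (f ` A)" if vw: "v \<in> A" "tgt (f v) = Some w" for v w
      using tree_relI[of "f v" "f ` A" G D] vw choicesD(2)[OF f[OF vw(1)]] by (auto simp: tgt)
    have 2: "v \<in> A \<and> w \<in> V \<and> tgt (f v) = Some w" if vw: "(v, w) \<in> tree_rel G D (f ` A)" for v w
    proof -
      obtain e where e: "e \<in> f ` A" "trace G e \<subseteq> D" "v = tail (skel G) e" "w = head (skel G) e"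
        using vw by (auto simp: tree_rel_def arc_rel_def)
      obtain u where u: "u \<in> A" "e = f u" using e(1) by blast
      have uv: "u = v" using choicesD(2)[OF f[OF u(1)]] e(3) u(2) by simp
      note ends = arc_ends[OF embedding graph choicesD(1)[OF f[OF u(1)]]]
      have "head (skel G) (f u) \<in> D" using ends(2) e(2) unfolding u(2) by blast
      then have "w \<in> V" using ends(4) V(2) unfolding e(4) u(2) by blast
      moreover have "v \<in> A" using u(1) unfolding uv .
      moreover have "tgt (f v) = Some w" unfolding tgt uv[symmetric] u(2)[symmetric] using e(2,4) by simp
      ultimately show ?thesis by blast
    qed
    show ?thesis
    proof (intro equalityI subrelI)
      fix v w assume "(v, w) \<in> {(v, w). v \<in> A \<and> w \<in> V \<and> tgt (f v) = Some w}"
      then have "v \<in> A" "tgt (f v) = Some w" by simp_all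
      then show "(v, w) \<in> tree_rel G D (f ` A)" by (rule 1)
    next
      fix v w assume "(v, w) \<in> tree_rel G D (f ` A)"
      from 2[OF this] show "(v, w) \<in> {(v, w). v \<in> A \<and> w \<in> V \<and> tgt (f v) = Some w}" by simp
    qed
  qed
  have bij: "bij_betw (\<lambda>f. f ` A) FF {T. T \<in> wired_trees G D \<and> {e \<in> T. trace G e \<subseteq> U} = F}"
    (is "bij_betw _ _ ?TT")
    unfolding bij_betw_def
  proof (intro conjI equalityI subsetI)
    show "inj_on (\<lambda>f. f ` A) FF"
    proof (rule inj_onI)
      fix f f' assume f: "f \<in> FF" "f' \<in> FF" "f ` A = f' ` A"
      show "f = f'"
      proof (rule PiE_ext[of f A "choices G U F"])
        show "f \<in> PiE A (choices G U F)" "f' \<in> PiE A (choices G U F)" using f by (simp_all add: FF_def)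
        fix v assume v: "v \<in> A"
        then have "f v \<in> f' ` A" using f(3) by blast
        then obtain w where w: "f v = f' w" "w \<in> A" by (rule imageE)
        then have "v = w" using ft[OF f(1) v] ft[OF f(2) w(2)] by simp
        then show "f v = f' v" using w by simp
      qed
    qed
  next
    fix T assume "T \<in> (\<lambda>f. f ` A) ` FF"
    then obtain f where f: "f \<in> FF" "T = f ` A" by blast
    have fA: "f v \<in> arcs (skel G)" if "v \<in> A" for v by (rule choicesD(1)[OF fc[OF f(1) that]])
    have "T \<in> wired_trees G D"
      unfolding wired_trees_iff[OF graph embedding]
    proof (intro conjI ballI)
      show "T \<subseteq> {e \<in> arcs (skel G). tail (skel G) e \<in> D}" using f fA ft[OF f(1)] Av(2) by auto
      show "acyclic (tree_rel G D T)" using f rel[OF fc[OF f(1)]] by (simp add: FF_def)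
      fix v assume "v \<in> verts (skel G) \<inter> D"
      then have v: "v \<in> A" by (simp add: A_def)
      show "\<exists>!e. e \<in> T \<and> tail (skel G) e = v"
      proof (rule ex1I[of _ "f v"])
        show "f v \<in> T \<and> tail (skel G) (f v) = v" using v f(2) ft[OF f(1) v] by simp
        show "e = f v" if "e \<in> T \<and> tail (skel G) e = v" for e using that f(2) ft[OF f(1)] by auto
      qed
    qed
    moreover have "{e \<in> T. trace G e \<subseteq> U} = F"
    proof (rule equalityI; rule subsetI)
      fix e assume "e \<in> {e \<in> T. trace G e \<subseteq> U}"
      then obtain v where "v \<in> A" "e = f v" "trace G e \<subseteq> U" unfolding f(2) by auto
      then show "e \<in> F" using fc[OF f(1), of v] by (simp add: choices_def)
    next
      fix e assume e: "e \<in> F"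
      have ea: "e \<in> arcs (skel G)" "trace G e \<subseteq> U" using F[OF e] by simp_all
      have v: "tail (skel G) e \<in> A"
        using arc_ends(1,3)[OF embedding graph ea(1)] ea(2) UD by (auto simp: A_def)
      \<comment> \<open>The selected edge at the tail of \<open>e\<close> is forced into
        \<open>F\<close>, and \<open>F\<close> has just one edge with this tail.\<close>
      have fF: "f (tail (skel G) e) \<in> F" using fc[OF f(1) v] e by (simp add: choices_def)
      have "f (tail (skel G) e) = e" by (rule inj_onD[OF F_inj ft[OF f(1) v] fF e])
      then have "e = f (tail (skel G) e)" by (rule sym)
      then have "e \<in> f ` A" using v by (rule image_eqI)
      then show "e \<in> {e \<in> T. trace G e \<subseteq> U}" using ea(2) f(2) by simp
    qed
    ultimately show "T \<in> ?TT" by simp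
  next
    fix T assume "T \<in> ?TT"
    then have T: "T \<in> wired_trees G D" "{e \<in> T. trace G e \<subseteq> U} = F" by simp_all
    have T': "T \<subseteq> {e \<in> arcs (skel G). tail (skel G) e \<in> D}"
      "\<forall>v\<in>A. \<exists>!e. e \<in> T \<and> tail (skel G) e = v" "acyclic (tree_rel G D T)"
      using T(1) unfolding wired_trees_iff[OF graph embedding] A_def by simp_all
    have "\<forall>v\<in>A. \<exists>e. e \<in> T \<and> tail (skel G) e = v" using T'(2) by (auto dest: ex1_implies_ex)
    from bchoice[OF this] obtain f0 where f0: "\<forall>v\<in>A. f0 v \<in> T \<and> tail (skel G) (f0 v) = v" ..
    define f where "f = restrict f0 A"
    have f: "f v \<in> T" "tail (skel G) (f v) = v" if "v \<in> A" for v using f0 that by (simp_all add: f_def)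
    have fch: "f v \<in> choices G U F v" if "v \<in> A" for v
      using tree_choice[OF T f(1)[OF that]] unfolding f(2)[OF that] .
    have im: "f ` A = T"
    proof (intro equalityI subsetI)
      show "e \<in> T" if "e \<in> f ` A" for e using that f(1) by auto
      fix e assume e: "e \<in> T"
      have ea: "e \<in> arcs (skel G)" "tail (skel G) e \<in> D" using e T'(1) by auto
      have v: "tail (skel G) e \<in> A" using ea arc_ends(3)[OF embedding graph ea(1)] by (simp add: A_def)
      have "\<exists>!e'. e' \<in> T \<and> tail (skel G) e' = tail (skel G) e" using T'(2) v by simp
      then have "e = f (tail (skel G) e)" using e f[OF v] by auto
      then show "e \<in> f ` A" using v by (rule image_eqI)
    qed
    have "f \<in> PiE A (choices G U F)" using fch by (auto simp: f_def PiE_iff)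
    then have "f \<in> FF" unfolding FF_def using rel[OF fch] T'(3) im by simp
    then show "T \<in> (\<lambda>f. f ` A) ` FF" using im by blast
  qed
  have w: "tree_weight G (f ` A) = (\<Prod>v\<in>A. cond_weight G U F v) * (\<Prod>v\<in>A. q (f v))" if f: "f \<in> FF" for f
  proof -
    have "tree_weight G (f ` A) = (\<Prod>v\<in>A. norm_weight G (f v))"
      unfolding tree_weight_def by (simp add: prod.reindex[OF inj[OF f]])
    also have "\<dots> = (\<Prod>v\<in>A. cond_weight G U F v * q (f v))"
    proof (rule prod.cong[OF refl])
      fix v assume v: "v \<in> A"
      show "norm_weight G (f v) = cond_weight G U F v * q (f v)"
        using cond_weight_pos[OF Av(1)[OF v]] by (simp add: q_def ft[OF f v])
    qed
    finally show ?thesis by (simp add: prod.distrib)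
  qed
  have "(\<Prod>v\<in>verts (skel G) \<inter> U. cond_weight G U F v) = (\<Prod>v\<in>A. cond_weight G U F v)"
  proof (rule prod.mono_neutral_left[OF finA])
    show "verts (skel G) \<inter> U \<subseteq> A" using UD by (auto simp: A_def)
    show "\<forall>v\<in>A - verts (skel G) \<inter> U. cond_weight G U F v = 1"
      using cond_weight_outside Av(1) by blast
  qed
  moreover have "(\<Sum>T\<in>?TT. tree_weight G T) = (\<Sum>f\<in>FF. tree_weight G (f ` A))"
    by (rule sum.reindex_bij_betw[OF bij, symmetric])
  ultimately show ?thesis by (simp add: det w sum_distrib_left)
qed

end

lemma restricted_forestI:
  assumes G: "weighted_graph G" "good_embedding G" and T: "T \<in> wired_trees G D" and UD: "U \<subseteq> D"
  shows "restricted_forest G U {e \<in> T. trace G e \<subseteq> U}"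
proof (rule restricted_forest.intro[OF G])
  let ?F = "{e \<in> T. trace G e \<subseteq> U}"
  have T': "T \<subseteq> {e \<in> arcs (skel G). tail (skel G) e \<in> D}"
    "\<forall>v\<in>verts (skel G) \<inter> D. \<exists>!e. e \<in> T \<and> tail (skel G) e = v"
    using T unfolding wired_trees_iff[OF G] by simp_all
  show "e \<in> arcs (skel G) \<and> trace G e \<subseteq> U" if "e \<in> ?F" for e using that T'(1) by auto
  have uniq: "e = e'" if e: "e \<in> T" "e' \<in> T" "tail (skel G) e = tail (skel G) e'" for e e'
  proof -
    have ea: "e \<in> arcs (skel G)" "tail (skel G) e \<in> D" using e(1) T'(1) by auto
    have "\<exists>!e'. e' \<in> T \<and> tail (skel G) e' = tail (skel G) e"
      by (rule bspec[OF T'(2) IntI[OF arc_ends(3)[OF G(2,1) ea(1)] ea(2)]])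
    then show ?thesis using e by auto
  qed
  show "inj_on (tail (skel G)) ?F" by (rule inj_onI) (rule uniq, simp_all)
  fix v assume v: "v \<in> verts (skel G)"
  show "choices G U ?F v \<noteq> {}"
  proof (cases "v \<in> U")
    case True
    then obtain e where e: "e \<in> T" "tail (skel G) e = v" using T'(2) v UD by blast
    have "e \<in> ?F" if "v \<in> tail (skel G) ` ?F"
    proof -
      from that obtain e' where e': "v = tail (skel G) e'" "e' \<in> ?F" by (rule imageE)
      have "e' \<in> T" using e'(2) by simp
      have "e' = e" by (rule uniq[OF \<open>e' \<in> T\<close> e(1)]) (simp add: e(2) e'(1)[symmetric])
      then show ?thesis using e'(2) by simp
    qed
    then have "e \<in> choices G U ?F v" using e T'(1) unfolding choices_def by auto
    then show ?thesis by blast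
  next
    case False
    obtain e where e: "e \<in> out_arcs (skel G) v" using G(1) v unfolding weighted_graph_def by blast
    have "e \<notin> ?F" if "tail (skel G) e = v" for e
      using that False T'(1) arc_ends(1)[OF G(2,1), of e] by auto
    then have "v \<notin> tail (skel G) ` ?F" by blast
    moreover have "\<not> trace G e \<subseteq> U" using e False arc_ends(1)[OF G(2,1), of e] by auto
    ultimately have "e \<in> choices G U ?F v" using e unfolding choices_def by simp
    then show ?thesis by blast
  qed
qed

text \<open>The unconditioned walk as a special case; its determinants form the factor free of
  \<open>F\<close>.\<close>

lemma restricted_forest_empty:
  assumes G: "weighted_graph G" "good_embedding G"
  shows "restricted_forest G {} {}"
proof (rule restricted_forest.intro[OF G])
  fix v assume v: "v \<in> verts (skel G)"
  then obtain e where e: "e \<in> out_arcs (skel G) v" using G(1) unfolding weighted_graph_def by blast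
  then have "e \<in> choices G {} {} v" using arc_ends(1)[OF G(2,1), of e] by (auto simp: choices_def)
  then show "choices G {} {} v \<noteq> {}" by blast
qed simp_all

lemma finite_wired_trees:
  assumes G: "weighted_graph G" "good_embedding G" and fin: "finite (verts (skel G) \<inter> D)"
  shows "finite (wired_trees G D)"
proof (rule finite_subset)
  show "wired_trees G D \<subseteq> Pow (\<Union>v\<in>verts (skel G) \<inter> D. out_arcs (skel G) v)"
  proof
    fix T assume "T \<in> wired_trees G D"
    then have T: "T \<subseteq> {e \<in> arcs (skel G). tail (skel G) e \<in> D}" unfolding wired_trees_iff[OF G] by simp
    show "T \<in> Pow (\<Union>v\<in>verts (skel G) \<inter> D. out_arcs (skel G) v)"
      using T arc_ends(3)[OF G(2,1)] by fastforce
  qed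
  have "finite (out_arcs (skel G) v)" if "v \<in> verts (skel G)" for v
    using G(1) that unfolding weighted_graph_def by simp
  then show "finite (Pow (\<Union>v\<in>verts (skel G) \<inter> D. out_arcs (skel G) v))" using fin by simp
qed

text \<open>The matrix-tree theorem also provides the existence of a tree.\<close>

lemma wired_trees_nonempty:
  assumes G: "weighted_graph G" "good_embedding G" and fin: "finite (verts (skel G) \<inter> D)"
    and path: "\<And>v. v \<in> verts (skel G) \<Longrightarrow> \<exists>z. z \<notin> D \<and> (v, z) \<in> (arc_rel G (arcs (skel G)))\<^sup>*"
  shows "wired_trees G D \<noteq> {}"
proof
  assume empty: "wired_trees G D = {}"
  interpret restricted_forest G "{}" "{}" by (rule restricted_forest_empty[OF G])
  let ?V = "verts (skel G) \<inter> D"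
  interpret S: substochastic ?V "cond_kernel G {} {} D"
    by (rule substochastic_cond_kernel[OF fin]) auto
  have "vdet ?V (lap ?V (cond_kernel G {} {} D)) \<noteq> 0"
  proof (rule S.lap_nonsingular[OF order_refl])
    fix v assume v: "v \<in> ?V"
    then obtain z where z: "z \<notin> D" "(v, z) \<in> (arc_rel G (arcs (skel G)))\<^sup>*" using path by blast
    show "escapes ?V (cond_kernel G {} {} D) ?V v"
      by (rule escapes_walk[OF fin order_refl _ order_refl _ z(2) _ v]) (use z(1) in auto)
  qed
  moreover have "(\<Sum>T | T \<in> wired_trees G D \<and> {e \<in> T. trace G e \<subseteq> {}} = {}. tree_weight G T) =
    (\<Prod>v\<in>verts (skel G) \<inter> {}. cond_weight G {} {} v) * vdet ?V (lap ?V (cond_kernel G {} {} D))"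
    by (rule tree_sum[OF fin]) auto
  ultimately show False by (simp add: empty)
qed

lemma pmf_restricted_ust:
  assumes G: "weighted_graph G" and fin: "finite (wired_trees G D)" and ne: "wired_trees G D \<noteq> {}"
  shows "pmf (restricted_ust G U D) F =
      (\<Sum>T | T \<in> wired_trees G D \<and> {e \<in> T. trace G e \<subseteq> U} = F. tree_weight G T)
        / (\<Sum>T\<in>wired_trees G D. tree_weight G T)"
    and "set_pmf (restricted_ust G U D) \<subseteq> (\<lambda>T. {e \<in> T. trace G e \<subseteq> U}) ` wired_trees G D"
proof -
  let ?p = "wired_ust G D" and ?TT = "{T. T \<in> wired_trees G D \<and> {e \<in> T. trace G e \<subseteq> U} = F}"
  note pmf = pmf_wired_ust[OF G fin ne]
  have supp: "set_pmf ?p \<subseteq> wired_trees G D"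
  proof
    fix T assume "T \<in> set_pmf ?p"
    then have "pmf ?p T \<noteq> 0" by (simp add: set_pmf_iff)
    then show "T \<in> wired_trees G D" unfolding pmf by (metis (full_types))
  qed
  then show "set_pmf (restricted_ust G U D) \<subseteq> (\<lambda>T. {e \<in> T. trace G e \<subseteq> U}) ` wired_trees G D"
    unfolding restricted_ust_def set_map_pmf by (rule image_mono)
  have "pmf (restricted_ust G U D) F = measure ?p ((\<lambda>T. {e \<in> T. trace G e \<subseteq> U}) -` {F})"
    unfolding restricted_ust_def by (rule pmf_map)
  also have "\<dots> = measure ?p ?TT"
    by (rule measure_prob_cong_0) (use supp in \<open>auto simp: set_pmf_iff\<close>)
  also have "\<dots> = (\<Sum>T\<in>?TT. pmf ?p T)"
    by (rule measure_measure_pmf_finite) (use fin in simp)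
  also have "\<dots> = (\<Sum>T\<in>?TT. tree_weight G T / (\<Sum>T\<in>wired_trees G D. tree_weight G T))"
    by (intro sum.cong refl) (simp add: pmf)
  finally show "pmf (restricted_ust G U D) F =
      (\<Sum>T\<in>?TT. tree_weight G T) / (\<Sum>T\<in>wired_trees G D. tree_weight G T)"
    by (simp add: sum_divide_distrib)
qed

text \<open>Total mass one compares the unknown constants: with \<open>W\<close> the sum of
  \<open>\<bar>w x\<bar>\<close>, both \<open>\<bar>\<kappa>1\<bar> * c * W \<le> 1\<close> and
  \<open>1 \<le> \<bar>\<kappa>2\<bar> * W\<close>. This costs one factor \<open>1 / c\<close>, the
  ratio of \<open>d1\<close> and \<open>d2\<close> another.\<close>

lemma pmf_le_if_same_factor:
  fixes \<nu>1 \<nu>2 :: "'a pmf"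
  assumes S: "finite S" "set_pmf \<nu>1 \<subseteq> S" "set_pmf \<nu>2 \<subseteq> S" and c: "0 < c"
    and r1: "\<And>x. x \<in> S \<Longrightarrow> pmf \<nu>1 x = \<kappa>1 * w x * d1 x" "\<And>x. x \<in> S \<Longrightarrow> c \<le> d1 x" "\<And>x. x \<in> S \<Longrightarrow> d1 x \<le> 1"
    and r2: "\<And>x. x \<in> S \<Longrightarrow> pmf \<nu>2 x = \<kappa>2 * w x * d2 x" "\<And>x. x \<in> S \<Longrightarrow> c \<le> d2 x" "\<And>x. x \<in> S \<Longrightarrow> d2 x \<le> 1"
    and x: "x \<in> S"
  shows "pmf \<nu>1 x \<le> pmf \<nu>2 x / c^2"
proof -
  define W where "W = (\<Sum>x\<in>S. \<bar>w x\<bar>)"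
  \<comment> \<open>The signs of \<open>\<kappa>1\<close> and \<open>w x\<close> are not known
    separately, but the product is a probability.\<close>
  have a1: "pmf \<nu>1 x = \<bar>\<kappa>1\<bar> * \<bar>w x\<bar> * d1 x" if "x \<in> S" for x
  proof -
    have "pmf \<nu>1 x = \<bar>\<kappa>1 * w x * d1 x\<bar>" using r1(1)[OF that] pmf_nonneg[of \<nu>1 x] by simp
    then show ?thesis using r1(2)[OF that] c by (simp add: abs_mult)
  qed
  have a2: "pmf \<nu>2 x = \<bar>\<kappa>2\<bar> * \<bar>w x\<bar> * d2 x" if "x \<in> S" for x
  proof -
    have "pmf \<nu>2 x = \<bar>\<kappa>2 * w x * d2 x\<bar>" using r2(1)[OF that] pmf_nonneg[of \<nu>2 x] by simp
    then show ?thesis using r2(2)[OF that] c by (simp add: abs_mult)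
  qed
  have "1 = (\<Sum>x\<in>S. \<bar>\<kappa>1\<bar> * \<bar>w x\<bar> * d1 x)" using sum_pmf_eq_1[OF S(1,2)] a1 by simp
  also have "\<dots> \<ge> (\<Sum>x\<in>S. \<bar>\<kappa>1\<bar> * \<bar>w x\<bar> * c)" by (intro sum_mono mult_left_mono r1(2)) simp_all
  also have "(\<Sum>x\<in>S. \<bar>\<kappa>1\<bar> * \<bar>w x\<bar> * c) = \<bar>\<kappa>1\<bar> * c * W" by (simp add: W_def sum_distrib_left mult_ac)
  finally have k1: "\<bar>\<kappa>1\<bar> * c * W \<le> 1" .
  have "1 = (\<Sum>x\<in>S. \<bar>\<kappa>2\<bar> * \<bar>w x\<bar> * d2 x)" using sum_pmf_eq_1[OF S(1,3)] a2 by simp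
  also have "\<dots> \<le> (\<Sum>x\<in>S. \<bar>\<kappa>2\<bar> * \<bar>w x\<bar> * 1)" by (intro sum_mono mult_left_mono r2(3)) simp_all
  also have "\<dots> = \<bar>\<kappa>2\<bar> * W" by (simp add: W_def sum_distrib_left)
  finally have k2: "1 \<le> \<bar>\<kappa>2\<bar> * W" .
  have W0: "0 \<le> W" by (simp add: W_def sum_nonneg)
  have W: "0 < W" using k2 W0 by (cases "W = 0") auto
  have "\<bar>\<kappa>1\<bar> * c * W \<le> \<bar>\<kappa>2\<bar> * W" using k1 k2 by linarith
  then have k: "\<bar>\<kappa>1\<bar> * c \<le> \<bar>\<kappa>2\<bar>" using W by simp
  have "pmf \<nu>1 x * c^2 = \<bar>\<kappa>1\<bar> * c * (\<bar>w x\<bar> * c) * d1 x" by (simp add: a1[OF x] power2_eq_square mult_ac)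
  also have "\<dots> \<le> \<bar>\<kappa>1\<bar> * c * (\<bar>w x\<bar> * c) * 1" using r1(3)[OF x] c by (intro mult_left_mono) simp_all
  also have "\<dots> = \<bar>\<kappa>1\<bar> * c * (\<bar>w x\<bar> * c)" by simp
  also have "\<dots> \<le> \<bar>\<kappa>2\<bar> * (\<bar>w x\<bar> * d2 x)" using k r2(2)[OF x] c by (intro mult_mono) simp_all
  also have "\<dots> = pmf \<nu>2 x" by (simp add: a2[OF x] mult.assoc)
  finally show ?thesis using c by (simp add: field_simps)
qed

text \<open>The two inequalities make the supports equal, so the ratio is finite and bounded at
  every point charged by either law.\<close>

lemma prob_density_ratio:
  fixes \<nu>1 \<nu>2 :: "'a pmf"
  assumes K: "0 < K" and le: "\<And>x. x \<in> set_pmf \<nu>1 \<union> set_pmf \<nu>2 \<Longrightarrow> pmf \<nu>1 x \<le> K * pmf \<nu>2 x"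
    "\<And>x. x \<in> set_pmf \<nu>1 \<union> set_pmf \<nu>2 \<Longrightarrow> pmf \<nu>2 x \<le> K * pmf \<nu>1 x"
    and \<nu>: "\<nu> = \<nu>1 \<or> \<nu> = \<nu>2"
  shows "measure_pmf.prob \<nu> {x. ennreal (1 / K) \<le> density_ratio \<nu>1 \<nu>2 x \<and> density_ratio \<nu>1 \<nu>2 x \<le> ennreal K} = 1"
proof -
  let ?E = "{x. ennreal (1 / K) \<le> density_ratio \<nu>1 \<nu>2 x \<and> density_ratio \<nu>1 \<nu>2 x \<le> ennreal K}"
  have "x \<in> ?E" if x: "x \<in> set_pmf \<nu>1 \<union> set_pmf \<nu>2" for x
  proof -
    have nz: "pmf \<nu>1 x \<noteq> 0 \<or> pmf \<nu>2 x \<noteq> 0" using x by (auto simp: set_pmf_iff)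
    have nn: "0 \<le> pmf \<nu>1 x" "0 \<le> pmf \<nu>2 x" by simp_all
    have pos: "0 < pmf \<nu>2 x"
    proof (rule ccontr)
      assume "\<not> 0 < pmf \<nu>2 x"
      then have "pmf \<nu>2 x = 0" using nn by linarith
      then show False using le(1)[OF x] nz nn by simp
    qed
    have "density_ratio \<nu>1 \<nu>2 x = ennreal (pmf \<nu>1 x / pmf \<nu>2 x)"
      unfolding density_ratio_def by (rule divide_ennreal[OF nn(1) pos])
    moreover have "1 / K \<le> pmf \<nu>1 x / pmf \<nu>2 x" "pmf \<nu>1 x / pmf \<nu>2 x \<le> K"
      using le[OF x] pos K by (simp_all add: field_simps)
    ultimately show ?thesis by (simp add: ennreal_leI)
  qed
  then have "AE x in measure_pmf \<nu>. x \<in> ?E" using \<nu> unfolding AE_measure_pmf_iff by blast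
  then show ?thesis by (subst measure_pmf.prob_eq_1) simp_all
qed

section \<open>Comparison of two domains\<close>

text \<open>One mesh together with the geometry: \<open>C - I\<close> is the ring and
  \<open>W\<close> will contain both domains. By \<open>cut_I\<close> no edge jumps over the ring;
  \<open>a\<close> is the Harnack constant on the ring, and \<open>b\<close> bounds below the
  probability of getting from \<open>W - E\<close> out of \<open>W\<close> without touching
  \<open>C\<close>.\<close>

locale nested_scale = planar_walk G p0 \<eta>0 for G :: "'e plane_graph" and p0 \<eta>0 :: real +
  fixes U I C E R W :: "complex set" and a b :: real
  assumes fin: "finite (verts (skel G) \<inter> W)"
    and sets: "U \<subseteq> I" "I \<subseteq> C" "C - I \<subseteq> R" "R \<subseteq> E" "R \<inter> U = {}" "C \<subseteq> E" "E \<subseteq> W"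
    and far: "\<And>v. v \<in> verts (skel G) \<Longrightarrow> \<exists>z. z \<notin> W \<and> (v, z) \<in> (arc_rel G (arcs (skel G)))\<^sup>*"
    and cut_I: "\<And>e. e \<in> arcs (skel G) \<Longrightarrow> tail (skel G) e \<in> I \<Longrightarrow> head (skel G) e \<in> C"
      "\<And>e. e \<in> arcs (skel G) \<Longrightarrow> head (skel G) e \<in> I \<Longrightarrow> tail (skel G) e \<in> C"
    and a: "0 < a" and harnack: "\<And>h s s'. superharmonic_on G R h \<Longrightarrow>
      (\<And>w. w \<in> verts (skel G) \<inter> R \<Longrightarrow> h w \<le> (\<Sum>e\<in>out_arcs (skel G) w. norm_weight G e * h (head (skel G) e))) \<Longrightarrow>
      s \<in> verts (skel G) \<inter> (C - I) \<Longrightarrow> s' \<in> verts (skel G) \<inter> (C - I) \<Longrightarrow> a * h s' \<le> h s"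
    and b: "0 < b" "b \<le> 1" and escape: "\<And>h s. superharmonic_on G (- C) h \<Longrightarrow>
      (\<And>v. v \<in> verts (skel G) - W \<Longrightarrow> 1 \<le> h v) \<Longrightarrow> s \<in> verts (skel G) \<inter> (W - E) \<Longrightarrow> b \<le> h s"
begin

text \<open>The part of the determinant that lives off \<open>C\<close>, where the conditioning is
  not felt; hence the empty \<open>U\<close> and \<open>F\<close>.\<close>

definition outer_factor :: "complex set \<Rightarrow> real" where
  "outer_factor D = (let V = verts (skel G) \<inter> W; P = cond_kernel G {} {} D
     in vdet V (lap (V - C) P) / vdet V (lap (V - C - (V - E)) P))"

text \<open>The decoupling with inner part in \<open>I\<close>, ring \<open>C - I\<close>, outer
  part off \<open>C\<close> and far part off \<open>E\<close>. The domain \<open>D'\<close> of the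
  tree that witnesses \<open>F\<close> may differ from \<open>D\<close>.\<close>

lemma restricted_kernel_decoupling:
  assumes UD: "U \<subseteq> D" and D: "D \<subseteq> W" "E \<subseteq> D" "E \<subseteq> D'"
    and tr: "\<And>v e. v \<in> E \<Longrightarrow> e \<in> out_arcs (skel G) v \<Longrightarrow> trace G e \<subseteq> D \<inter> D'"
    and T: "T \<in> wired_trees G D'" "{e \<in> T. trace G e \<subseteq> U} = F"
  defines "V \<equiv> verts (skel G) \<inter> W" and "P \<equiv> cond_kernel G U F D"
  shows "\<exists>d. exp (- ((1 / a) / b^2)) \<le> d \<and> d \<le> 1 \<and>
    vdet V (lap V P) = outer_factor D * vdet V (lap (V \<inter> E) P) * d"
proof -
  have UD': "U \<subseteq> D'" using sets D(3) by blast
  interpret restricted_forest G U F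
    using restricted_forestI[OF graph embedding T(1) UD'] unfolding T(2) .
  have finV: "finite V" unfolding V_def by (rule fin)
  have VD: "verts (skel G) \<inter> D \<subseteq> V" using D(1) by (auto simp: V_def)
  have Vv: "V \<subseteq> verts (skel G)" by (simp add: V_def)
  interpret S: substochastic V P unfolding P_def by (rule substochastic_cond_kernel[OF finV VD Vv])
  define Q where "Q = V - C"
  define B where "B = V - E"
  have OU: "Q \<inter> U = {}" using sets by (auto simp: Q_def)
  have BO: "B \<subseteq> Q" using sets(6) by (auto simp: B_def Q_def)
  have VB: "V - B = V \<inter> E" by (auto simp: B_def)
  have Pz: "P v w = 0" if "\<And>e. e \<in> arcs (skel G) \<Longrightarrow> tail (skel G) e = v \<Longrightarrow> head (skel G) e \<noteq> w" for v w
  proof -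
    have "head (skel G) e \<noteq> w" if "e \<in> choices G U F v" for e
      using that choicesD(1,2) \<open>\<And>e. e \<in> arcs (skel G) \<Longrightarrow> tail (skel G) e = v \<Longrightarrow> head (skel G) e \<noteq> w\<close> by blast
    then show ?thesis unfolding P_def cond_kernel_def by (simp add: sum.neutral)
  qed
  \<comment> \<open>Off \<open>C\<close> there is no conditioning, and a path out of
    \<open>W\<close> certifies escape; in \<open>E\<close> the certificate has to come from the
    tree.\<close>
  have escO: "escapes V P Q v" if v: "v \<in> Q" for v
  proof -
    have "v \<in> verts (skel G)" using v by (simp add: Q_def V_def)
    from far[OF this] obtain z where z: "z \<notin> W" "(v, z) \<in> (arc_rel G (arcs (skel G)))\<^sup>*" by blast
    show ?thesis
      unfolding P_def by (rule escapes_walk[OF finV VD Vv _ OU z(2) _ v]) (use z(1) in \<open>auto simp: Q_def V_def\<close>)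
  qed
  have escE: "escapes V P A v" if A: "A \<subseteq> V \<inter> E" "v \<in> A" for A v
    unfolding P_def
  proof (rule escapes_tree[OF finV VD Vv _ _ _ _ T A(2)])
    show "A \<subseteq> V" "A \<subseteq> D" "A \<subseteq> D'" using A(1) D(2,3) by blast+
    show "trace G e \<subseteq> D \<inter> D'" if "v \<in> A" "e \<in> out_arcs (skel G) v" for v e
      using tr[OF _ that(2)] that(1) A(1) by blast
  qed
  have row: "(\<Sum>w\<in>V. P v w * h w) =
      (\<Sum>e\<in>out_arcs (skel G) v. if trace G e \<subseteq> D then norm_weight G e * h (head (skel G) e) else 0)"
    if v: "v \<in> verts (skel G)" "v \<in> D" "v \<notin> U" for v and h :: "complex \<Rightarrow> real"
    unfolding P_def sum_cond_kernel[OF finV VD v(2)] choices_outside[OF v(3)] cond_weight_outside[OF v(1,3)]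
      div_by_1 by (rule refl)
  have nw: "0 \<le> norm_weight G e" if "e \<in> out_arcs (skel G) v" for e v
    using norm_weight_pos[OF graph, of e] that by simp
  have fo: "finite (out_arcs (skel G) v)" if "v \<in> verts (skel G)" for v
    using graph that unfolding weighted_graph_def by simp
  have "\<exists>d. exp (- ((1 / a) / (1 - (1 - b))^2)) \<le> d \<and> d \<le> 1 \<and>
    vdet V (lap V P) * vdet V (lap (Q - B) P) = vdet V (lap Q P) * vdet V (lap (V - B) P) * d"
  proof (rule S.vdet_decoupling[of "V \<inter> I" "V \<inter> (C - I)" Q])
    show "V = V \<inter> I \<union> V \<inter> (C - I) \<union> Q" using sets(2) by (auto simp: Q_def)
    show "V \<inter> I \<inter> (V \<inter> (C - I)) = {}" by blast
    show "V \<inter> I \<inter> Q = {}" using sets(2) by (auto simp: Q_def)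
    show "V \<inter> (C - I) \<inter> Q = {}" by (auto simp: Q_def)
    show "B \<subseteq> Q" by (rule BO)
    show "P v w = 0" if "v \<in> V \<inter> I" "w \<in> Q" for v w
      by (rule Pz) (use that cut_I(1) in \<open>auto simp: Q_def\<close>)
    show "P v w = 0" if "v \<in> Q" "w \<in> V \<inter> I" for v w
      by (rule Pz) (use that cut_I(2) in \<open>auto simp: Q_def\<close>)
    show "escapes V P (V \<inter> I) v" if "v \<in> V \<inter> I" for v
      by (rule escE[OF _ that]) (use sets in blast)
    show "escapes V P Q v" if "v \<in> Q" for v by (rule escO[OF that])
    show "escapes V P (V - B) v" if "v \<in> V - B" for v
      by (rule escE[OF _ that]) (simp add: VB)
    show "0 \<le> 1 / a" "0 \<le> 1 - b" "1 - b < 1" using a b by simp_all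
  next
    fix h s s'
    assume h0: "\<And>v. v \<in> V \<Longrightarrow> 0 \<le> h v" and hP: "\<And>v. v \<in> V - B \<Longrightarrow> h v = (\<Sum>w\<in>V. P v w * h w)"
      and s: "s \<in> V \<inter> (C - I)" "s' \<in> V \<inter> (C - I)"
    \<comment> \<open>Edges from \<open>R\<close> are drawn in \<open>D\<close> and end in
      \<open>V\<close>, so on \<open>R\<close> the extension by zero is harmonic for the
      unrestricted walk.\<close>
    define k where "k v = (if v \<in> V then h v else 0)" for v
    have kk: "k w = (\<Sum>e\<in>out_arcs (skel G) w. norm_weight G e * k (head (skel G) e))"
      if w: "w \<in> verts (skel G) \<inter> R" for w
    proof -
      have wE: "w \<in> E" and wU: "w \<notin> U" using w sets by auto
      have wV: "w \<in> V - B" using w wE sets(7) by (auto simp: V_def B_def)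
      have "k w = (\<Sum>u\<in>V. P w u * h u)" using wV hP[OF wV] by (simp add: k_def)
      also have "\<dots> = (\<Sum>u\<in>V. P w u * k u)" by (intro sum.cong refl) (simp add: k_def)
      also have "\<dots> = (\<Sum>e\<in>out_arcs (skel G) w. if trace G e \<subseteq> D then norm_weight G e * k (head (skel G) e) else 0)"
        by (rule row) (use w wE wU D(2) in auto)
      also have "\<dots> = (\<Sum>e\<in>out_arcs (skel G) w. norm_weight G e * k (head (skel G) e))"
      proof (rule sum.cong[OF refl])
        fix e assume "e \<in> out_arcs (skel G) w"
        from tr[OF wE this] show "(if trace G e \<subseteq> D then norm_weight G e * k (head (skel G) e) else 0)
          = norm_weight G e * k (head (skel G) e)" by simp
      qed
      finally show ?thesis .
    qed
    have k0: "0 \<le> k v" for v using h0 by (simp add: k_def)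
    have "a * k s \<le> k s'"
    proof (rule harnack)
      show "superharmonic_on G R k"
        unfolding superharmonic_on_def
      proof (intro conjI ballI k0)
        fix w assume w: "w \<in> verts (skel G) \<inter> R"
        show "(\<Sum>e\<in>{e \<in> out_arcs (skel G) w. trace G e \<subseteq> R}. norm_weight G e * k (head (skel G) e)) \<le> k w"
          unfolding kk[OF w]
          by (rule sum_mono2[OF fo]) (use w nw k0 in \<open>auto intro: mult_nonneg_nonneg\<close>)
      qed
      show "k w \<le> (\<Sum>e\<in>out_arcs (skel G) w. norm_weight G e * k (head (skel G) e))"
        if "w \<in> verts (skel G) \<inter> R" for w by (rule eq_refl[OF kk[OF that]])
      show "s' \<in> verts (skel G) \<inter> (C - I)" "s \<in> verts (skel G) \<inter> (C - I)" using s Vv by blast+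
    qed
    then have "a * h s \<le> h s'" using s by (simp add: k_def)
    then show "h s \<le> 1 / a * h s'" using a by (simp add: field_simps)
  next
    fix u y
    assume u01: "\<And>v. v \<in> V \<Longrightarrow> 0 \<le> u v \<and> u v \<le> 1"
      and uP: "\<And>v. v \<in> V - V \<inter> (C - I) \<Longrightarrow> u v = (\<Sum>w\<in>V. P v w * u w)"
      and y: "y \<in> B"
    \<comment> \<open>With \<open>u\<close> read as a return probability, \<open>g\<close> is the
      probability of dying before the return, set to 1 off \<open>V\<close>. Leaving
      \<open>D\<close> counts as success, which makes \<open>g\<close> superharmonic off
      \<open>C\<close>.\<close>
    define g where "g v = (if v \<in> V then 1 - u v else 1)" for v
    have g01: "0 \<le> g v" "g v \<le> 1" for v using u01[of v] by (simp_all add: g_def)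
    have "b \<le> g y"
    proof (rule escape)
      show "1 \<le> g v" if "v \<in> verts (skel G) - W" for v using that by (simp add: g_def V_def)
      show "y \<in> verts (skel G) \<inter> (W - E)" using y by (auto simp: B_def V_def)
      show "superharmonic_on G (- C) g"
        unfolding superharmonic_on_def
      proof (intro conjI ballI g01(1))
        fix w assume w: "w \<in> verts (skel G) \<inter> - C"
        have wv: "w \<in> verts (skel G)" using w by simp
        let ?O = "out_arcs (skel G) w"
        have "(\<Sum>e\<in>{e \<in> ?O. trace G e \<subseteq> - C}. norm_weight G e * g (head (skel G) e)) \<le>
            (\<Sum>e\<in>?O. norm_weight G e * g (head (skel G) e))"
          by (rule sum_mono2[OF fo[OF wv]]) (use nw g01(1) in \<open>auto intro: mult_nonneg_nonneg\<close>)
        also have "\<dots> \<le> g w"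
        proof (cases "w \<in> V \<inter> D")
          case True
          have wU: "w \<notin> U" using w sets by auto
          have wV: "w \<in> V - V \<inter> (C - I)" using True w by blast
          have "u w = (\<Sum>e\<in>?O. if trace G e \<subseteq> D then norm_weight G e * u (head (skel G) e) else 0)"
            unfolding uP[OF wV] by (rule row[OF wv _ wU]) (use True in blast)
          moreover have "(\<Sum>e\<in>?O. norm_weight G e * g (head (skel G) e)) \<le>
            (\<Sum>e\<in>?O. norm_weight G e - (if trace G e \<subseteq> D then norm_weight G e * u (head (skel G) e) else 0))"
          proof (rule sum_mono)
            fix e assume e: "e \<in> ?O"
            have ea: "e \<in> arcs (skel G)" using e by simp
            show "norm_weight G e * g (head (skel G) e) \<le>
              norm_weight G e - (if trace G e \<subseteq> D then norm_weight G e * u (head (skel G) e) else 0)"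
            proof (cases "trace G e \<subseteq> D")
              case True
              have "head (skel G) e \<in> V"
                by (rule subsetD[OF VD IntI[OF arc_ends(4)[OF embedding graph ea] subsetD[OF True arc_ends(2)[OF embedding graph ea]]]])
              then show ?thesis using True by (simp add: g_def right_diff_distrib)
            next
              case False
              have "norm_weight G e * g (head (skel G) e) \<le> norm_weight G e * 1"
                by (rule mult_left_mono[OF g01(2) nw[OF e]])
              then show ?thesis using False by simp
            qed
          qed
          ultimately show ?thesis
            using True by (simp add: sum_subtractf sum_norm_weight[OF graph wv] g_def)
        next
          case False
          have "g w = 1"
          proof (cases "w \<in> V")
            case True
            then have wV: "w \<in> V - V \<inter> (C - I)" using w by blast
            have "w \<notin> D" using True False by blast
            then have "u w = 0" unfolding uP[OF wV] by (simp add: P_def cond_kernel_def)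
            then show ?thesis by (simp add: g_def)
          qed (simp add: g_def)
          moreover have "(\<Sum>e\<in>?O. norm_weight G e * g (head (skel G) e)) \<le> (\<Sum>e\<in>?O. norm_weight G e * 1)"
            by (intro sum_mono mult_left_mono g01(2) nw)
          ultimately show ?thesis by (simp add: sum_norm_weight[OF graph wv])
        qed
        finally show "(\<Sum>e\<in>{e \<in> ?O. trace G e \<subseteq> - C}. norm_weight G e * g (head (skel G) e)) \<le> g w" .
      qed
    qed
    then show "u y \<le> 1 - b" using y by (simp add: g_def B_def)
  qed
  then obtain d where d: "exp (- ((1 / a) / b^2)) \<le> d" "d \<le> 1"
    "vdet V (lap V P) * vdet V (lap (Q - B) P) = vdet V (lap Q P) * vdet V (lap (V - B) P) * d"
    by auto
  have "vdet V (lap (Q - B) P) \<noteq> 0"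
  proof (rule S.lap_nonsingular)
    show "Q - B \<subseteq> V" by (auto simp: Q_def)
    fix v assume v: "v \<in> Q - B"
    show "escapes V P (Q - B) v" by (rule escapes_subset[OF escO v Diff_subset]) (use v in blast)
  qed
  then have "vdet V (lap V P) = vdet V (lap Q P) / vdet V (lap (Q - B) P) * vdet V (lap (V \<inter> E) P) * d"
    using d(3) unfolding VB by (simp add: field_simps)
  \<comment> \<open>On rows off \<open>C\<close>, hence off \<open>U\<close>, the conditioned and
    the unconditioned kernel agree; this removes \<open>F\<close> from the outer factor.\<close>
  moreover have "lap A P = lap A (cond_kernel G {} {} D)" if A: "A \<subseteq> Q" for A
  proof -
    interpret E: restricted_forest G "{}" "{}" by (rule restricted_forest_empty[OF graph embedding])
    have "P v w = cond_kernel G {} {} D v w" if "v \<in> A" for v w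
    proof -
      have v: "v \<in> verts (skel G)" "v \<notin> U" using that A OU Vv by (auto simp: Q_def)
      have v0: "v \<notin> {}" by simp
      show ?thesis
        unfolding P_def cond_kernel_def choices_outside[OF v(2)] cond_weight_outside[OF v]
          E.choices_outside[OF v0] E.cond_weight_outside[OF v(1) v0] by (rule refl)
    qed
    then show ?thesis unfolding lap_def by (intro ext) simp
  qed
  ultimately have "vdet V (lap V P) = outer_factor D * vdet V (lap (V \<inter> E) P) * d"
    unfolding outer_factor_def Let_def V_def[symmetric] Q_def[symmetric] B_def[symmetric] by simp
  then show ?thesis using d(1,2) by blast
qed

end

section \<open>Comparison of the two laws at a fixed mesh\<close>

context nested_scale
begin

text \<open>Each mass is a constant of the domain times a weight \<open>?w F\<close> times a number
  between \<open>c\<close> and 1. The weight is written with the kernel of \<open>D1\<close>, yet is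
  common to both domains: on rows in \<open>E\<close> all edges are drawn in both, so the kernels
  agree.\<close>

lemma pmf_restricted_ust_le:
  assumes D1: "U \<subseteq> D1" "D1 \<subseteq> W" "E \<subseteq> D1" and D2: "U \<subseteq> D2" "D2 \<subseteq> W" "E \<subseteq> D2"
    and tr: "\<And>v e. v \<in> E \<Longrightarrow> e \<in> out_arcs (skel G) v \<Longrightarrow> trace G e \<subseteq> D1 \<inter> D2"
  defines "c \<equiv> exp (- ((1 / a) / b^2))" and "\<nu>1 \<equiv> restricted_ust G U D1" and "\<nu>2 \<equiv> restricted_ust G U D2"
  assumes F: "F \<in> set_pmf \<nu>1 \<union> set_pmf \<nu>2"
  shows "pmf \<nu>1 F \<le> pmf \<nu>2 F / c^2"
proof -
  define V where "V = verts (skel G) \<inter> W"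
  let ?w = "\<lambda>F. (\<Prod>v\<in>verts (skel G) \<inter> U. cond_weight G U F v) * vdet V (lap (V \<inter> E) (cond_kernel G U F D1))"
  let ?Z = "\<lambda>D. \<Sum>T\<in>wired_trees G D. tree_weight G T"
  let ?S = "set_pmf \<nu>1 \<union> set_pmf \<nu>2"
  have finV: "finite V" unfolding V_def by (rule fin)
  have trees: "finite (wired_trees G D)" "wired_trees G D \<noteq> {}" if D: "D \<subseteq> W" for D
  proof -
    have f: "finite (verts (skel G) \<inter> D)" by (rule finite_subset[OF _ fin]) (use D in blast)
    show "finite (wired_trees G D)" by (rule finite_wired_trees[OF graph embedding f])
    show "wired_trees G D \<noteq> {}"
    proof (rule wired_trees_nonempty[OF graph embedding f])
      fix v assume "v \<in> verts (skel G)"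
      from far[OF this] obtain z where "z \<notin> W" "(v, z) \<in> (arc_rel G (arcs (skel G)))\<^sup>*" by blast
      then show "\<exists>z. z \<notin> D \<and> (v, z) \<in> (arc_rel G (arcs (skel G)))\<^sup>*" using D by (intro exI[of _ z]) auto
    qed
  qed
  note pmf1 = pmf_restricted_ust[OF graph trees[OF D1(2)], of U, folded \<nu>1_def]
  note pmf2 = pmf_restricted_ust[OF graph trees[OF D2(2)], of U, folded \<nu>2_def]
  have fin1: "finite (set_pmf \<nu>1)" by (rule finite_subset[OF pmf1(2) finite_imageI[OF trees(1)[OF D1(2)]]])
  have fin2: "finite (set_pmf \<nu>2)" by (rule finite_subset[OF pmf2(2) finite_imageI[OF trees(1)[OF D2(2)]]])
  have finS: "finite ?S" using fin1 fin2 by simp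
  have rep: "\<exists>d. c \<le> d \<and> d \<le> 1 \<and> (\<Sum>T | T \<in> wired_trees G D \<and> {e \<in> T. trace G e \<subseteq> U} = F. tree_weight G T) / ?Z D
      = outer_factor D / ?Z D * ?w F * d"
    if D: "D = D1 \<or> D = D2" and F: "F \<in> ?S" for D F
  proof -
    have "\<exists>D' T. (D' = D1 \<or> D' = D2) \<and> T \<in> wired_trees G D' \<and> {e \<in> T. trace G e \<subseteq> U} = F"
      using F
    proof (elim UnE)
      assume "F \<in> set_pmf \<nu>1"
      from subsetD[OF pmf1(2) this] obtain T where "F = {e \<in> T. trace G e \<subseteq> U}" "T \<in> wired_trees G D1"
        by (rule imageE)
      then show ?thesis by (intro exI[of _ D1] exI[of _ T]) simp
    next
      assume "F \<in> set_pmf \<nu>2"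
      from subsetD[OF pmf2(2) this] obtain T where "F = {e \<in> T. trace G e \<subseteq> U}" "T \<in> wired_trees G D2"
        by (rule imageE)
      then show ?thesis by (intro exI[of _ D2] exI[of _ T]) simp
    qed
    then obtain D' T where D': "D' = D1 \<or> D' = D2" and T: "T \<in> wired_trees G D'" "{e \<in> T. trace G e \<subseteq> U} = F"
      by (elim exE conjE)
    have sub: "U \<subseteq> D" "D \<subseteq> W" "E \<subseteq> D" "U \<subseteq> D'" "E \<subseteq> D'" using D D' D1 D2 by auto
    have tr': "trace G e \<subseteq> D \<inter> D'" if "v \<in> E" "e \<in> out_arcs (skel G) v" for v e
      using tr[OF that] D D' by auto
    interpret restricted_forest G U F
      using restricted_forestI[OF graph embedding T(1) sub(4)] unfolding T(2) .
    have lapD: "lap (V \<inter> E) (cond_kernel G U F D) = lap (V \<inter> E) (cond_kernel G U F D1)"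
    proof (intro ext)
      fix v w
      have "cond_kernel G U F D v w = cond_kernel G U F D1 v w" if v: "v \<in> V \<inter> E"
      proof -
        have vD: "v \<in> D" "v \<in> D1" using v sub(3) D1(3) by blast+
        show ?thesis
          unfolding cond_kernel_def if_P[OF vD(1)] if_P[OF vD(2)]
        proof (rule sum.cong[OF refl])
          fix e assume "e \<in> choices G U F v"
          then have "e \<in> out_arcs (skel G) v" using choicesD(1,2) by simp
          then have "trace G e \<subseteq> D1 \<inter> D2" using tr v by blast
          then have "trace G e \<subseteq> D" "trace G e \<subseteq> D1" using D by blast+
          then show "(if trace G e \<subseteq> D \<and> head (skel G) e = w then norm_weight G e / cond_weight G U F v else 0)
            = (if trace G e \<subseteq> D1 \<and> head (skel G) e = w then norm_weight G e / cond_weight G U F v else 0)" by simp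
        qed
      qed
      then show "lap (V \<inter> E) (cond_kernel G U F D) v w = lap (V \<inter> E) (cond_kernel G U F D1) v w"
        by (simp add: lap_def)
    qed
    have "\<exists>d. c \<le> d \<and> d \<le> 1 \<and>
      vdet V (lap V (cond_kernel G U F D)) = outer_factor D * vdet V (lap (V \<inter> E) (cond_kernel G U F D)) * d"
      unfolding c_def V_def by (rule restricted_kernel_decoupling[OF sub(1-3,5) _ T]) (rule tr')
    then obtain d where d: "c \<le> d" "d \<le> 1"
      "vdet V (lap V (cond_kernel G U F D)) = outer_factor D * vdet V (lap (V \<inter> E) (cond_kernel G U F D)) * d"
      by (elim exE conjE)
    have "verts (skel G) \<inter> D \<subseteq> V" "V \<subseteq> verts (skel G)" using sub(2) by (auto simp: V_def)
    note ts = tree_sum[OF finV this sub(1)]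
    show ?thesis
      unfolding ts d(3) lapD by (intro exI[of _ d] conjI d(1,2)) simp
  qed
  define d where "d D F = (SOME d. c \<le> d \<and> d \<le> 1 \<and>
      (\<Sum>T | T \<in> wired_trees G D \<and> {e \<in> T. trace G e \<subseteq> U} = F. tree_weight G T) / ?Z D
      = outer_factor D / ?Z D * ?w F * d)" for D F
  have dd: "c \<le> d D F" "d D F \<le> 1"
    "(\<Sum>T | T \<in> wired_trees G D \<and> {e \<in> T. trace G e \<subseteq> U} = F. tree_weight G T) / ?Z D
      = outer_factor D / ?Z D * ?w F * d D F"
    if "D = D1 \<or> D = D2" "F \<in> ?S" for D F
    using someI_ex[OF rep[OF that], folded d_def] by blast+
  show ?thesis
  proof (rule pmf_le_if_same_factor[OF finS Un_upper1 Un_upper2 _ _ _ _ _ _ _ F])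
    show "0 < c" by (simp add: c_def)
    fix F assume F: "F \<in> ?S"
    show "pmf \<nu>1 F = outer_factor D1 / ?Z D1 * ?w F * d D1 F"
      unfolding pmf1(1) by (rule dd(3)[OF disjI1[OF refl] F])
    show "pmf \<nu>2 F = outer_factor D2 / ?Z D2 * ?w F * d D2 F"
      unfolding pmf2(1) by (rule dd(3)[OF disjI2[OF refl] F])
    show "c \<le> d D1 F" "d D1 F \<le> 1" by (rule dd[OF disjI1[OF refl] F])+
    show "c \<le> d D2 F" "d D2 F \<le> 1" by (rule dd[OF disjI2[OF refl] F])+
  qed
qed

end

text \<open>The constants are fixed by the domains and the crossing estimate. The mesh is taken
  small afterwards, so that edges are shorter than the gaps between the nested sets.\<close>

lemma restricted_ust_ratio_bounded:
  fixes G :: "real \<Rightarrow> 'e plane_graph" and U D1 D2 :: "complex set"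
  assumes graph: "\<And>\<delta>. \<delta> > 0 \<Longrightarrow> weighted_graph (G \<delta>)"
    and embedding: "\<And>\<delta>. \<delta> > 0 \<Longrightarrow> good_embedding (G \<delta>)"
    and density: "bounded_density G" and crossing: "uniform_crossing G"
    and U: "U \<noteq> {}" "bounded U" "connected U"
    and D1: "open D1" "bounded D1" "simply_connected D1"
    and D2: "open D2" "bounded D2" "simply_connected D2"
    and closure: "closure U \<subseteq> D1 \<inter> D2"
  shows "\<exists>K>0. \<exists>\<delta>1>0. \<forall>\<delta>. 0 < \<delta> \<and> \<delta> < \<delta>1 \<longrightarrow>
    (\<forall>F\<in>set_pmf (restricted_ust (G \<delta>) U D1) \<union> set_pmf (restricted_ust (G \<delta>) U D2).
      pmf (restricted_ust (G \<delta>) U D1) F \<le> K * pmf (restricted_ust (G \<delta>) U D2) F \<and>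
      pmf (restricted_ust (G \<delta>) U D2) F \<le> K * pmf (restricted_ust (G \<delta>) U D1) F)"
proof -
  have "\<exists>p c. 0 < p \<and> 0 < c \<and> (\<forall>\<delta>>0. planar_walk (G \<delta>) p (c * \<delta>))"
    by (rule uniform_crossing_planar_walk[OF crossing graph embedding])
  then obtain p c where p: "0 < p" and c: "0 < c" and walk: "\<forall>\<delta>>0. planar_walk (G \<delta>) p (c * \<delta>)"
    by (elim exE conjE)
  interpret walk_family G p c
    by (rule walk_family.intro[OF _ p c finite_verts_bounded[OF density]]) (rule walk[rule_format])
  obtain x0 where x0: "x0 \<in> U" using U(1) by blast
  \<comment> \<open>The rings are built in the component of \<open>D1 \<inter> D2\<close> around
    \<open>U\<close>; the union \<open>W\<close> is the common state space.\<close>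
  define W0 where "W0 = connected_component_set (D1 \<inter> D2) x0"
  define W where "W = D1 \<union> D2"
  have opD: "open (D1 \<inter> D2)" using D1(1) D2(1) by blast
  have W0: "open W0" "simply_connected W0" "W0 \<subseteq> D1 \<inter> D2"
    unfolding W0_def by (rule open_connected_component[OF opD], rule simply_connected_component_Int[OF D1 D2(1,3)],
      rule connected_component_subset)
  have "closure U \<subseteq> W0"
    unfolding W0_def by (rule connected_component_maximal[OF subsetD[OF closure_subset x0] connected_intermediate_closure[OF U(3) closure_subset order_refl] closure])
  from concentric_discs[OF W0(1,2) U(2,1) this]
  obtain I J C E R where I: "open I" and J: "open J" and C: "compact C" and E: "open E" and R: "open R" "connected R"
    and sub: "U \<subseteq> I" "closure I \<subseteq> J" "J \<subseteq> C" "C - I \<subseteq> R" "R \<subseteq> E" "R \<inter> U = {}" "C \<subseteq> E"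
    and cE: "compact (closure E)" "closure E \<subseteq> W0" and conC: "connected (- C)" .
  have IC: "I \<subseteq> C" using closure_subset[of I] sub(2,3) by (rule order_trans[OF order_trans])
  have ED: "closure E \<subseteq> D1 \<inter> D2" by (rule order_trans[OF cE(2) W0(3)])
  have ED': "E \<subseteq> D1" "E \<subseteq> D2" "E \<subseteq> W" using ED closure_subset[of E] by (auto simp: W_def)
  have "compact (C \<inter> closure I)" by (rule compact_Int_closed[OF C closed_closure])
  moreover have "C \<inter> closure I = closure I" using sub(2,3) by blast
  ultimately have cI: "compact (closure I)" by simp
  \<comment> \<open>Within \<open>\<epsilon>1\<close> of \<open>I\<close> one is still in
    \<open>C\<close>, within \<open>\<epsilon>2\<close> of \<open>E\<close> in both domains.\<close>
  obtain \<epsilon>1 where \<epsilon>1: "0 < \<epsilon>1" "(\<Union>x\<in>closure I. ball x \<epsilon>1) \<subseteq> J"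
    by (rule compact_subset_open_imp_ball_epsilon_subset[OF cI J sub(2)])
  obtain \<epsilon>2 where \<epsilon>2: "0 < \<epsilon>2" "(\<Union>x\<in>closure E. ball x \<epsilon>2) \<subseteq> D1 \<inter> D2"
    by (rule compact_subset_open_imp_ball_epsilon_subset[OF cE(1) opD ED])
  have bW: "bounded W" using D1(2) D2(2) by (simp add: W_def)
  then obtain r where r: "0 < r" "\<And>x. x \<in> W \<Longrightarrow> norm x \<le> r" unfolding bounded_pos by blast
  \<comment> \<open>\<open>W\<close> lies in the closed disc of radius \<open>r\<close> around the
    origin, so the unit ball around \<open>y\<close> misses it and can serve as target of the
    escape.\<close>
  define y where "y = complex_of_real (r + 1)"
  have yW: "v \<notin> W" if "v \<in> ball y 1" for v
  proof
    assume "v \<in> W"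
    have "norm y = r + 1" using r(1) by (simp add: y_def del: of_real_add)
    moreover have "norm y \<le> norm v + dist y v" unfolding dist_norm by (rule norm_triangle_sub)
    ultimately show False using r(2)[OF \<open>v \<in> W\<close>] that by simp
  qed
  have CW: "C \<subseteq> W" using sub(7) ED'(3) by (rule order_trans)
  have yC: "y \<in> - C" using yW[of y] CW by auto
  obtain a where a: "0 < a" and harnack: "\<forall>\<delta> h s s'. 0 < \<delta> \<longrightarrow> \<delta> < a \<longrightarrow> superharmonic_on (G \<delta>) R h \<longrightarrow> subharmonic_on \<delta> R h \<longrightarrow>
    s \<in> verts (skel (G \<delta>)) \<inter> (C - I) \<longrightarrow> s' \<in> verts (skel (G \<delta>)) \<inter> (C - I) \<longrightarrow> a * h s' \<le> h s"
    using harnack_compact[OF R compact_diff[OF C I] sub(4)] by (elim exE conjE)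
  have K: "compact (closure W - E)" using bW E by (intro compact_diff) simp_all
  have KC: "closure W - E \<subseteq> - C" using sub(7) by blast
  have oC: "open (- C)" by (rule open_Compl[OF compact_imp_closed[OF C]])
  obtain b where b: "0 < b" and escape: "\<forall>\<delta> h s. 0 < \<delta> \<longrightarrow> \<delta> < b \<longrightarrow> superharmonic_on (G \<delta>) (- C) h \<longrightarrow>
    (\<forall>v\<in>verts (skel (G \<delta>)) \<inter> ball y 1. 1 \<le> h v) \<longrightarrow> s \<in> verts (skel (G \<delta>)) \<inter> (closure W - E) \<longrightarrow> b \<le> h s"
    using escape_compact[OF oC conC K KC yC, of 1] by auto
  define k where "k = exp (- ((1 / a) / (min b 1)^2))"
  \<comment> \<open>\<open>120 * c * \<delta>\<close> bounds the reach of an edge and must stay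
    below both gaps; \<open>4 * c * \<delta> < 1\<close> lets \<open>reach_everywhere\<close> land
    in the unit ball around \<open>y\<close>; \<open>a\<close> and \<open>b\<close> also bound the
    mesh in their estimates.\<close>
  define \<delta>1 where "\<delta>1 = min (min a b) (min (1 / (4 * c)) (min (\<epsilon>1 / (120 * c)) (\<epsilon>2 / (120 * c))))"
  have \<delta>1: "0 < \<delta>1" using a b c \<epsilon>1(1) \<epsilon>2(1) by (simp add: \<delta>1_def)
  have UD: "U \<subseteq> D1" "U \<subseteq> D2" using closure closure_subset[of U] by auto
  have main: "pmf (restricted_ust (G \<delta>) U D1) F \<le> 1 / k^2 * pmf (restricted_ust (G \<delta>) U D2) F \<and>
      pmf (restricted_ust (G \<delta>) U D2) F \<le> 1 / k^2 * pmf (restricted_ust (G \<delta>) U D1) F"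
    if \<delta>: "0 < \<delta>" "\<delta> < \<delta>1"
      and F: "F \<in> set_pmf (restricted_ust (G \<delta>) U D1) \<union> set_pmf (restricted_ust (G \<delta>) U D2)" for \<delta> F
  proof -
    let ?G = "G \<delta>"
    interpret P: planar_walk ?G p "c * \<delta>" by (rule walk[rule_format, OF \<delta>(1)])
    have small: "\<delta> < a" "\<delta> < b" "4 * (c * \<delta>) < 1" "120 * (c * \<delta>) < \<epsilon>1" "120 * (c * \<delta>) < \<epsilon>2"
      using \<delta>(2) c unfolding \<delta>1_def by (simp_all add: field_simps)
    have tr: "trace ?G e \<subseteq> ball (tail (skel ?G) e) \<epsilon>" if "e \<in> arcs (skel ?G)" "120 * (c * \<delta>) < \<epsilon>" for e \<epsilon>
      by (rule order_trans[OF P.trace_subset_ball[OF that(1)] subset_ball]) (use that(2) in simp)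
    have hd: "dist (tail (skel ?G) e) (head (skel ?G) e) < \<epsilon>1" if "e \<in> arcs (skel ?G)" for e
      using subsetD[OF tr[OF that small(4)] arc_ends(2)[OF P.embedding P.graph that]] by simp
    have near: "w \<in> C" if "v \<in> I" "dist v w < \<epsilon>1" for v w
    proof -
      have "w \<in> (\<Union>x\<in>closure I. ball x \<epsilon>1)"
        by (rule UN_I[OF subsetD[OF closure_subset that(1)]]) (use that(2) in simp)
      from subsetD[OF sub(3) subsetD[OF \<epsilon>1(2) this]] show ?thesis .
    qed
    have trD: "trace ?G e \<subseteq> D1 \<inter> D2" if "v \<in> E" "e \<in> out_arcs (skel ?G) v" for v e
    proof -
      have e: "e \<in> arcs (skel ?G)" "tail (skel ?G) e = v" using that(2) by simp_all
      have vU: "ball v \<epsilon>2 \<subseteq> (\<Union>x\<in>closure E. ball x \<epsilon>2)" by (rule UN_upper[OF subsetD[OF closure_subset that(1)]])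
      show ?thesis by (rule order_trans[OF tr[OF e(1) small(5), unfolded e(2)] order_trans[OF vU \<epsilon>2(2)]])
    qed
    interpret N: nested_scale ?G p "c * \<delta>" U I C E R W a "min b 1"
    proof (rule nested_scale.intro[OF P.planar_walk_axioms], rule nested_scale_axioms.intro)
      show "finite (verts (skel ?G) \<inter> W)" by (rule finite_verts[OF \<delta>(1) bW])
      show "U \<subseteq> I" "I \<subseteq> C" "C - I \<subseteq> R" "R \<subseteq> E" "R \<inter> U = {}" "C \<subseteq> E" "E \<subseteq> W" by (fact sub IC ED')+
      show "\<exists>z. z \<notin> W \<and> (v, z) \<in> (arc_rel ?G (arcs (skel ?G)))\<^sup>*" if vv: "v \<in> verts (skel ?G)" for v
      proof -
        obtain z where z: "dist z y \<le> 4 * (c * \<delta>)" "(v, z) \<in> (arc_rel ?G (arcs (skel ?G)))\<^sup>*"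
          using P.reach_everywhere[OF vv, of y] by (elim bexE conjE)
        have "z \<in> ball y 1" using z(1) small(3) by (simp add: dist_commute)
        then show ?thesis using yW z(2) by blast
      qed
      show "head (skel ?G) e \<in> C" if "e \<in> arcs (skel ?G)" "tail (skel ?G) e \<in> I" for e
        by (rule near[OF that(2) hd[OF that(1)]])
      show "tail (skel ?G) e \<in> C" if "e \<in> arcs (skel ?G)" "head (skel ?G) e \<in> I" for e
        by (rule near[OF that(2)]) (use hd[OF that(1)] in \<open>simp add: dist_commute\<close>)
      show "0 < a" "0 < min b 1" "min b 1 \<le> 1" using a b by simp_all
      show "a * h s' \<le> h s"
        if "superharmonic_on ?G R h"
          "\<And>w. w \<in> verts (skel ?G) \<inter> R \<Longrightarrow> h w \<le> (\<Sum>e\<in>out_arcs (skel ?G) w. norm_weight ?G e * h (head (skel ?G) e))"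
          "s \<in> verts (skel ?G) \<inter> (C - I)" "s' \<in> verts (skel ?G) \<inter> (C - I)" for h s s'
      proof -
        have "subharmonic_on \<delta> R h" unfolding subharmonic_on_def by (intro ballI that(2))
        from harnack[rule_format, OF \<delta>(1) small(1) that(1) this that(3,4)] show ?thesis .
      qed
      show "min b 1 \<le> h s"
        if "superharmonic_on ?G (- C) h" "\<And>v. v \<in> verts (skel ?G) - W \<Longrightarrow> 1 \<le> h v"
          "s \<in> verts (skel ?G) \<inter> (W - E)" for h s
      proof -
        have 1: "\<forall>v\<in>verts (skel ?G) \<inter> ball y 1. 1 \<le> h v" using that(2) yW by blast
        have 2: "s \<in> verts (skel ?G) \<inter> (closure W - E)" using that(3) closure_subset[of W] by blast
        have "b \<le> h s" by (rule escape[THEN spec, THEN spec, THEN spec, THEN mp, THEN mp, THEN mp, THEN mp, THEN mp,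
          OF \<delta>(1) small(2) that(1) 1 2])
        then show ?thesis by simp
      qed
    qed
    have DW: "D1 \<subseteq> W" "D2 \<subseteq> W" by (simp_all add: W_def)
    have "pmf (restricted_ust ?G U D1) F \<le> pmf (restricted_ust ?G U D2) F / k^2"
      unfolding k_def by (rule N.pmf_restricted_ust_le[OF UD(1) DW(1) ED'(1) UD(2) DW(2) ED'(2) _ F]) (rule trD)
    moreover have "pmf (restricted_ust ?G U D2) F \<le> pmf (restricted_ust ?G U D1) F / k^2"
      unfolding k_def
    proof (rule N.pmf_restricted_ust_le[OF UD(2) DW(2) ED'(2) UD(1) DW(1) ED'(1)])
      show "trace ?G e \<subseteq> D2 \<inter> D1" if "v \<in> E" "e \<in> out_arcs (skel ?G) v" for v e
        using trD[OF that] by (simp add: Int_commute)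
      show "F \<in> set_pmf (restricted_ust ?G U D2) \<union> set_pmf (restricted_ust ?G U D1)" using F by (simp add: Un_commute disj_commute)
    qed
    ultimately show ?thesis by simp
  qed
  show ?thesis
  proof (rule exI[of _ "1 / k^2"], rule conjI)
    show "0 < 1 / k^2" by (simp add: k_def)
    show "\<exists>\<delta>1>0. \<forall>\<delta>. 0 < \<delta> \<and> \<delta> < \<delta>1 \<longrightarrow>
      (\<forall>F\<in>set_pmf (restricted_ust (G \<delta>) U D1) \<union> set_pmf (restricted_ust (G \<delta>) U D2).
        pmf (restricted_ust (G \<delta>) U D1) F \<le> 1 / k^2 * pmf (restricted_ust (G \<delta>) U D2) F \<and>
        pmf (restricted_ust (G \<delta>) U D2) F \<le> 1 / k^2 * pmf (restricted_ust (G \<delta>) U D1) F)"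
      by (rule exI[of _ \<delta>1], intro conjI[OF \<delta>1] allI impI ballI, elim conjE, rule main)
  qed
qed

theorem theorem1p1:
  fixes G :: "real \<Rightarrow> 'e plane_graph"
    and U D1 D2 :: "complex set"
    and \<epsilon> :: real
  assumes graph: "\<And>\<delta>. \<delta> > 0 \<Longrightarrow> weighted_graph (G \<delta>)"
    and embedding: "\<And>\<delta>. \<delta> > 0 \<Longrightarrow> good_embedding (G \<delta>)"
    and density: "bounded_density G"
    and connected: "\<And>\<delta>. \<delta> > 0 \<Longrightarrow> connected_graph (G \<delta>)"
    and crossing: "uniform_crossing G"
    and U: "open U" "bounded U" "simply_connected U"
    and D1: "open D1" "bounded D1" "simply_connected D1"
    and D2: "open D2" "bounded D2" "simply_connected D2"
    and closure: "closure U \<subseteq> D1 \<inter> D2"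
    and eps: "\<epsilon> > 0"
  shows "\<exists>C>0. \<exists>\<delta>1>0. \<forall>\<delta>. 0 < \<delta> \<and> \<delta> < \<delta>1 \<longrightarrow>
    (let \<nu>1 = restricted_ust (G \<delta>) U D1;
         \<nu>2 = restricted_ust (G \<delta>) U D2;
         E = {F. ennreal (1 / C) \<le> density_ratio \<nu>1 \<nu>2 F \<and> density_ratio \<nu>1 \<nu>2 F \<le> ennreal C}
     in measure_pmf.prob \<nu>1 E \<ge> 1 - \<epsilon> \<and> measure_pmf.prob \<nu>2 E \<ge> 1 - \<epsilon>)"
proof -
  have "\<exists>K>0. \<exists>\<delta>1>0. \<forall>\<delta>. 0 < \<delta> \<and> \<delta> < \<delta>1 \<longrightarrow>
    (\<forall>F\<in>set_pmf (restricted_ust (G \<delta>) U D1) \<union> set_pmf (restricted_ust (G \<delta>) U D2).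
      pmf (restricted_ust (G \<delta>) U D1) F \<le> K * pmf (restricted_ust (G \<delta>) U D2) F \<and>
      pmf (restricted_ust (G \<delta>) U D2) F \<le> K * pmf (restricted_ust (G \<delta>) U D1) F)"
  proof (cases "U = {}")
    case True
    \<comment> \<open>No edge fits into the empty set, so both laws sit at the empty
      configuration.\<close>
    then have "restricted_ust G' U D = return_pmf {}" for G' :: "'e plane_graph" and D
      by (simp add: restricted_ust_def)
    then show ?thesis by (intro exI[of _ 1] conjI) simp_all
  next
    case False
    show ?thesis
      by (rule restricted_ust_ratio_bounded[OF graph embedding density crossing False U(2)
        simply_connected_imp_connected[OF U(3)] D1 D2 closure])
  qed
  then obtain K \<delta>1 where K: "0 < K" "0 < \<delta>1" "\<forall>\<delta>. 0 < \<delta> \<and> \<delta> < \<delta>1 \<longrightarrow>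
    (\<forall>F\<in>set_pmf (restricted_ust (G \<delta>) U D1) \<union> set_pmf (restricted_ust (G \<delta>) U D2).
      pmf (restricted_ust (G \<delta>) U D1) F \<le> K * pmf (restricted_ust (G \<delta>) U D2) F \<and>
      pmf (restricted_ust (G \<delta>) U D2) F \<le> K * pmf (restricted_ust (G \<delta>) U D1) F)"
    by (elim exE conjE)
  show ?thesis
    unfolding Let_def
  proof (rule exI[of _ K], rule conjI[OF K(1)], rule exI[of _ \<delta>1], rule conjI[OF K(2)], intro allI impI conjI)
    fix \<delta> assume \<delta>: "0 < \<delta> \<and> \<delta> < \<delta>1"
    let ?\<nu>1 = "restricted_ust (G \<delta>) U D1" and ?\<nu>2 = "restricted_ust (G \<delta>) U D2"
    let ?E = "{F. ennreal (1 / K) \<le> density_ratio ?\<nu>1 ?\<nu>2 F \<and> density_ratio ?\<nu>1 ?\<nu>2 F \<le> ennreal K}"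
    note le = K(3)[rule_format, OF \<delta>]
    \<comment> \<open>The bounds hold at every configuration charged by either law, so the event has
      full probability.\<close>
    have "measure_pmf.prob \<nu> ?E = 1" if "\<nu> = ?\<nu>1 \<or> \<nu> = ?\<nu>2" for \<nu>
      by (rule prob_density_ratio[OF K(1) conjunct1[OF le] conjunct2[OF le] that])
    then show "1 - \<epsilon> \<le> measure_pmf.prob ?\<nu>1 ?E" "1 - \<epsilon> \<le> measure_pmf.prob ?\<nu>2 ?E"
      using eps by simp_all
  qed
qed

end
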